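(* Let $\mathbb{K}$ be an algebraically closed field of characteristic $p\ge 0$. Let $X_\sigma$ be a singular normal affine toric surface over $\mathbb{K}$ with associated continued fraction $[1,a_2,\dots,a_r]$ (so $r\ge 2$ and $a_i\ge 2$ for $2\le i\le r$). Then the normalized Nash blowup of $X_\sigma$ is smooth if and only if $[1,a_2,\dots,a_r]$ is one of the following: (1) $[1,2]$ if $r=2$; (2) $[1,2,2]$ if $r=3$; (3) $[1,2,2,2]$, $[1,2,3,2]$ or $[1,2,4,2]$ if $r=4$; (4) $[1,2,a_3,\dots,a_{r-1},2]$ if $r\ge 5$, where $(a_i,a_{i+1})\in\{(2,2),(2,3),(2,4),(3,2),(4,2)\}$ for all $3\le i\le r-2$.
   Context: Normal toric surface and its continued fraction. Let $\check\sigma\subset\mathbb{R}^2$ be a strongly convex rational polyhedral cone of dimension two. The normal toric surface $X_\sigma$ is the affine variety with coordinate ring the semigroup algebra $\mathbb{K}[\check\sigma\cap\mathbb{Z}^2]$. Concretely, if $\gamma_1,\dots,\gamma_n$ generate the semigroup $\check\sigma\cap\mathbb{Z}^2$, then $X_\sigma\subset\mathbb{K}^n$ is the zero set of the kernel of the $\mathbb{K}$-algebra homomorphism $\mathbb{K}[x_1,\dots,x_n]\to\mathbb{K}[t_1^{\pm1},t_2^{\pm1}]$, $x_i\mapsto t^{\gamma_i}$. After a unimodular change of coordinates of $\mathbb{Z}^2$ one may take $\check\sigma$ in normal form $\check\sigma=\mathbb{R}_{\ge0}\{(1,0),(P,Q)\}$ with $P,Q$ coprime and $0\le P<Q$; the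 surface is singular exactly when $P\ge1$. For $P\ge 1$, the continued fraction associated with $X_\sigma$ is the unique expansion $$\frac{P}{Q}=[a_1,a_2,\dots,a_r]:=a_1-\cfrac{1}{a_2-\cfrac{1}{\ddots-\cfrac{1}{a_r}}}$$ with $a_1=1$ and integers $a_i>1$ for $i>1$. Nash blowup. Let $X\subset\mathbb{K}^n$ be an irreducible algebraic variety of dimension $d$, and let $Gr(d,n)$ be the Grassmannian of $d$-dimensional linear subspaces of $\mathbb{K}^n$. Let $G:X\setminus\operatorname{Sing}(X)\to X\times Gr(d,n)$, $G(q)=(q,T_q(X))$, where $T_q(X)$ is the tangent space of $X$ at $q$. Let $X^*$ be the Zariski closure of the image of $G$ in $X\times Gr(d,n)$ and $\nu:X^*\to X$ the restriction of the projection. The Nash blowup of $X$ is $(X^*,\nu)$. The normalized Nash blowup of $X$ is the normalization of $X^*$ (composed with $\nu$). *)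

theory Defs
  imports
    "HOL-Analysis.Analysis"
    "HOL-Library.Poly_Mapping"
    "HOL-Library.Product_Plus"
    "HOL-Algebra.Algebraic_Closure_Type"
    "HOL-Algebra.Embedded_Algebras"
    "HOL-Algebra.Ideal_Product"
    "HOL-Algebra.QuotRing"
begin

unbundle no fps_syntax

section \<open>Rational cones in the plane and their continued fractions\<close>

definition real_vec :: "int \<times> int \<Rightarrow> real \<times> real" where
  "real_vec z = (real_of_int (fst z), real_of_int (snd z))"

definition rational_cone2 :: "(real \<times> real) set \<Rightarrow> bool" where
  "rational_cone2 C \<longleftrightarrow>
     (\<exists>S. finite S \<and> C = convex_cone hull (real_vec ` S)) \<and>
     C \<inter> uminus ` C = {0} \<and> dim C = 2"

definition lattice_points :: "(real \<times> real) set \<Rightarrow> (int \<times> int) set" where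
  "lattice_points C = {z. real_vec z \<in> C}"

definition unimodularly_equivalent :: "(real \<times> real) set \<Rightarrow> (real \<times> real) set \<Rightarrow> bool" where
  "unimodularly_equivalent C D \<longleftrightarrow>
     (\<exists>a b c d :: int. \<bar>a * d - b * c\<bar> = 1 \<and>
        (\<lambda>(x, y). (of_int a * x + of_int b * y, of_int c * x + of_int d * y)) ` C = D)"

definition cone_normal_form :: "(real \<times> real) set \<Rightarrow> int \<Rightarrow> int \<Rightarrow> bool" where
  "cone_normal_form C P Q \<longleftrightarrow>
     coprime P Q \<and> 0 \<le> P \<and> P < Q \<and>
     unimodularly_equivalent C (convex_cone hull {real_vec (1, 0), real_vec (P, Q)})"

fun neg_cfrac :: "int list \<Rightarrow> rat" where
  "neg_cfrac [] = 0"
| "neg_cfrac [a] = of_int a"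
| "neg_cfrac (a # b # as) = of_int a - 1 / neg_cfrac (b # as)"

text \<open>The normal form is not unique: exchanging the two rays replaces \<open>[1, a\<^sub>2, \<dots>, a\<^sub>r]\<close> by
  \<open>[1, a\<^sub>r, \<dots>, a\<^sub>2]\<close>.  Being associated is therefore a relation, which holds for the
  expansion obtained from any normal form of the cone.\<close>

definition associated_cfrac :: "(real \<times> real) set \<Rightarrow> int list \<Rightarrow> bool" where
  "associated_cfrac C as \<longleftrightarrow>
     (\<exists>P Q. cone_normal_form C P Q \<and> 1 \<le> P \<and>
        as \<noteq> [] \<and> hd as = 1 \<and> (\<forall>a \<in> set (tl as). 1 < a) \<and>
        neg_cfrac as = of_int P / of_int Q)"


section \<open>Affine algebraic sets\<close>

text \<open>Polynomials over \<open>'k\<close> in variables indexed by \<open>'m\<close>.\<close>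

type_synonym ('k, 'm) mpoly = "('m \<Rightarrow>\<^sub>0 nat) \<Rightarrow>\<^sub>0 'k"

definition peval :: "('k::field, 'm::finite) mpoly \<Rightarrow> 'k ^ 'm \<Rightarrow> 'k" where
  "peval f x =
     (\<Sum>m \<in> Poly_Mapping.keys f. Poly_Mapping.lookup f m * (\<Prod>i\<in>UNIV. (x $ i) ^ Poly_Mapping.lookup m i))"

definition partial_deriv :: "'m \<Rightarrow> ('k::field, 'm) mpoly \<Rightarrow> ('k, 'm) mpoly" where
  "partial_deriv i f =
     (\<Sum>m \<in> Poly_Mapping.keys f.
        Poly_Mapping.single (m - Poly_Mapping.single i 1)
          (of_nat (Poly_Mapping.lookup m i) * Poly_Mapping.lookup f m))"

definition zero_set :: "('k::field, 'm::finite) mpoly set \<Rightarrow> ('k ^ 'm) set" where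
  "zero_set S = {x. \<forall>f\<in>S. peval f x = 0}"

definition vanishing_ideal :: "('k::field ^ 'm::finite) set \<Rightarrow> ('k, 'm) mpoly set" where
  "vanishing_ideal Z = {f. \<forall>x\<in>Z. peval f x = 0}"

definition tangent_space :: "('k::field ^ 'm::finite) set \<Rightarrow> 'k ^ 'm \<Rightarrow> ('k ^ 'm) set" where
  "tangent_space V q =
     {v. \<forall>f \<in> vanishing_ideal V. (\<Sum>i\<in>UNIV. peval (partial_deriv i f) q * v $ i) = 0}"

text \<open>All varieties below are surfaces, so points are nonsingular when the tangent
  space has dimension 2.\<close>

definition singular_locus :: "('k::field ^ 'm::finite) set \<Rightarrow> ('k ^ 'm) set" where
  "singular_locus V = {q \<in> V. vec.dim (tangent_space V q) \<noteq> 2}"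


section \<open>Toric surfaces\<close>

definition toric_weight :: "('n::finite \<Rightarrow> int \<times> int) \<Rightarrow> ('n \<Rightarrow>\<^sub>0 nat) \<Rightarrow> int \<times> int" where
  "toric_weight \<gamma> m =
     (\<Sum>i\<in>UNIV. (int (Poly_Mapping.lookup m i) * fst (\<gamma> i),
                int (Poly_Mapping.lookup m i) * snd (\<gamma> i)))"

definition semigroup_generators :: "(real \<times> real) set \<Rightarrow> ('n::finite \<Rightarrow> int \<times> int) \<Rightarrow> bool" where
  "semigroup_generators C \<gamma> \<longleftrightarrow> range (toric_weight \<gamma>) = lattice_points C"

text \<open>The homomorphism \<open>x\<^sub>i \<mapsto> t\<^bsup>\<gamma> i\<^esup>\<close> into the ring of Laurent polynomials in two variables,
  i.e. the group algebra of \<open>\<int>\<^sup>2\<close>.\<close>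

definition toric_hom ::
    "('n::finite \<Rightarrow> int \<times> int) \<Rightarrow> ('k::field, 'n) mpoly \<Rightarrow> (int \<times> int \<Rightarrow>\<^sub>0 'k)" where
  "toric_hom \<gamma> f =
     (\<Sum>m \<in> Poly_Mapping.keys f. Poly_Mapping.single (toric_weight \<gamma> m) (Poly_Mapping.lookup f m))"

definition toric_surface :: "('n::finite \<Rightarrow> int \<times> int) \<Rightarrow> ('k::field ^ 'n) set" where
  "toric_surface \<gamma> = zero_set {f. toric_hom \<gamma> f = 0}"


section \<open>The Nash blowup of an affine surface\<close>

definition grassmannian2 :: "('k::field ^ 'n::finite) set set" where
  "grassmannian2 = {W. vec.subspace W \<and> vec.dim W = 2}"

text \<open>The Zariski topology and the affine charts of \<open>K\<^sup>n \<times> Gr(2,n)\<close> come from the Pluecker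
  embedding.  A plane has one vector of Pluecker coordinates for every basis, and
  these differ by nonzero factors.  The coordinates are indexed by all pairs
  \<open>(i, j)\<close>, not only by those with \<open>i < j\<close>.\<close>

definition pluecker :: "('k::field ^ 'n::finite) set \<Rightarrow> 'k ^ ('n \<times> 'n) \<Rightarrow> bool" where
  "pluecker W p \<longleftrightarrow>
     (\<exists>u v. vec.span {u, v} = W \<and> (\<forall>i j. p $ (i, j) = u $ i * v $ j - u $ j * v $ i))"

definition join_coords :: "'k ^ 'n \<Rightarrow> 'k ^ ('n \<times> 'n) \<Rightarrow> 'k ^ ('n + 'n \<times> 'n)" where
  "join_coords x p = (\<chi> s. case s of Inl i \<Rightarrow> x $ i | Inr ij \<Rightarrow> p $ ij)"

definition pluecker_homogeneous :: "('k::field, 'n::finite + 'n \<times> 'n) mpoly \<Rightarrow> bool" where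
  "pluecker_homogeneous F \<longleftrightarrow>
     (\<exists>e. \<forall>m \<in> Poly_Mapping.keys F. (\<Sum>ij\<in>UNIV. Poly_Mapping.lookup m (Inr ij)) = e)"

definition zariski_closed :: "(('k::field ^ 'n::finite) \<times> ('k ^ 'n) set) set \<Rightarrow> bool" where
  "zariski_closed Z \<longleftrightarrow>
     (\<exists>S. (\<forall>F\<in>S. pluecker_homogeneous F) \<and>
        Z = {(x, W). W \<in> grassmannian2 \<and>
               (\<forall>F\<in>S. \<forall>p. pluecker W p \<longrightarrow> peval F (join_coords x p) = 0)})"

definition gauss_graph :: "('k::field ^ 'n::finite) set \<Rightarrow> (('k ^ 'n) \<times> ('k ^ 'n) set) set" where
  "gauss_graph V = (\<lambda>q. (q, tangent_space V q)) ` (V - singular_locus V)"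

definition nash_blowup :: "('k::field ^ 'n::finite) set \<Rightarrow> (('k ^ 'n) \<times> ('k ^ 'n) set) set" where
  "nash_blowup V = (V \<times> grassmannian2) \<inter> (zariski_closed hull gauss_graph V)"

text \<open>The part of \<open>Z\<close> over the open set \<open>p\<^sub>i\<^sub>j \<noteq> 0\<close>, in the affine coordinates
  \<open>(x, p / p\<^sub>i\<^sub>j)\<close>: these identify the open set with a closed subset of affine space.\<close>

definition affine_chart ::
    "'n \<Rightarrow> 'n \<Rightarrow> (('k::field ^ 'n::finite) \<times> ('k ^ 'n) set) set \<Rightarrow> ('k ^ ('n + 'n \<times> 'n)) set" where
  "affine_chart i j Z = {join_coords x p | x W p. (x, W) \<in> Z \<and> pluecker W p \<and> p $ (i, j) = 1}"


section \<open>Normalization and smoothness\<close>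

definition fraction_rel :: "('a, 'b) ring_scheme \<Rightarrow> (('a \<times> 'a) \<times> ('a \<times> 'a)) set" where
  "fraction_rel R =
     {((a, b), (c, d)) | a b c d.
        a \<in> carrier R \<and> c \<in> carrier R \<and> b \<in> carrier R - {\<zero>\<^bsub>R\<^esub>} \<and> d \<in> carrier R - {\<zero>\<^bsub>R\<^esub>} \<and>
        a \<otimes>\<^bsub>R\<^esub> d = c \<otimes>\<^bsub>R\<^esub> b}"

definition fraction :: "('a, 'b) ring_scheme \<Rightarrow> 'a \<Rightarrow> 'a \<Rightarrow> ('a \<times> 'a) set" where
  "fraction R a b = fraction_rel R `` {(a, b)}"

definition fraction_field :: "('a, 'b) ring_scheme \<Rightarrow> ('a \<times> 'a) set ring" where
  "fraction_field R =
     \<lparr> carrier = (carrier R \<times> (carrier R - {\<zero>\<^bsub>R\<^esub>})) // fraction_rel R,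
       monoid.mult = (\<lambda>A B. \<Union>(a, b)\<in>A. \<Union>(c, d)\<in>B. fraction R (a \<otimes>\<^bsub>R\<^esub> c) (b \<otimes>\<^bsub>R\<^esub> d)),
       one = fraction R \<one>\<^bsub>R\<^esub> \<one>\<^bsub>R\<^esub>,
       ring.zero = fraction R \<zero>\<^bsub>R\<^esub> \<one>\<^bsub>R\<^esub>,
       add = (\<lambda>A B. \<Union>(a, b)\<in>A. \<Union>(c, d)\<in>B.
                fraction R (a \<otimes>\<^bsub>R\<^esub> d \<oplus>\<^bsub>R\<^esub> c \<otimes>\<^bsub>R\<^esub> b) (b \<otimes>\<^bsub>R\<^esub> d)) \<rparr>"

text \<open>The elements of \<open>L\<close> that are roots of a monic polynomial with coefficients in the
  subring \<open>A\<close>.\<close>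

definition integral_closure :: "('a, 'b) ring_scheme \<Rightarrow> 'a set \<Rightarrow> 'a set" where
  "integral_closure L A =
     {x \<in> carrier L. \<exists>f \<in> carrier (univ_poly L A).
        f \<noteq> [] \<and> Polynomials.lead_coeff f = \<one>\<^bsub>L\<^esub> \<and> ring.eval L f x = \<zero>\<^bsub>L\<^esub>}"

definition coordinate_ring :: "('k::field ^ 'm::finite) set \<Rightarrow> ('k, 'm) mpoly set ring" where
  "coordinate_ring Z = ring_of_type_algebra Quot (vanishing_ideal Z)"

definition normalization_ring ::
    "('k::field ^ 'm::finite) set \<Rightarrow> (('k, 'm) mpoly set \<times> ('k, 'm) mpoly set) set ring" where
  "normalization_ring Z =
     (let R = coordinate_ring Z; L = fraction_field R
      in L\<lparr>carrier := integral_closure L ((\<lambda>a. fraction R a \<one>\<^bsub>R\<^esub>) ` carrier R)\<rparr>)"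

definition normalization_scalars ::
    "('k::field ^ 'm::finite) set \<Rightarrow> (('k, 'm) mpoly set \<times> ('k, 'm) mpoly set) set set" where
  "normalization_scalars Z =
     (let R = coordinate_ring Z
      in range (\<lambda>c :: 'k. fraction R
           (vanishing_ideal Z +>\<^bsub>ring_of_type_algebra\<^esub> Poly_Mapping.single 0 c) \<one>\<^bsub>R\<^esub>))"

text \<open>The Zariski cotangent space \<open>M / M\<^sup>2\<close> at the maximal ideal \<open>M\<close> of \<open>B\<close> has dimension \<open>d\<close>
  over the field \<open>k \<subseteq> B\<close>.\<close>

definition cotangent_dim :: "('a, 'b) ring_scheme \<Rightarrow> 'a set \<Rightarrow> 'a set \<Rightarrow> nat \<Rightarrow> bool" where
  "cotangent_dim B k M d \<longleftrightarrow>
     (let J = ideal_prod B M M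
      in ring.dimension (B Quot J) d ((\<lambda>x. J +>\<^bsub>B\<^esub> x) ` k) ((\<lambda>x. J +>\<^bsub>B\<^esub> x) ` M))"

text \<open>For an irreducible affine surface \<open>Z\<close>: the points of its normalization are the maximal
  ideals of the integral closure of its coordinate ring in its function field.\<close>

definition smooth_normalization :: "('k::field ^ 'm::finite) set \<Rightarrow> bool" where
  "smooth_normalization Z \<longleftrightarrow>
     (\<forall>M. maximalideal M (normalization_ring Z) \<longrightarrow>
        cotangent_dim (normalization_ring Z) (normalization_scalars Z) M 2)"

text \<open>The normalization of the Nash blowup is glued from the normalizations of its nonempty
  affine charts, so it is smooth iff each of these is.\<close>

definition smooth_normalized_nash_blowup :: "('k::field ^ 'n::finite) set \<Rightarrow> bool" where
  "smooth_normalized_nash_blowup V \<longleftrightarrow>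
     (\<forall>i j. affine_chart i j (nash_blowup V) \<noteq> {} \<longrightarrow>
        smooth_normalization (affine_chart i j (nash_blowup V)))"

end

theory Submission
  imports Defs "Jordan_Normal_Form.Char_Poly"
begin

text \<open>The semigroup \<open>\<Lambda>\<close> of lattice points of the cone is governed by the lattice points
\<open>h\<^sub>0 = (1, 0)\<close>, \<open>h\<^sub>1 = (1, 1)\<close>, \<dots>, \<open>h\<^sub>r = (P, Q)\<close> on the compact part of the boundary of the
convex hull of \<open>\<Lambda> - {0}\<close>.  They satisfy \<open>h\<^bsub>m+1\<^esub> = b\<^sub>m h\<^sub>m - h\<^bsub>m-1\<^esub>\<close>, where \<open>b\<^sub>m\<close> is the entry with
zero-based index \<open>m\<close> of the continued fraction; neighbours form a lattice basis, and all \<open>h\<^sub>m\<close> are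
irreducible in \<open>\<Lambda>\<close>, so they occur among any generators \<open>\<gamma>\<close>
(locale \<open>hilbert_chain\<close>, \<open>chain_irreducible\<close>, \<open>hull_point_last\<close>).

The tangent plane at a torus point \<open>t\<close> is spanned by the two logarithmic derivatives of the
parametrization, so its Pluecker coordinates are \<open>p\<^sub>k\<^sub>l = det (\<gamma>\<^sub>k, \<gamma>\<^sub>l) t\<^bsup>\<gamma>\<^sub>k + \<gamma>\<^sub>l\<^esup>\<close>.  The torus is dense
in the Nash blowup (\<open>vanishing_on_gauss_graph\<close>: near a nonsingular point, Pluecker
coordinates of the tangent plane are polynomials in the point).  Hence the chart \<open>p\<^sub>i\<^sub>j \<noteq> 0\<close> is empty when \<open>det (\<gamma>\<^sub>i, \<gamma>\<^sub>j)\<close> vanishes in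
the field, and otherwise its coordinate ring is the algebra of the semigroup \<open>S\<close> generated by all
\<open>\<gamma>\<^sub>k\<close> and all \<open>\<gamma>\<^sub>k + \<gamma>\<^sub>l - \<gamma>\<^sub>i - \<gamma>\<^sub>j\<close> with \<open>det (\<gamma>\<^sub>k, \<gamma>\<^sub>l) \<noteq> 0\<close> in the field
(\<open>vanishing_ideal_chart\<close>, \<open>range_chart_hom\<close>).  Its normalization is the algebra of the saturation
of \<open>S\<close> (\<open>chart_smooth_iff\<close>).

A saturated semigroup of full rank has a smooth algebra if it contains a line
(\<open>smooth_if_line\<close>).  If instead it spans a pointed cone, the algebra is smooth exactly when the
primitive edge vectors of the cone form a lattice basis (\<open>smooth_if_basis\<close>,
\<open>not_smooth_if_index\<close>): otherwise there are three irreducible elements, and the cotangent space at the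
torus fixed point is too large (\<open>three_irreducibles_singular\<close>).

It remains to compare the charts with \<open>u = \<gamma>\<^sub>i + \<gamma>\<^sub>j\<close>.  If \<open>u\<close> is not of the form \<open>h\<^sub>m + h\<^bsub>m+1\<^esub>\<close>,
its semigroup contains a line (\<open>chart_cases\<close>).  If \<open>u = h\<^sub>m + h\<^bsub>m+1\<^esub>\<close>, the cone of the chart is bounded
by \<open>h\<^bsub>m-1\<^esub> - h\<^bsub>m+1\<^esub> = b\<^sub>m h\<^sub>m - 2 h\<^bsub>m+1\<^esub>\<close> (by \<open>h\<^sub>0\<close> when \<open>m = 0\<close>) and by
\<open>h\<^bsub>m+2\<^esub> - h\<^sub>m = b\<^bsub>m+1\<^esub> h\<^bsub>m+1\<^esub> - 2 h\<^sub>m\<close> (by \<open>h\<^sub>r\<close> when \<open>m + 1 = r\<close>).  Dividing these vectors by the gcd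
of their coefficients and taking the determinant gives a number that is \<open>0\<close> for
\<open>(b\<^sub>m, b\<^bsub>m+1\<^esub>) = (2, 2)\<close>, where the two vectors are opposite, is \<open>1\<close> for \<open>(2, 3)\<close>, \<open>(2, 4)\<close>, \<open>(3, 2)\<close> and
\<open>(4, 2)\<close>, and is at least \<open>2\<close> otherwise (\<open>edge_coeff_pair\<close>); at the two ends it is \<open>1\<close>
exactly when the entry involved is \<open>2\<close>.  Neighbours have determinant \<open>1\<close>, so these charts are nonempty in every
characteristic, and collecting their conditions for \<open>m < r\<close> gives the four cases of the theorem.\<close>

section \<open>Evaluating elements of a monoid algebra\<close>

text \<open>Polynomials and Laurent polynomials are both finitely supported functions on exponents.  Evaluation
at a point, substitution and the monomial parametrizations below all have this form, with \<open>h\<close>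
acting on coefficients and \<open>\<mu>\<close> on monomials.\<close>

definition lin_ext :: "('k::comm_ring_1 \<Rightarrow> 'r::comm_ring_1) \<Rightarrow> ('m \<Rightarrow> 'r) \<Rightarrow> ('m \<Rightarrow>\<^sub>0 'k) \<Rightarrow> 'r" where
  "lin_ext h \<mu> f = (\<Sum>m\<in>Poly_Mapping.keys f. h (Poly_Mapping.lookup f m) * \<mu> m)"

lemma pm_sum_singles:
  fixes f :: "'m \<Rightarrow>\<^sub>0 'k::comm_monoid_add"
  shows "f = (\<Sum>m\<in>Poly_Mapping.keys f. Poly_Mapping.single m (Poly_Mapping.lookup f m))"
  by (rule poly_mapping_eqI)
    (simp add: lookup_sum lookup_single when_def in_keys_iff)

lemma pm_induct [case_names zero single add]:
  fixes f :: "'m \<Rightarrow>\<^sub>0 'k::comm_monoid_add"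
  assumes "P 0" "\<And>m c. P (Poly_Mapping.single m c)" "\<And>f g. P f \<Longrightarrow> P g \<Longrightarrow> P (f + g)"
  shows "P f"
proof -
  have "P (\<Sum>m\<in>A. Poly_Mapping.single m (Poly_Mapping.lookup f m))" if "finite A" for A
    using that by induction (auto intro: assms)
  from this[OF finite_keys] show ?thesis using pm_sum_singles[of f] by metis
qed

text \<open>The induction that keeps track of a set \<open>S\<close> of allowed exponents; it serves the functions on a
  surface whose exponents form a semigroup \<open>S\<close>.\<close>

lemma pm_induct_on [consumes 1, case_names zero single add]:
  fixes f :: "'m \<Rightarrow>\<^sub>0 'k::comm_monoid_add"
  assumes "Poly_Mapping.keys f \<subseteq> S" "P 0"
    and "\<And>m c. m \<in> S \<Longrightarrow> P (Poly_Mapping.single m c)"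
    and "\<And>f g. Poly_Mapping.keys f \<subseteq> S \<Longrightarrow> Poly_Mapping.keys g \<subseteq> S \<Longrightarrow> P f \<Longrightarrow> P g \<Longrightarrow> P (f + g)"
  shows "P f"
proof -
  have "P (\<Sum>m\<in>A. Poly_Mapping.single m (Poly_Mapping.lookup f m)) \<and>
     Poly_Mapping.keys (\<Sum>m\<in>A. Poly_Mapping.single m (Poly_Mapping.lookup f m)) \<subseteq> S"
    if "finite A" "A \<subseteq> S" for A
    using that
  proof induction
    case empty then show ?case using assms(2) by simp
  next
    case (insert x F)
    let ?t = "Poly_Mapping.single x (Poly_Mapping.lookup f x)"
    let ?s = "\<Sum>m\<in>F. Poly_Mapping.single m (Poly_Mapping.lookup f m)"
    have IH: "P ?s" "Poly_Mapping.keys ?s \<subseteq> S" using insert by auto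
    have t: "Poly_Mapping.keys ?t \<subseteq> S" "P ?t"
      using insert.prems assms(3) by (auto split: if_splits)
    have "P (?t + ?s)" by (rule assms(4)[OF t(1) IH(2) t(2) IH(1)])
    moreover have "Poly_Mapping.keys (?t + ?s) \<subseteq> S"
      using keys_add[of ?t ?s] t(1) IH(2) by blast
    ultimately show ?case using insert.hyps by simp
  qed
  from this[OF finite_keys assms(1)] show ?thesis using pm_sum_singles[of f] by metis
qed

lemma lin_ext_superset:
  assumes "finite A" "Poly_Mapping.keys f \<subseteq> A" "h 0 = 0"
  shows "lin_ext h \<mu> f = (\<Sum>m\<in>A. h (Poly_Mapping.lookup f m) * \<mu> m)"
  unfolding lin_ext_def
  by (rule sum.mono_neutral_left) (use assms in \<open>auto simp: in_keys_iff\<close>)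

lemma lin_ext_zero [simp]: "lin_ext h \<mu> 0 = 0"
  by (simp add: lin_ext_def)

lemma lin_ext_single: "h 0 = 0 \<Longrightarrow> lin_ext h \<mu> (Poly_Mapping.single m c) = h c * \<mu> m"
  by (subst lin_ext_superset[of "{m}"]) auto

lemma lin_ext_add:
  assumes "\<And>a b. h (a + b) = h a + h b"
  shows "lin_ext h \<mu> (f + g) = lin_ext h \<mu> f + lin_ext h \<mu> g"
proof -
  have h0: "h 0 = 0" using assms[of 0 0] by simp
  let ?A = "Poly_Mapping.keys f \<union> Poly_Mapping.keys g"
  show ?thesis
    using keys_add[of f g]
    by (subst (1 2 3) lin_ext_superset[where A = ?A])
      (auto simp: h0 lookup_add assms algebra_simps sum.distrib)
qed

locale monomial_eval =
  fixes h :: "'k::comm_ring_1 \<Rightarrow> 'r::comm_ring_1" and \<mu> :: "'m::comm_monoid_add \<Rightarrow> 'r"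
  assumes h_add: "h (a + b) = h a + h b" and h_mult: "h (a * b) = h a * h b" and h_one: "h 1 = 1"
    and mu_zero: "\<mu> 0 = 1" and mu_add: "\<mu> (m + n) = \<mu> m * \<mu> n"
begin

lemma h_zero: "h 0 = 0" using h_add[of 0 0] by simp

lemma eval_add: "lin_ext h \<mu> (f + g) = lin_ext h \<mu> f + lin_ext h \<mu> g"
  by (rule lin_ext_add) (rule h_add)

lemma eval_single: "lin_ext h \<mu> (Poly_Mapping.single m c) = h c * \<mu> m"
  by (rule lin_ext_single) (rule h_zero)

lemma eval_one: "lin_ext h \<mu> 1 = 1"
  using eval_single[of 0 1] by (simp add: h_one mu_zero)

lemma eval_mult: "lin_ext h \<mu> (f * g) = lin_ext h \<mu> f * lin_ext h \<mu> g"
proof (induction f rule: pm_induct)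
  case (single m c)
  show ?case
    by (induction g rule: pm_induct)
      (simp_all add: mult_single eval_single eval_add h_mult mu_add algebra_simps)
qed (simp_all add: eval_add algebra_simps)

lemma eval_sum: "lin_ext h \<mu> (sum f A) = (\<Sum>a\<in>A. lin_ext h \<mu> (f a))"
  by (induction A rule: infinite_finite_induct) (simp_all add: eval_add)

lemma eval_prod: "lin_ext h \<mu> (prod f A) = (\<Prod>a\<in>A. lin_ext h \<mu> (f a))"
  by (induction A rule: infinite_finite_induct) (simp_all add: eval_one eval_mult)

lemma eval_power: "lin_ext h \<mu> (f ^ n) = lin_ext h \<mu> f ^ n"
  by (induction n) (simp_all add: eval_one eval_mult)

lemma eval_uminus: "lin_ext h \<mu> (- f) = - lin_ext h \<mu> f"
  using eval_add[of f "- f"] by (simp add: eq_neg_iff_add_eq_0 add.commute)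

lemma eval_diff: "lin_ext h \<mu> (f - g) = lin_ext h \<mu> f - lin_ext h \<mu> g"
  using eval_add[of f "- g"] by (simp add: eval_uminus)

end

section \<open>Laurent polynomials in two variables\<close>

type_synonym 'k laurent = "int \<times> int \<Rightarrow>\<^sub>0 'k"

definition tpow :: "'a::field \<times> 'a \<Rightarrow> int \<times> int \<Rightarrow> 'a" where
  "tpow s m = fst s powi fst m * snd s powi snd m"

lemma tpow_zero [simp]: "tpow s 0 = 1" by (simp add: tpow_def)

lemma tpow_add: "fst s \<noteq> 0 \<Longrightarrow> snd s \<noteq> 0 \<Longrightarrow> tpow s (m + n) = tpow s m * tpow s n"
  by (simp add: tpow_def power_int_add)

lemma tpow_nonzero: "fst s \<noteq> 0 \<Longrightarrow> snd s \<noteq> 0 \<Longrightarrow> tpow s m \<noteq> 0"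
  by (simp add: tpow_def)

abbreviation torus_eval :: "'k::field \<times> 'k \<Rightarrow> 'k laurent \<Rightarrow> 'k" where
  "torus_eval s \<equiv> lin_ext (\<lambda>c. c) (tpow s)"

lemma monomial_eval_torus:
  fixes s :: "'k::field \<times> 'k"
  shows "fst s \<noteq> 0 \<Longrightarrow> snd s \<noteq> 0 \<Longrightarrow> monomial_eval (\<lambda>c. c) (tpow s)"
  by unfold_locales (auto simp: tpow_add)

text \<open>The function field of the torus.  The variable of the inner polynomials is the first coordinate, that
of the outer polynomials the second one.\<close>

type_synonym 'k rat_fun = "'k poly poly fract"

definition const_fun :: "'k::field \<Rightarrow> 'k rat_fun" where
  "const_fun c = to_fract [:[:c:]:]"

definition var_x :: "'k::field rat_fun" where "var_x = to_fract [:[:0, 1:]:]"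
definition var_y :: "'k::field rat_fun" where "var_y = to_fract [:0, 1:]"

lemma var_nonzero [simp]: "var_x \<noteq> 0" "var_y \<noteq> 0"
  by (simp_all add: var_x_def var_y_def)

definition emb :: "'k::field laurent \<Rightarrow> 'k rat_fun" where
  "emb = lin_ext const_fun (tpow (var_x, var_y))"

interpretation emb: monomial_eval const_fun "tpow (var_x, var_y)"
  by unfold_locales
    (auto simp: tpow_add const_fun_def one_pCons[symmetric] simp flip: to_fract_add to_fract_mult)

lemmas emb_simps = emb.eval_add[folded emb_def] emb.eval_mult[folded emb_def]
  emb.eval_one[folded emb_def] emb.eval_uminus[folded emb_def] emb.eval_diff[folded emb_def]
  emb.eval_sum[folded emb_def] emb.eval_prod[folded emb_def] emb.eval_power[folded emb_def]

lemma emb_zero [simp]: "emb 0 = 0" by (simp add: emb_def)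

lemma emb_single: "emb (Poly_Mapping.single m c) = const_fun c * tpow (var_x, var_y) m"
  by (simp add: emb_def emb.eval_single)

subsection \<open>Clearing denominators\<close>

definition eval2 :: "'k::comm_ring_1 poly poly \<Rightarrow> 'k \<Rightarrow> 'k \<Rightarrow> 'k" where
  "eval2 p c d = poly (poly p [:d:]) c"

lemma eval2_simps [simp]:
  "eval2 (p + q) c d = eval2 p c d + eval2 q c d"
  "eval2 (p * q) c d = eval2 p c d * eval2 q c d"
  "eval2 (p - q) c d = eval2 p c d - eval2 q c d"
  "eval2 0 c d = 0" "eval2 1 c d = 1" "eval2 (p ^ n) c d = eval2 p c d ^ n"
  by (simp_all add: eval2_def)

lemma eval2_sum: "eval2 (sum f A) c d = (\<Sum>a\<in>A. eval2 (f a) c d)"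
  by (induction A rule: infinite_finite_induct) simp_all

lemma eval2_pCons: "eval2 (pCons a p) c d = poly a c + d * eval2 p c d"
  by (simp add: eval2_def)

lemma eval2_monom: "eval2 (Polynomial.monom (Polynomial.monom a i) j) c d = a * c ^ i * d ^ j"
  by (simp add: eval2_def poly_monom)

text \<open>The polynomial \<open>(x y)\<^sup>N F\<close>.  Only for \<open>exps_ge N F\<close> are the shifted exponents nonnegative, so that
\<open>nat\<close> does not truncate them.\<close>

definition shift_poly :: "nat \<Rightarrow> 'k::field laurent \<Rightarrow> 'k poly poly" where
  "shift_poly N F = (\<Sum>m\<in>Poly_Mapping.keys F.
     Polynomial.monom (Polynomial.monom (Poly_Mapping.lookup F m) (nat (fst m + int N))) (nat (snd m + int N)))"

definition exps_ge :: "nat \<Rightarrow> 'k::zero laurent \<Rightarrow> bool" where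
  "exps_ge N F \<longleftrightarrow> (\<forall>m\<in>Poly_Mapping.keys F. - int N \<le> fst m \<and> - int N \<le> snd m)"

lemma exps_ge_exists: "\<exists>N. exps_ge N (F :: 'k::zero laurent)"
proof -
  let ?N = "\<Sum>m\<in>Poly_Mapping.keys F. nat \<bar>fst m\<bar> + nat \<bar>snd m\<bar>"
  have "nat \<bar>fst m\<bar> + nat \<bar>snd m\<bar> \<le> ?N" if "m \<in> Poly_Mapping.keys F" for m
    by (rule member_le_sum) (use that in auto)
  then have "nat \<bar>fst m\<bar> \<le> ?N \<and> nat \<bar>snd m\<bar> \<le> ?N" if "m \<in> Poly_Mapping.keys F" for m
    using that by fastforce
  then have "- int ?N \<le> fst m \<and> - int ?N \<le> snd m" if "m \<in> Poly_Mapping.keys F" for m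
    using that by (meson abs_le_D2 minus_le_iff nat_le_iff)
  then show ?thesis unfolding exps_ge_def by blast
qed

lemma exps_ge_mono: "exps_ge N F \<Longrightarrow> N \<le> N' \<Longrightarrow> exps_ge N' F"
  unfolding exps_ge_def by force

lemma tpow_shift:
  fixes x y :: "'a::field"
  assumes "x \<noteq> 0" "y \<noteq> 0" "- int N \<le> fst m" "- int N \<le> snd m"
  shows "tpow (x, y) m * (x * y) ^ N = x ^ nat (fst m + int N) * y ^ nat (snd m + int N)"
proof -
  have *: "z powi k * z ^ N = z ^ nat (k + int N)" if "z \<noteq> 0" "- int N \<le> k" for z :: 'a and k :: int
  proof -
    have "z powi k * z ^ N = z powi (k + int N)"
      using that by (simp add: power_int_add)
    also have "\<dots> = z ^ nat (k + int N)"
      using that(2) by (simp add: power_int_def)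
    finally show ?thesis .
  qed
  have "tpow (x, y) m * (x * y) ^ N = (x powi fst m * x ^ N) * (y powi snd m * y ^ N)"
    by (simp add: tpow_def power_mult_distrib)
  then show ?thesis using *[OF assms(1,3)] *[OF assms(2,4)] by simp
qed

lemma emb_shift:
  assumes "exps_ge N F"
  shows "emb F * (var_x * var_y) ^ N = to_fract (shift_poly N F)"
proof -
  have sumf: "to_fract (sum f A) = (\<Sum>a\<in>A. to_fract (f a))" for f :: "'b \<Rightarrow> 'a poly poly" and A
    by (induction A rule: infinite_finite_induct) simp_all
  have powf: "to_fract (p ^ n) = to_fract p ^ n" for p :: "'a poly poly" and n
    by (induction n) simp_all
  have mon: "const_fun c * (var_x ^ i * var_y ^ j) = to_fract (Polynomial.monom (Polynomial.monom c i) j)" for c :: 'a and i j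
  proof -
    have "Polynomial.monom (Polynomial.monom c i) j = [:[:c:]:] * ([:[:0,1:]:] ^ i * [:0,1:] ^ j)"
    proof -
      have "[:[:0,1:]:] ^ i = [:[:0,1::'a:] ^ i:]" by (induction i) (simp_all add: mult.commute one_pCons)
      moreover have "Polynomial.monom c i = Polynomial.smult c ([:0,1:] ^ i)" by (simp add: monom_altdef)
      moreover have "Polynomial.monom (Polynomial.monom c i) j = Polynomial.smult (Polynomial.monom c i) ([:0,1:] ^ j)" by (simp add: monom_altdef)
      ultimately show ?thesis by simp
    qed
    then show ?thesis
      unfolding const_fun_def var_x_def var_y_def by (simp only: to_fract_mult powf)
  qed
  show ?thesis
    unfolding emb_def lin_ext_def shift_poly_def sumf sum_distrib_right
  proof (rule sum.cong[OF refl])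
    fix m assume "m \<in> Poly_Mapping.keys F"
    then have ge: "- int N \<le> fst m" "- int N \<le> snd m" using assms by (auto simp: exps_ge_def)
    show
      "const_fun (Poly_Mapping.lookup F m) * tpow (var_x, var_y) m * (var_x * var_y) ^ N =
       to_fract (Polynomial.monom (Polynomial.monom (Poly_Mapping.lookup F m) (nat (fst m + int N))) (nat (snd m + int N)))"
      by (simp only: mult.assoc tpow_shift[OF var_nonzero ge] mon[symmetric])
  qed
qed

lemma torus_eval_shift:
  assumes "exps_ge N F" "fst s \<noteq> 0" "snd s \<noteq> 0"
  shows "torus_eval s F * (fst s * snd s) ^ N = eval2 (shift_poly N F) (fst s) (snd s)"
  unfolding lin_ext_def shift_poly_def eval2_sum sum_distrib_right
proof (rule sum.cong[OF refl])
  fix m assume "m \<in> Poly_Mapping.keys F"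
  then have "- int N \<le> fst m" "- int N \<le> snd m" using assms by (auto simp: exps_ge_def)
  from tpow_shift[OF assms(2,3) this] show
    "Poly_Mapping.lookup F m * tpow s m * (fst s * snd s) ^ N =
      eval2 (Polynomial.monom (Polynomial.monom (Poly_Mapping.lookup F m) (nat (fst m + int N))) (nat (snd m + int N))) (fst s) (snd s)"
    by (simp add: eval2_monom mult.assoc)
qed

text \<open>Distinct exponents stay distinct after the shift, so each coefficient of \<open>F\<close> can be read off.\<close>

lemma shift_poly_eq_0:
  assumes "exps_ge N F" "shift_poly N F = 0"
  shows "F = 0"
proof (rule poly_mapping_eqI)
  fix m0
  show "Poly_Mapping.lookup F m0 = Poly_Mapping.lookup 0 m0"
  proof (cases "m0 \<in> Poly_Mapping.keys F")
    case True
    have "0 = Polynomial.coeff (Polynomial.coeff (shift_poly N F) (nat (snd m0 + int N))) (nat (fst m0 + int N))"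
      using assms by simp
    also have "\<dots> = (\<Sum>m\<in>Poly_Mapping.keys F. if m = m0 then Poly_Mapping.lookup F m else 0)"
      unfolding shift_poly_def coeff_sum
    proof (rule sum.cong[OF refl])
      fix m assume m: "m \<in> Poly_Mapping.keys F"
      have "- int N \<le> fst m" "- int N \<le> snd m" "- int N \<le> fst m0" "- int N \<le> snd m0"
        using m True assms(1) by (auto simp: exps_ge_def)
      then have "nat (fst m + int N) = nat (fst m0 + int N) \<and> nat (snd m + int N) = nat (snd m0 + int N) \<longleftrightarrow> m = m0"
        by (auto simp: prod_eq_iff nat_eq_iff2)
      then show "Polynomial.coeff (Polynomial.coeff (Polynomial.monom (Polynomial.monom (Poly_Mapping.lookup F m) (nat (fst m + int N))) (nat (snd m + int N)))
           (nat (snd m0 + int N))) (nat (fst m0 + int N)) = (if m = m0 then Poly_Mapping.lookup F m else 0)"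
        by (auto simp: coeff_monom)
    qed
    also have "\<dots> = Poly_Mapping.lookup F m0" using True by simp
    finally show ?thesis by simp
  qed (simp add: in_keys_iff)
qed

lemma emb_eq_0: "emb F = 0 \<Longrightarrow> F = 0"
proof -
  assume "emb F = 0"
  obtain N where N: "exps_ge N F" using exps_ge_exists by blast
  from emb_shift[OF N] \<open>emb F = 0\<close> have "shift_poly N F = 0" by simp
  with shift_poly_eq_0 N show ?thesis by blast
qed

lemma emb_eq_iff: "emb F = emb G \<longleftrightarrow> F = G"
  using emb_eq_0[of "F - G"] by (auto simp: emb_simps)

lemma laurent_no_zero_divisors: "F * G = (0 :: 'k::field laurent) \<Longrightarrow> F = 0 \<or> G = 0"
  using emb_eq_0 by (metis emb_simps(2) emb_zero mult_eq_0_iff)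

lemma laurent_power_eq_0: "F ^ n = (0 :: 'k::field laurent) \<Longrightarrow> F = 0"
  using laurent_no_zero_divisors by (induction n) auto

lemma alg_closed_infinite: "infinite (UNIV :: 'k::alg_closed_field set)"
proof
  assume fin: "finite (UNIV :: 'k set)"
  let ?p = "(\<Prod>a\<in>(UNIV::'k set). [:- a, 1:]) + 1"
  have "Polynomial.degree (\<Prod>a\<in>(UNIV::'k set). [:- a, 1:]) = (\<Sum>a\<in>(UNIV::'k set). Polynomial.degree [:- a, 1:])"
    by (rule degree_prod_eq_sum_degree) simp
  also have "\<dots> > 0" using fin by (simp add: card_gt_0_iff)
  finally have "Polynomial.degree ?p > 0" by (subst degree_add_eq_left) auto
  then obtain c where "poly ?p c = 0" using alg_closed_imp_poly_has_root by blast
  moreover have "poly ?p c = 1" using fin by (simp add: poly_prod)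
  ultimately show False by simp
qed

lemma exists_nonroot:
  fixes p :: "'k::alg_closed_field poly"
  assumes "p \<noteq> 0"
  shows "\<exists>c. poly p c \<noteq> 0"
proof (rule ccontr)
  assume "\<nexists>c. poly p c \<noteq> 0"
  then have "{c. poly p c = 0} = UNIV" by auto
  then show False using poly_roots_finite[OF assms] alg_closed_infinite[where 'k='k] by simp
qed

lemma eval2_map_poly: "eval2 p c d = poly (map_poly (\<lambda>r. poly r c) p) d"
  by (induction p) (simp_all add: eval2_pCons map_poly_pCons)

text \<open>The factors \<open>[:0, 1:]\<close> in the proof keep both coordinates away from zero, so that the point lies in
the torus.\<close>

lemma exists_nonroot2:
  fixes p :: "'k::alg_closed_field poly poly"
  assumes "p \<noteq> 0"
  shows "\<exists>c d. c \<noteq> 0 \<and> d \<noteq> 0 \<and> eval2 p c d \<noteq> 0"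
proof -
  have "[:0, 1:] * Polynomial.lead_coeff p \<noteq> 0" using assms by (metis leading_coeff_0_iff mult_eq_0_iff pCons_eq_0_iff zero_neq_one)
  then obtain c where c: "poly ([:0, 1:] * Polynomial.lead_coeff p) c \<noteq> 0" using exists_nonroot by blast
  define q where "q = map_poly (\<lambda>r. poly r c) p"
  have "Polynomial.coeff q (Polynomial.degree p) \<noteq> 0" using c by (simp add: q_def coeff_map_poly)
  then have "q \<noteq> 0" by auto
  then have "[:0, 1:] * q \<noteq> 0" by (metis mult_eq_0_iff pCons_eq_0_iff zero_neq_one)
  then obtain d where d: "poly ([:0, 1:] * q) d \<noteq> 0" using exists_nonroot by blast
  have "poly q d = eval2 p c d"
    by (simp add: q_def eval2_map_poly)
  with c d show ?thesis by (intro exI[of _ c] exI[of _ d]) auto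
qed

text \<open>The torus over an infinite field is Zariski dense in the plane.\<close>

lemma laurent_eq_0I:
  fixes F :: "'k::alg_closed_field laurent"
  assumes "\<And>s. fst s \<noteq> 0 \<Longrightarrow> snd s \<noteq> 0 \<Longrightarrow> torus_eval s F = 0"
  shows "F = 0"
proof -
  obtain N where N: "exps_ge N F" using exps_ge_exists by blast
  have "shift_poly N F = 0"
  proof (rule ccontr)
    assume "shift_poly N F \<noteq> 0"
    then obtain c d where "c \<noteq> 0" "d \<noteq> 0" "eval2 (shift_poly N F) c d \<noteq> 0" using exists_nonroot2 by blast
    with torus_eval_shift[OF N, of "(c, d)"] assms[of "(c,d)"] show False by simp
  qed
  with N show ?thesis by (rule shift_poly_eq_0)
qed

section \<open>Integral dependence\<close>

definition integral_over :: "'f::field set \<Rightarrow> 'f \<Rightarrow> bool" where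
  "integral_over A z \<longleftrightarrow> (\<exists>n c. (\<forall>i<n. c i \<in> A) \<and> z ^ n = (\<Sum>i<n. c i * z ^ i))"

lemma to_fract_sum: "to_fract (sum f A) = (\<Sum>a\<in>A. to_fract (f a))"
  by (induction A rule: infinite_finite_induct) simp_all

lemma to_fract_power: "to_fract (p ^ n) = to_fract p ^ n"
  by (induction n) simp_all

lemma obtain_fraction:
  obtains a b where "z = to_fract a / to_fract b" "b \<noteq> 0"
proof (cases z)
  case (Fract a b)
  then have "z = to_fract a / to_fract b" by (simp add: Fract_conv_to_fract)
  then show ?thesis using Fract that by blast
qed

text \<open>If \<open>b\<close> is a denominator of \<open>z\<close>, then \<open>b\<^sup>n\<close> is one of \<open>z\<^sup>k\<close> for \<open>k < n\<close>, and the integral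
equation of degree \<open>n\<close> reduces all higher powers to these.\<close>

lemma integral_common_denominator:
  fixes z :: "'d::idom fract"
  assumes "integral_over (range to_fract) z"
  shows "\<exists>d. d \<noteq> 0 \<and> (\<forall>k. to_fract d * z ^ k \<in> range to_fract)"
proof -
  from assms obtain n c where c: "\<And>i. i < n \<Longrightarrow> c i \<in> range to_fract" and zn: "z ^ n = (\<Sum>i<n. c i * z ^ i)"
    unfolding integral_over_def by blast
  have "\<forall>i. \<exists>C. i < n \<longrightarrow> c i = to_fract C" using c by blast
  then obtain C where C: "\<And>i. i < n \<Longrightarrow> c i = to_fract (C i)" by metis
  obtain a b where ab: "z = to_fract a / to_fract b" "b \<noteq> 0" by (rule obtain_fraction)
  have "to_fract (b ^ n) * z ^ k \<in> range to_fract" for k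
  proof (induction k rule: less_induct)
    case (less k)
    show ?case
    proof (cases "k < n")
      case True
      have "to_fract (b ^ n) * z ^ k = to_fract (b ^ (n - k)) * (to_fract b * z) ^ k"
        using True by (simp add: to_fract_power power_mult_distrib flip: power_add mult.assoc)
      also have "to_fract b * z = to_fract a" using ab by simp
      finally show ?thesis by (metis rangeI to_fract_mult to_fract_power)
    next
      case False
      then have "z ^ k = z ^ n * z ^ (k - n)" by (simp flip: power_add)
      also have "\<dots> = (\<Sum>i<n. to_fract (C i) * z ^ (i + (k - n)))"
        unfolding zn by (simp add: sum_distrib_right C power_add mult.assoc)
      finally have "to_fract (b ^ n) * z ^ k = (\<Sum>i<n. to_fract (C i) * (to_fract (b ^ n) * z ^ (i + (k - n))))"
        by (simp add: sum_distrib_left algebra_simps)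
      moreover have "\<exists>y. to_fract (b ^ n) * z ^ (i + (k - n)) = to_fract y" if "i < n" for i
      proof -
        have "i + (k - n) < k" using that False by linarith
        from less.IH[OF this] show ?thesis by blast
      qed
      then obtain y where "\<And>i. i < n \<Longrightarrow> to_fract (b ^ n) * z ^ (i + (k - n)) = to_fract (y i)" by metis
      ultimately have "to_fract (b ^ n) * z ^ k = to_fract (\<Sum>i<n. C i * y i)"
        by (simp add: to_fract_sum)
      then show ?thesis by blast
    qed
  qed
  then show ?thesis using ab(2) by (intro exI[of _ "b ^ n"]) simp
qed

text \<open>Multiplication by an integral element preserves the ideal of its universal denominators.
  Pseudo-dividing by a denominator of minimal degree in the outer variable shows that a polynomial
  in the inner variable alone is a denominator.\<close>

lemma integral_inner_denominator:
  fixes z :: "'a::idom poly fract"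
  assumes "integral_over (range to_fract) z"
  shows "\<exists>l. l \<noteq> 0 \<and> to_fract [:l:] * z \<in> range to_fract"
proof -
  define I where "I = {d. \<forall>k. to_fract d * z ^ k \<in> range to_fract}"
  have ex: "\<exists>d. d \<in> I \<and> d \<noteq> 0" using integral_common_denominator[OF assms] by (auto simp: I_def)
  define d where "d = arg_min Polynomial.degree (\<lambda>d. d \<in> I \<and> d \<noteq> 0)"
  obtain d0 where d0: "d0 \<in> I \<and> d0 \<noteq> 0" using ex by blast
  have d: "d \<in> I" "d \<noteq> 0" and dmin: "\<And>e. e \<in> I \<Longrightarrow> e \<noteq> 0 \<Longrightarrow> Polynomial.degree d \<le> Polynomial.degree e"
    using arg_min_nat_lemma[of "\<lambda>d. d \<in> I \<and> d \<noteq> 0", OF d0, of Polynomial.degree] unfolding d_def by blast+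
  obtain e where e: "to_fract d * z = to_fract e" using d(1) unfolding I_def by (auto dest: spec[of _ 1])
  have eI: "e \<in> I"
    unfolding I_def mem_Collect_eq
  proof
    fix k
    have "to_fract e * z ^ k = to_fract d * z ^ Suc k" by (simp add: e[symmetric] mult.assoc)
    moreover from d(1) have "to_fract d * z ^ Suc k \<in> range to_fract" unfolding I_def by blast
    ultimately show "to_fract e * z ^ k \<in> range to_fract" by (simp only:)
  qed
  obtain a q where a: "a \<noteq> 0" "Polynomial.smult a e = d * q + pseudo_mod e d"
    using pseudo_mod(1)[OF d(2)] by blast
  let ?r = "pseudo_mod e d"
  have "?r = [:a:] * e - q * d" using a(2) by simp
  have "?r \<in> I"
    unfolding I_def mem_Collect_eq
  proof
    fix k
    obtain u v where "to_fract e * z ^ k = to_fract u" "to_fract d * z ^ k = to_fract v"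
      using eI d(1) unfolding I_def by blast
    then have "to_fract ?r * z ^ k = to_fract ([:a:] * u - q * v)"
      unfolding \<open>?r = _\<close> by (simp only: to_fract_diff to_fract_mult left_diff_distrib mult.assoc)
    then show "to_fract ?r * z ^ k \<in> range to_fract" by blast
  qed
  then have "?r = 0" using dmin pseudo_mod(2)[OF d(2), of e] by (meson leD)
  then have "[:a:] * e = d * q" using a(2) by simp
  then have "to_fract [:a:] * (to_fract d * z) = to_fract d * to_fract q"
    unfolding e by (metis to_fract_mult)
  then have "to_fract [:a:] * z = to_fract q" using d(2) by simp
  then show ?thesis using a(1) by blast
qed

text \<open>Take a denominator \<open>m\<close> of least degree in the inner variable.  At a root \<open>c\<close> of \<open>m\<close> the integral
equation, multiplied by \<open>m\<^sup>n\<close>, says that the numerator vanishes on the line \<open>x = c\<close>.  Then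
\<open>x - c\<close> cancels, so \<open>m\<close> has no root and is constant.\<close>

lemma poly_ring_integrally_closed:
  fixes z :: "'k::alg_closed_field rat_fun"
  assumes int: "integral_over (range to_fract) z"
  shows "z \<in> range to_fract"
proof -
  have ex: "\<exists>l. l \<noteq> 0 \<and> to_fract [:l:] * z \<in> range to_fract" by (rule integral_inner_denominator[OF int])
  define m where "m = arg_min Polynomial.degree (\<lambda>l. l \<noteq> 0 \<and> to_fract [:l:] * z \<in> range to_fract)"
  have m: "m \<noteq> 0" "to_fract [:m:] * z \<in> range to_fract"
    and mmin: "\<And>e. e \<noteq> 0 \<Longrightarrow> to_fract [:e:] * z \<in> range to_fract \<Longrightarrow> Polynomial.degree m \<le> Polynomial.degree e"
    using arg_min_nat_lemma[of "\<lambda>l. l \<noteq> 0 \<and> to_fract [:l:] * z \<in> range to_fract" _ Polynomial.degree] ex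
    unfolding m_def by blast+
  obtain q where q: "to_fract [:m:] * z = to_fract q" using m(2) by blast
  have "Polynomial.degree m = 0"
  proof (rule ccontr)
    assume "Polynomial.degree m \<noteq> 0"
    then obtain c where "poly m c = 0" using alg_closed_imp_poly_has_root by blast
    then obtain m' where m': "m = [:- c, 1:] * m'" by (auto simp: poly_eq_0_iff_dvd)
    from int obtain n C where C: "\<And>i. i < n \<Longrightarrow> C i \<in> range to_fract" and zn: "z ^ n = (\<Sum>i<n. C i * z ^ i)"
      unfolding integral_over_def by blast
    then have "\<forall>i. \<exists>P. i < n \<longrightarrow> C i = to_fract P" by blast
    then obtain P where P: "\<And>i. i < n \<Longrightarrow> C i = to_fract (P i)" by metis
    have "to_fract q ^ n = to_fract [:m:] ^ n * z ^ n" by (simp flip: q add: power_mult_distrib)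
    also have "\<dots> = (\<Sum>i<n. to_fract (P i) * to_fract [:m:] ^ (n - i) * (to_fract [:m:] * z) ^ i)"
      unfolding zn sum_distrib_left
    proof (rule sum.cong[OF refl])
      fix i assume "i \<in> {..<n}"
      then have i: "i < n" by simp
      have "to_fract [:m:] ^ n = to_fract [:m:] ^ (n - i) * to_fract [:m:] ^ i"
        using i by (simp flip: power_add)
      then show "to_fract [:m:] ^ n * (C i * z ^ i) = to_fract (P i) * to_fract [:m:] ^ (n - i) * (to_fract [:m:] * z) ^ i"
        using P[OF i] by (simp add: power_mult_distrib mult_ac)
    qed
    also have "\<dots> = to_fract (\<Sum>i<n. P i * [:m:] ^ (n - i) * q ^ i)"
      by (simp add: q to_fract_sum to_fract_power)
    finally have "to_fract (q ^ n) = to_fract (\<Sum>i<n. P i * [:m:] ^ (n - i) * q ^ i)"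
      by (simp only: to_fract_power)
    then have eq: "q ^ n = (\<Sum>i<n. P i * [:m:] ^ (n - i) * q ^ i)"
      by (simp only: to_fract_eq_iff)
    have "eval2 q c d = 0" for d
    proof -
      have m0: "eval2 [:m:] c d = 0" using \<open>poly m c = 0\<close> by (simp add: eval2_pCons)
      have "eval2 q c d ^ n = eval2 (\<Sum>i<n. P i * [:m:] ^ (n - i) * q ^ i) c d"
        by (metis eq eval2_simps(6))
      also have "\<dots> = 0" by (simp add: eval2_sum m0 power_0_left)
      finally show ?thesis by simp
    qed
    then have "poly (map_poly (\<lambda>r. poly r c) q) d = 0" for d
      by (simp add: eval2_map_poly)
    then have "map_poly (\<lambda>r. poly r c) q = 0"
      using exists_nonroot by metis
    then have "poly (Polynomial.coeff q i) c = 0" for i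
      by (metis coeff_0 coeff_map_poly poly_0)
    then have "[:[:- c, 1:]:] dvd q"
      by (simp add: const_poly_dvd_iff flip: poly_eq_0_iff_dvd)
    then obtain q' where "q = [:[:- c, 1:]:] * q'" by (elim dvdE)
    moreover have "[:m:] = [:[:- c, 1:]:] * [:m':]" using m' by simp
    ultimately have "to_fract [:[:- c, 1:]:] * (to_fract [:m':] * z) = to_fract [:[:- c, 1:]:] * to_fract q'"
      using q by (simp only: to_fract_mult mult.assoc)
    then have "to_fract [:m':] * z = to_fract q'" by simp
    moreover have "m' \<noteq> 0" using m' m(1) by auto
    ultimately have "Polynomial.degree m \<le> Polynomial.degree m'" using mmin by blast
    moreover have "Polynomial.degree m = Suc (Polynomial.degree m')"
      using degree_mult_eq[of "[:- c, 1:]" m'] m' \<open>m' \<noteq> 0\<close> by simp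
    ultimately show False by simp
  qed
  then obtain c where c: "m = [:c:]" by (rule degree_eq_zeroE)
  with m(1) have "c \<noteq> 0" by simp
  have "to_fract [:[:inverse c:]:] * to_fract [:m:] = (1 :: 'k rat_fun)"
    using c \<open>c \<noteq> 0\<close> by (simp flip: to_fract_mult add: one_pCons[symmetric])
  then have "z = to_fract [:[:inverse c:]:] * (to_fract [:m:] * z)"
    by (simp only: mult.assoc[symmetric] mult_1)
  also have "\<dots> = to_fract ([:[:inverse c:]:] * q)"
    by (simp only: q to_fract_mult)
  finally show ?thesis by blast
qed

lemma range_emb_shift: "G \<in> range emb \<Longrightarrow> \<exists>N. \<forall>N'\<ge>N. G * (var_x * var_y) ^ N' \<in> range to_fract"
  using emb_shift exps_ge_mono exps_ge_exists by (metis (no_types, lifting) imageE rangeI)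

lemma var_shift_in_range: "to_fract p = z * (var_x * var_y) ^ N \<Longrightarrow> z \<in> range (emb :: 'k::field laurent \<Rightarrow> _)"
proof -
  assume a: "to_fract p = z * (var_x * var_y) ^ N"
  let ?R = "range (emb :: 'k laurent \<Rightarrow> _)"
  have mult: "u * v \<in> ?R" if "u \<in> ?R" "v \<in> ?R" for u v using that by (auto simp flip: emb_simps)
  have add: "u + v \<in> ?R" if "u \<in> ?R" "v \<in> ?R" for u v using that by (auto simp flip: emb_simps)
  have "emb (Poly_Mapping.single (1, 0) 1) = (var_x :: 'k rat_fun)"
    by (simp add: emb_single tpow_def emb.h_one)
  then have x: "var_x \<in> ?R" by (metis rangeI)
  have "emb (Poly_Mapping.single (0, 1) 1) = (var_y :: 'k rat_fun)"
    by (simp add: emb_single tpow_def emb.h_one)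
  then have y: "var_y \<in> ?R" by (metis rangeI)
  have c: "const_fun c \<in> ?R" for c using emb_single[of 0 c] by (metis mult_1_right rangeI tpow_zero)
  have "to_fract [:r:] \<in> ?R" for r :: "'k poly"
  proof (induction r)
    case 0 then show ?case by (metis emb_zero pCons_0_0 rangeI to_fract_0)
  next
    case (pCons a r)
    have "[:pCons a r:] = [:[:a:]:] + [:[:0,1:]:] * [:r:]" by simp
    then have "to_fract [:pCons a r:] = const_fun a + var_x * to_fract [:r:]"
      by (metis const_fun_def to_fract_add to_fract_mult var_x_def)
    then show ?case using pCons c x add mult by metis
  qed
  then have "to_fract p \<in> ?R" for p :: "'k poly poly"
  proof (induction p)
    case 0 then show ?case by (metis emb_zero rangeI to_fract_0)
  next
    case (pCons a p)
    have "pCons a p = [:a:] + [:0,1:] * p" by simp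
    then have "to_fract (pCons a p) = to_fract [:a:] + var_y * to_fract p"
      by (metis to_fract_add to_fract_mult var_y_def)
    then show ?case using pCons y add mult by metis
  qed
  moreover have inv: "emb (Poly_Mapping.single (- int N, - int N) 1) = inverse ((var_x * var_y :: 'k rat_fun) ^ N)"
    by (simp add: emb_single emb.h_one tpow_def power_int_minus power_mult_distrib)
  have "z = to_fract p * emb (Poly_Mapping.single (- int N, - int N) 1)"
    unfolding a inv by simp
  ultimately show ?thesis using mult by blast
qed

text \<open>Multiplying \<open>z\<close> by a power of \<open>x y\<close> turns an integral equation over the Laurent polynomials into one
over the polynomials.\<close>

lemma laurent_integrally_closed:
  fixes z :: "'k::alg_closed_field rat_fun"
  assumes "integral_over (range emb) z"
  shows "z \<in> range emb"
proof -
  from assms obtain n c where c: "\<And>i. i < n \<Longrightarrow> c i \<in> range emb" and zn: "z ^ n = (\<Sum>i<n. c i * z ^ i)"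
    unfolding integral_over_def by blast
  let ?u = "var_x * var_y :: 'k rat_fun"
  have "\<forall>i. \<exists>N. i < n \<longrightarrow> (\<forall>N'\<ge>N. c i * ?u ^ N' \<in> range to_fract)" using range_emb_shift c by metis
  then obtain Nf where Nf: "\<And>i N'. i < n \<Longrightarrow> N' \<ge> Nf i \<Longrightarrow> c i * ?u ^ N' \<in> range to_fract" by metis
  define N where "N = (\<Sum>i<n. Nf i)"
  have N: "Nf i \<le> N" if "i < n" for i unfolding N_def by (rule member_le_sum) (use that in auto)
  have "(?u ^ N * z) ^ n = (\<Sum>i<n. (c i * ?u ^ (N * (n - i))) * (?u ^ N * z) ^ i)"
    unfolding power_mult_distrib[of _ z] zn sum_distrib_left
  proof (rule sum.cong[OF refl])
    fix i assume "i \<in> {..<n}"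
    then have "(?u ^ N) ^ n = ?u ^ (N * (n - i)) * (?u ^ N) ^ i"
      by (simp flip: power_add power_mult add: distrib_left[symmetric])
    then show "(?u ^ N) ^ n * (c i * z ^ i) = c i * ?u ^ (N * (n - i)) * ((?u ^ N) ^ i * z ^ i)"
      by (simp add: mult_ac)
  qed
  moreover have "c i * ?u ^ (N * (n - i)) \<in> range to_fract" if "i < n" for i
  proof (rule Nf[OF that])
    have "N * 1 \<le> N * (n - i)" using that by (intro mult_le_mono) auto
    then have "N \<le> N * (n - i)" by (simp only: mult_1_right)
    then show "Nf i \<le> N * (n - i)" using N[OF that] by (rule order_trans[rotated])
  qed
  ultimately have "integral_over (range to_fract) (?u ^ N * z)"
    unfolding integral_over_def by (intro exI[of _ n] exI[of _ "\<lambda>i. c i * ?u ^ (N * (n - i))"]) auto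
  then obtain p where "to_fract p = z * ?u ^ N"
    using poly_ring_integrally_closed by (metis imageE mult.commute)
  then show ?thesis by (rule var_shift_in_range)
qed

subsection \<open>Linear functionals bound the exponents of integral elements\<close>

lemma keys_sum_subset:
  assumes "\<And>i. i \<in> A \<Longrightarrow> Poly_Mapping.keys (f i) \<subseteq> S"
  shows "Poly_Mapping.keys (sum f A) \<subseteq> S"
  using assms
proof (induction A rule: infinite_finite_induct)
  case (insert x F)
  then show ?case using keys_add[of "f x" "sum f F"] by (simp, blast)
qed auto

lemma keys_mult_subset:
  assumes "\<And>a b. a \<in> Poly_Mapping.keys f \<Longrightarrow> b \<in> Poly_Mapping.keys g \<Longrightarrow> a + b \<in> U"
  shows "Poly_Mapping.keys (f * g) \<subseteq> U"
  using keys_mult[of f g] assms by blast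

text \<open>Suppose that the least value \<open>\<mu>\<close> of \<open>E\<close> on the exponents of \<open>F\<close> is negative, and let \<open>F0\<close> be the part
of \<open>F\<close> where it is attained.  The part of \<open>F\<^sup>n\<close> where \<open>E\<close> has the value \<open>n \<mu>\<close> is \<open>F0\<^sup>n\<close>, but on the right
of the equation \<open>E\<close> is greater than \<open>n \<mu>\<close> everywhere.\<close>

lemma integral_exponents_ge:
  fixes F :: "'k::field laurent" and E :: "int \<times> int \<Rightarrow> int"
  assumes E: "\<And>m n. E (m + n) = E m + E n"
    and C: "\<And>i. i < n \<Longrightarrow> Poly_Mapping.keys (C i) \<subseteq> {m. E m \<ge> 0}"
    and eq: "F ^ n = (\<Sum>i<n. C i * F ^ i)"
  shows "Poly_Mapping.keys F \<subseteq> {m. E m \<ge> 0}"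
proof (rule ccontr)
  assume "\<not> ?thesis"
  then obtain m0 where "m0 \<in> Poly_Mapping.keys F" "\<not> 0 \<le> E m0" by blast
  then have m0: "m0 \<in> Poly_Mapping.keys F" "E m0 < 0" by simp_all
  define \<mu> where "\<mu> = Min (E ` Poly_Mapping.keys F)"
  have \<mu>: "\<mu> \<le> E m" if "m \<in> Poly_Mapping.keys F" for m using that by (simp add: \<mu>_def)
  have "\<mu> \<in> E ` Poly_Mapping.keys F" unfolding \<mu>_def using m0 by (intro Min_in) auto
  then obtain m1 where m1: "m1 \<in> Poly_Mapping.keys F" "E m1 = \<mu>" by auto
  have neg: "\<mu> < 0" using \<mu>[OF m0(1)] m0(2) by simp
  define ge where "ge = (\<lambda>a. {G :: 'k laurent. Poly_Mapping.keys G \<subseteq> {m. E m \<ge> a}})"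
  have ge_mult: "G * H \<in> ge (a + b)" if "G \<in> ge a" "H \<in> ge b" for G H a b
    unfolding ge_def mem_Collect_eq
  proof (rule keys_mult_subset)
    fix u v assume "u \<in> Poly_Mapping.keys G" "v \<in> Poly_Mapping.keys H"
    then have "E u \<ge> a" "E v \<ge> b" using that by (auto simp: ge_def)
    then show "u + v \<in> {m. a + b \<le> E m}" by (simp add: E)
  qed
  have ge_mono: "G \<in> ge b" if "G \<in> ge a" "b \<le> a" for G a b using that unfolding ge_def by force
  have E0: "E 0 = 0" using E[of 0 0] by simp
  have ge_power: "G ^ k \<in> ge (int k * a)" if "G \<in> ge a" for G k a
  proof (induction k)
    case 0 then show ?case by (simp add: ge_def E0)
  next
    case (Suc k) then show ?case using ge_mult[OF that Suc] by (simp add: algebra_simps)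
  qed
  have ge_add: "G + H \<in> ge a" if "G \<in> ge a" "H \<in> ge a" for G H a
    using that keys_add[of G H] unfolding ge_def by blast
  define F0 where "F0 = (\<Sum>m\<in>{m\<in>Poly_Mapping.keys F. E m = \<mu>}. Poly_Mapping.single m (Poly_Mapping.lookup F m))"
  define F1 where "F1 = (\<Sum>m\<in>{m\<in>Poly_Mapping.keys F. E m \<noteq> \<mu>}. Poly_Mapping.single m (Poly_Mapping.lookup F m))"
  have split: "F = F0 + F1"
  proof -
    have "(\<Sum>m\<in>Poly_Mapping.keys F. Poly_Mapping.single m (Poly_Mapping.lookup F m)) = F0 + F1"
      unfolding F0_def F1_def by (subst sum.union_disjoint[symmetric]) (auto intro!: sum.cong)
    then show ?thesis using pm_sum_singles[of F] by metis
  qed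
  have lookF0: "Poly_Mapping.lookup F0 m1 = Poly_Mapping.lookup F m1"
    unfolding F0_def lookup_sum using m1 by (subst sum.remove[of _ m1]) (auto simp: lookup_single when_def)
  have "F0 \<noteq> 0" using lookF0 m1(1) by (auto simp: in_keys_iff)
  have F1: "F1 \<in> ge (\<mu> + 1)"
    unfolding ge_def F1_def mem_Collect_eq by (rule keys_sum_subset) (use \<mu> in \<open>force split: if_splits\<close>)
  have F0: "F0 \<in> ge \<mu>"
    unfolding ge_def F0_def mem_Collect_eq by (rule keys_sum_subset) (use \<mu> in \<open>force split: if_splits\<close>)
  have keysF0: "Poly_Mapping.keys (F0 ^ k) \<subseteq> {m. E m = int k * \<mu>}" for k
  proof (induction k)
    case 0 then show ?case by (simp add: E0)
  next
    case (Suc k)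
    have "Poly_Mapping.keys F0 \<subseteq> {m. E m = \<mu>}"
      unfolding F0_def by (rule keys_sum_subset) (force split: if_splits)
    then have "a + b \<in> {m. E m = int (Suc k) * \<mu>}"
      if "a \<in> Poly_Mapping.keys F0" "b \<in> Poly_Mapping.keys (F0 ^ k)" for a b
    proof -
      have "E a = \<mu>" using that(1) \<open>Poly_Mapping.keys F0 \<subseteq> _\<close> by blast
      moreover have "E b = int k * \<mu>" using that(2) Suc by blast
      ultimately show ?thesis by (simp add: E algebra_simps)
    qed
    then show ?case unfolding power_Suc by (rule keys_mult_subset)
  qed
  have pow: "\<exists>H \<in> ge (int k * \<mu> + 1). F ^ k = F0 ^ k + H" for k
  proof (induction k)
    case 0 then show ?case by (intro bexI[of _ 0]) (auto simp: ge_def)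
  next
    case (Suc k)
    then obtain H where H: "H \<in> ge (int k * \<mu> + 1)" "F ^ k = F0 ^ k + H" by blast
    have "F ^ Suc k = F0 ^ Suc k + (F0 * H + F1 * F ^ k)"
      using H(2) by (simp add: split algebra_simps)
    moreover have "F \<in> ge \<mu>" using \<mu> by (auto simp: ge_def)
    then have "F1 * F ^ k \<in> ge (int (Suc k) * \<mu> + 1)"
      using ge_mult[OF F1 ge_power] by (simp add: algebra_simps)
    moreover have "F0 * H \<in> ge (int (Suc k) * \<mu> + 1)"
      using ge_mult[OF F0 H(1)] by (simp add: algebra_simps)
    ultimately show ?case using ge_add by blast
  qed
  have FF: "F \<in> ge \<mu>" using \<mu> by (auto simp: ge_def)
  have "C i * F ^ i \<in> ge (int n * \<mu> + 1)" if "i < n" for i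
  proof -
    have "C i * F ^ i \<in> ge (0 + int i * \<mu>)"
      using C[OF that] by (intro ge_mult ge_power FF) (simp add: ge_def)
    moreover have "int n * \<mu> + 1 \<le> int i * \<mu>"
    proof -
      have "(int n - int i) * \<mu> \<le> 1 * \<mu>" using that neg by (intro mult_right_mono_neg) auto
      then show ?thesis using neg by (simp add: algebra_simps)
    qed
    ultimately show ?thesis using ge_mono by simp
  qed
  then have "F ^ n \<in> ge (int n * \<mu> + 1)"
    unfolding eq ge_def mem_Collect_eq by (intro keys_sum_subset) auto
  moreover obtain H where H: "H \<in> ge (int n * \<mu> + 1)" "F ^ n = F0 ^ n + H" using pow by blast
  ultimately have "F0 ^ n + H - H \<in> ge (int n * \<mu> + 1)"
    using keys_diff[of "F0 ^ n + H" H] unfolding ge_def by auto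
  then have ge0: "Poly_Mapping.keys (F0 ^ n) \<subseteq> {m. int n * \<mu> + 1 \<le> E m}" unfolding ge_def by simp
  have "m \<notin> Poly_Mapping.keys (F0 ^ n)" for m
  proof
    assume "m \<in> Poly_Mapping.keys (F0 ^ n)"
    then have "int n * \<mu> + 1 \<le> E m" "E m = int n * \<mu>" using ge0 keysF0[of n] by blast+
    then show False by simp
  qed
  then have "F0 ^ n = 0" by (metis all_not_in_conv keys_eq_empty)
  with \<open>F0 \<noteq> 0\<close> laurent_power_eq_0 show False by blast
qed

subsection \<open>Saturating the exponents gives integral elements\<close>

text \<open>The determinant trick: \<open>z\<close> is an eigenvalue of a matrix over \<open>A\<close>, hence a root of its characteristic
polynomial, which is monic.\<close>

lemma integral_over_eigenvalue:
  fixes z :: "'f::field" and n :: nat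
  assumes A: "0 \<in> A" "1 \<in> A" "\<And>a b. a \<in> A \<Longrightarrow> b \<in> A \<Longrightarrow> a + b \<in> A" "\<And>a b. a \<in> A \<Longrightarrow> b \<in> A \<Longrightarrow> a * b \<in> A"
    "\<And>a. a \<in> A \<Longrightarrow> - a \<in> A"
    and C: "\<And>i j. i < n \<Longrightarrow> j < n \<Longrightarrow> C i j \<in> A"
    and v: "k < n" "v k \<noteq> 0"
    and eq: "\<And>i. i < n \<Longrightarrow> z * v i = (\<Sum>j<n. C i j * v j)"
  shows "integral_over A z"
proof -
  define M where "M = Matrix.mat n n (\<lambda>(i, j). C i j)"
  have M: "M \<in> carrier_mat n n" by (simp add: M_def)
  have "eigenvector M (Matrix.vec n v) z"
    unfolding eigenvector_def
  proof (intro conjI)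
    show "Matrix.vec n v \<noteq> 0\<^sub>v (dim_row M)"
    proof
      assume "Matrix.vec n v = 0\<^sub>v (dim_row M)"
      then have "vec_index (Matrix.vec n v) k = vec_index (0\<^sub>v (dim_row M)) k" by simp
      then show False using v M by simp
    qed
    show "M *\<^sub>v Matrix.vec n v = z \<cdot>\<^sub>v Matrix.vec n v"
      by (rule eq_vecI) (auto simp: M_def scalar_prod_def eq atLeast0LessThan)
  qed (simp add: M_def)
  then have root: "poly (char_poly M) z = 0"
    using eigenvalue_root_char_poly[OF M] by (auto simp: eigenvalue_def)
  define B where "B = {p :: 'f poly. \<forall>i. Polynomial.coeff p i \<in> A}"
  have sumA: "sum f T \<in> A" if "\<And>t. t \<in> T \<Longrightarrow> f t \<in> A" for f :: "nat \<Rightarrow> 'f" and T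
    using that by (induction T rule: infinite_finite_induct) (auto intro: A)
  have B: "p + q \<in> B" "p * q \<in> B" "- p \<in> B" if "p \<in> B" "q \<in> B" for p q
    using that by (auto simp: B_def coeff_mult intro!: A sumA)
  have B01: "0 \<in> B" "1 \<in> B" using A by (auto simp: B_def)
  have sumB: "sum f T \<in> B" if "\<And>t. t \<in> T \<Longrightarrow> f t \<in> B" for f :: "(nat \<Rightarrow> nat) \<Rightarrow> 'f poly" and T
    using that by (induction T rule: infinite_finite_induct) (auto intro: B B01)
  have prodB: "prod f T \<in> B" if "\<And>t. t \<in> T \<Longrightarrow> f t \<in> B" for f :: "nat \<Rightarrow> 'f poly" and T
    using that by (induction T rule: infinite_finite_induct) (auto intro: B B01)
  have "char_poly M \<in> B"
    unfolding char_poly_def det_def'[OF char_poly_matrix_closed[OF M]]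
  proof (rule sumB, rule B(2)[OF _ prodB])
    fix p i assume p: "p \<in> {p. p permutes {0..<n}}" and i: "i \<in> {0..<n}"
    then have pi: "p i < n" using permutes_in_image[of p "{0..<n}" i] by auto
    have "char_poly_matrix M $$ (i, p i) = (if i = p i then [:- C i (p i), 1:] else [:- C i (p i):])"
      using i pi by (simp add: char_poly_matrix_def M_def)
    then show "char_poly_matrix M $$ (i, p i) \<in> B"
      using C[of i "p i"] i pi A by (auto simp: B_def coeff_pCons split: nat.splits)
  next
    fix p
    show "signof p \<in> B" using B01 B(3)[OF B01(2) B01(2)] by (auto simp: sign_def)
  qed
  then have coeffs: "Polynomial.coeff (char_poly M) i \<in> A" for i by (simp add: B_def)
  have deg: "Polynomial.degree (char_poly M) = n" "Polynomial.coeff (char_poly M) n = 1"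
    using degree_monic_char_poly[OF M] by auto
  have "0 = (\<Sum>i<n. Polynomial.coeff (char_poly M) i * z ^ i) + z ^ n"
    using root unfolding poly_altdef deg(1) lessThan_Suc_atMost[symmetric] by (simp add: deg)
  then have "z ^ n = (\<Sum>i<n. - Polynomial.coeff (char_poly M) i * z ^ i)"
    by (simp add: sum_negf eq_neg_iff_add_eq_0 add.commute)
  then show ?thesis
    unfolding integral_over_def using A(5)[OF coeffs]
    by (intro exI[of _ n] exI[of _ "\<lambda>i. - Polynomial.coeff (char_poly M) i"]) blast
qed

definition zmult :: "nat \<Rightarrow> int \<times> int \<Rightarrow> int \<times> int" where
  "zmult n z = (int n * fst z, int n * snd z)"

lemma zmult_simps [simp]: "zmult 0 z = 0" "zmult (Suc n) z = z + zmult n z" "zmult n 0 = 0"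
  by (auto simp: zmult_def prod_eq_iff algebra_simps)

definition add_submonoid :: "(int \<times> int) set \<Rightarrow> bool" where
  "add_submonoid S \<longleftrightarrow> 0 \<in> S \<and> (\<forall>a\<in>S. \<forall>b\<in>S. a + b \<in> S)"

definition supported :: "(int \<times> int) set \<Rightarrow> 'k::zero laurent set" where
  "supported S = {F. Poly_Mapping.keys F \<subseteq> S}"

lemma supported_simps:
  fixes F G :: "'k::comm_ring_1 laurent"
  assumes "add_submonoid S"
  shows "0 \<in> supported S" "1 \<in> supported S"
    "F \<in> supported S \<Longrightarrow> G \<in> supported S \<Longrightarrow> F + G \<in> supported S"
    "F \<in> supported S \<Longrightarrow> G \<in> supported S \<Longrightarrow> F * G \<in> supported S"
    "F \<in> supported S \<Longrightarrow> - F \<in> supported S"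
    "F \<in> supported S \<Longrightarrow> G \<in> supported S \<Longrightarrow> F - G \<in> supported S"
proof -
  have S: "0 \<in> S" "a \<in> S \<Longrightarrow> b \<in> S \<Longrightarrow> a + b \<in> S" for a b using assms by (auto simp: add_submonoid_def)
  show "0 \<in> supported S" by (simp add: supported_def)
  show "1 \<in> supported S" using S(1) by (simp add: supported_def)
  show "F \<in> supported S \<Longrightarrow> - F \<in> supported S" by (simp add: supported_def)
  show "F \<in> supported S \<Longrightarrow> G \<in> supported S \<Longrightarrow> F + G \<in> supported S"
    using keys_add[of F G] unfolding supported_def by blast
  show "F \<in> supported S \<Longrightarrow> G \<in> supported S \<Longrightarrow> F - G \<in> supported S"
    using keys_diff[of F G] unfolding supported_def by blast
  show "F \<in> supported S \<Longrightarrow> G \<in> supported S \<Longrightarrow> F * G \<in> supported S"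
    using keys_mult[of F G] S(2) unfolding supported_def by blast
qed

text \<open>The monomials with exponents in \<open>G\<close> span a module over the semigroup algebra of \<open>S\<close> that is stable under
multiplication by monomials with exponents in \<open>K\<close>.  An exponent \<open>m\<close> with \<open>N m \<in> S\<close> is adjoined by
adding its multiples below \<open>N m\<close> to \<open>G\<close>.\<close>

lemma finite_translates:
  assumes S: "add_submonoid S" and fin: "finite K" and sat: "\<And>m. m \<in> K \<Longrightarrow> \<exists>n>0. zmult n m \<in> S"
  shows "\<exists>G. finite G \<and> G \<noteq> {} \<and> (\<forall>g\<in>G. \<forall>m\<in>K. \<exists>g'\<in>G. \<exists>s\<in>S. g + m = g' + s)"
  using fin sat
proof (induction K)
  case empty
  then show ?case by (intro exI[of _ "{0}"]) auto
next
  case (insert m0 K)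
  then obtain G where G: "finite G" "G \<noteq> {}" "\<And>g m. g \<in> G \<Longrightarrow> m \<in> K \<Longrightarrow> \<exists>g'\<in>G. \<exists>s\<in>S. g + m = g' + s"
    using insert.IH insert.prems by (metis insertCI)
  obtain N where N: "N > 0" "zmult N m0 \<in> S" using insert.prems by blast
  let ?G = "(\<lambda>(g, e). g + zmult e m0) ` (G \<times> {..<N})"
  have "\<exists>g'\<in>?G. \<exists>s\<in>S. h + m = g' + s" if h: "h \<in> ?G" and m: "m \<in> insert m0 K" for h m
  proof -
    from h obtain g e where g: "g \<in> G" "e < N" "h = g + zmult e m0" by auto
    show ?thesis
    proof (cases "m = m0")
      case True
      show ?thesis
      proof (cases "Suc e < N")
        case T: True
        have "h + m = (g + zmult (Suc e) m0) + 0" using g True by (simp add: add_ac)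
        moreover have "g + zmult (Suc e) m0 \<in> ?G" using g T by force
        moreover have "0 \<in> S" using S by (simp add: add_submonoid_def)
        ultimately show ?thesis by blast
      next
        case F: False
        then have "Suc e = N" using g by simp
        then have "h + m = (g + zmult 0 m0) + zmult N m0" using g True by (simp flip: \<open>Suc e = N\<close> add: add_ac)
        moreover have "g + zmult 0 m0 \<in> ?G" using g N by (intro image_eqI[of _ _ "(g, 0)"]) auto
        ultimately show ?thesis using N by blast
      qed
    next
      case False
      then obtain g' s where gs: "g' \<in> G" "s \<in> S" "g + m = g' + s" using G(3)[OF g(1)] m by blast
      then have "h + m = (g' + zmult e m0) + s" using g by (metis add.assoc add.commute)
      moreover have "g' + zmult e m0 \<in> ?G" using g gs by force
      ultimately show ?thesis using gs by blast
    qed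
  qed
  then show ?case using G N by (intro exI[of _ ?G]) auto
qed

text \<open>Multiplication by \<open>F\<close> acts on the finitely generated module of \<open>finite_translates\<close>, by a matrix with
entries in the semigroup algebra.\<close>

lemma saturation_integral:
  fixes F :: "'k::field laurent"
  assumes S: "add_submonoid S" and sat: "\<And>m. m \<in> Poly_Mapping.keys F \<Longrightarrow> \<exists>n>0. zmult n m \<in> S"
  shows "integral_over (emb ` supported S) (emb F)"
proof -
  let ?K = "Poly_Mapping.keys F"
  obtain G where G: "finite G" "G \<noteq> {}" "\<And>g m. g \<in> G \<Longrightarrow> m \<in> ?K \<Longrightarrow> \<exists>g'\<in>G. \<exists>s\<in>S. g + m = g' + s"
    using finite_translates[OF S finite_keys sat] by metis
  then obtain t s where ts: "\<And>g m. g \<in> G \<Longrightarrow> m \<in> ?K \<Longrightarrow> t g m \<in> G \<and> s g m \<in> S \<and> g + m = t g m + s g m"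
    by metis
  obtain gs where gs: "set gs = G" "distinct gs" using G(1) finite_distinct_list by blast
  define n where "n = length gs"
  define C :: "nat \<Rightarrow> nat \<Rightarrow> 'k laurent" where "C = (\<lambda>i j. \<Sum>m\<in>{m\<in>?K. t (gs ! i) m = gs ! j}.
     Poly_Mapping.single (s (gs ! i) m) (Poly_Mapping.lookup F m))"
  show ?thesis
  proof (rule integral_over_eigenvalue[where n = n and C = "\<lambda>i j. emb (C i j)" and k = 0
        and v = "\<lambda>j. emb (Poly_Mapping.single (gs ! j) 1)"])
    show "0 \<in> emb ` supported S" "1 \<in> emb ` supported S"
      using supported_simps(1,2)[OF S] by (force simp: emb_simps)+
    show "- a \<in> emb ` supported S" if "a \<in> emb ` supported S" for a :: "'k rat_fun"
      using that by (auto simp flip: emb_simps intro!: imageI supported_simps(5)[OF S])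
    show "a + b \<in> emb ` supported S" "a * b \<in> emb ` supported S"
      if "a \<in> emb ` supported S" "b \<in> emb ` supported S" for a b :: "'k rat_fun"
      using that by (auto simp flip: emb_simps intro!: imageI supported_simps(3,4)[OF S])
    show "0 < n" using G(2) gs(1) by (auto simp: n_def)
    show "emb (Poly_Mapping.single (gs ! 0) 1) \<noteq> 0"
      by (simp add: emb_single emb.h_one tpow_nonzero)
    show "emb (C i j) \<in> emb ` supported S" if "i < n" "j < n" for i j
    proof -
      have "gs ! i \<in> G" using that gs by (auto simp: n_def)
      then have "C i j \<in> supported S"
        unfolding C_def supported_def mem_Collect_eq using ts by (intro keys_sum_subset) auto
      then show ?thesis by blast
    qed
    show "emb F * emb (Poly_Mapping.single (gs ! i) 1) = (\<Sum>j<n. emb (C i j) * emb (Poly_Mapping.single (gs ! j) 1))"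
      if "i < n" for i
    proof -
      have gi: "gs ! i \<in> G" using that gs by (auto simp: n_def)
      have "F * Poly_Mapping.single (gs ! i) 1 = (\<Sum>m\<in>?K. Poly_Mapping.single (m + gs ! i) (Poly_Mapping.lookup F m))"
        by (subst (1) pm_sum_singles[of F]) (simp add: sum_distrib_right mult_single)
      also have "\<dots> = (\<Sum>y\<in>G. \<Sum>m\<in>{m\<in>?K. t (gs ! i) m = y}. Poly_Mapping.single (m + gs ! i) (Poly_Mapping.lookup F m))"
        by (rule sum.group[symmetric]) (use ts[OF gi] G(1) in auto)
      also have "\<dots> = (\<Sum>j<n. \<Sum>m\<in>{m\<in>?K. t (gs ! i) m = gs ! j}. Poly_Mapping.single (m + gs ! i) (Poly_Mapping.lookup F m))"
        by (rule sum.reindex_bij_betw[symmetric], rule bij_betw_nth) (use gs in \<open>auto simp: n_def\<close>)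
      also have "\<dots> = (\<Sum>j<n. C i j * Poly_Mapping.single (gs ! j) 1)"
      proof (rule sum.cong[OF refl])
        fix j
        show "(\<Sum>m\<in>{m\<in>?K. t (gs ! i) m = gs ! j}. Poly_Mapping.single (m + gs ! i) (Poly_Mapping.lookup F m))
            = C i j * Poly_Mapping.single (gs ! j) 1"
          unfolding C_def sum_distrib_right
        proof (rule sum.cong[OF refl])
          fix m assume "m \<in> {m \<in> ?K. t (gs ! i) m = gs ! j}"
          then have "m + gs ! i = s (gs ! i) m + gs ! j" using ts[OF gi, of m] by (auto simp: add.commute)
          then show "Poly_Mapping.single (m + gs ! i) (Poly_Mapping.lookup F m) =
            Poly_Mapping.single (s (gs ! i) m) (Poly_Mapping.lookup F m) * Poly_Mapping.single (gs ! j) 1"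
            by (simp add: mult_single)
        qed
      qed
      finally have "emb (F * Poly_Mapping.single (gs ! i) 1) = emb (\<Sum>j<n. C i j * Poly_Mapping.single (gs ! j) 1)"
        by simp
      then show ?thesis by (simp only: emb_simps)
    qed
  qed
qed

section \<open>Two-dimensional cotangent spaces\<close>

text \<open>The statement that \<open>M / M\<^sup>2\<close> has dimension two, in terms of representatives \<open>u\<close> and \<open>v\<close> of a basis.\<close>

definition cotangent_basis_exists :: "('a, 'b) ring_scheme \<Rightarrow> 'a set \<Rightarrow> 'a set \<Rightarrow> bool" where
  "cotangent_basis_exists B k M \<longleftrightarrow> (\<exists>u\<in>M. \<exists>v\<in>M.
     (\<forall>m\<in>M. \<exists>a\<in>k. \<exists>b\<in>k. \<exists>j\<in>ideal_prod B M M. m = (a \<otimes>\<^bsub>B\<^esub> u \<oplus>\<^bsub>B\<^esub> b \<otimes>\<^bsub>B\<^esub> v) \<oplus>\<^bsub>B\<^esub> j) \<and>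
     (\<forall>a\<in>k. \<forall>b\<in>k. a \<otimes>\<^bsub>B\<^esub> u \<oplus>\<^bsub>B\<^esub> b \<otimes>\<^bsub>B\<^esub> v \<in> ideal_prod B M M \<longrightarrow> a = \<zero>\<^bsub>B\<^esub> \<and> b = \<zero>\<^bsub>B\<^esub>))"

lemma cotangent_dim_2_iff:
  fixes B (structure)
  assumes "cring B" and k: "subfield k B" and M: "ideal M B" "\<one> \<notin> M"
  shows "cotangent_dim B k M 2 \<longleftrightarrow> cotangent_basis_exists B k M"
proof -
  interpret cring B by fact
  define J where "J = ideal_prod B M M"
  have Jid: "ideal J B" unfolding J_def by (rule ideal_prod_is_ideal[OF M(1) M(1)])
  interpret J: ideal J B by (rule Jid)
  interpret M: ideal M B by (rule M(1))
  have JM: "J \<subseteq> M" using ideal_prod_inter[OF M(1) M(1)] by (simp add: J_def)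
  let ?Q = "B Quot J" and ?p = "\<lambda>x. J +> x"
  interpret Q: ring ?Q by (rule J.quotient_is_ring)
  interpret p: ring_hom_ring B ?Q ?p by (rule J.rcos_ring_hom_ring)
  have zeroQ: "\<zero>\<^bsub>?Q\<^esub> = J" unfolding FactRing_def by (simp only: ring.select_convs)
  have p0: "?p x = J \<longleftrightarrow> x \<in> J" if "x \<in> carrier B" for x
    using J.a_rcos_self[OF that] J.a_rcos_const by auto
  have one: "\<one>\<^bsub>?Q\<^esub> \<noteq> \<zero>\<^bsub>?Q\<^esub>"
    using p0[of \<one>] JM M(2) p.hom_one zeroQ by auto
  note K' = p.img_is_subfield(2)[OF k one] and inj = p.img_is_subfield(1)[OF k one]
  have kc: "k \<subseteq> carrier B" by (rule subringE(1)[OF subfieldE(1)[OF k]])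
  have k0: "\<zero> \<in> k" by (rule subringE(2)[OF subfieldE(1)[OF k]])
  have peq: "?p x = ?p y \<longleftrightarrow> (\<exists>j\<in>J. x = y \<oplus> j)" if "x \<in> carrier B" "y \<in> carrier B" for x y
  proof
    assume "?p x = ?p y"
    then have "x \<ominus> y \<in> J" using quotient_eq_iff_same_a_r_cos[OF Jid that] by simp
    moreover have "x = y \<oplus> (x \<ominus> y)" using that by algebra
    ultimately show "\<exists>j\<in>J. x = y \<oplus> j" by blast
  next
    assume "\<exists>j\<in>J. x = y \<oplus> j"
    then obtain j where j: "j \<in> J" "x = y \<oplus> j" by blast
    then have "x \<ominus> y = j" using that J.Icarr[OF j(1)] by algebra
    then show "?p x = ?p y" using quotient_eq_iff_same_a_r_cos[OF Jid that] j by simp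
  qed
  have comb2: "ring.combine ?Q [?p a, ?p b] [?p u, ?p v] = ?p (a \<otimes> u \<oplus> b \<otimes> v)"
    if "a \<in> k" "b \<in> k" "u \<in> carrier B" "v \<in> carrier B" for a b u v
    using that kc by (simp add: subset_iff)
  have comb1: "ring.combine ?Q [?p a] [?p u, ?p v] = ?p (a \<otimes> u \<oplus> \<zero> \<otimes> v)"
    if "a \<in> k" "u \<in> carrier B" "v \<in> carrier B" for a u v
    using that kc by (simp add: subset_iff)
  show ?thesis
    unfolding cotangent_dim_def Let_def J_def[symmetric]
  proof
    assume "ring.dimension ?Q 2 (?p ` k) (?p ` M)"
    from Q.exists_base[OF K' this] obtain Vs where
      Vs: "set Vs \<subseteq> carrier ?Q" "ring.independent ?Q (?p ` k) Vs" "length Vs = 2" "ring.Span ?Q (?p ` k) Vs = ?p ` M" by blast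
    then obtain P1 P2 where Vs2: "Vs = [P1, P2]" by (auto simp: numeral_2_eq_2 length_Suc_conv)
    have "set Vs \<subseteq> ?p ` M" using Q.Span_base_incl[OF K' Vs(1)] Vs(4) by simp
    then obtain u v where uv: "u \<in> M" "v \<in> M" "P1 = ?p u" "P2 = ?p v" unfolding Vs2 by auto
    have uvc: "u \<in> carrier B" "v \<in> carrier B" using uv M.Icarr by auto
    show "cotangent_basis_exists B k M"
      unfolding cotangent_basis_exists_def J_def[symmetric]
    proof (rule bexI[OF _ uv(1)], rule bexI[OF _ uv(2)], intro conjI ballI impI)
      fix m assume m: "m \<in> M"
      then have "?p m \<in> ring.Span ?Q (?p ` k) Vs" using Vs(4) by blast
      then obtain Ks where Ks: "length Ks = 2" "set Ks \<subseteq> ?p ` k" "?p m = ring.combine ?Q Ks Vs"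
        unfolding Q.Span_eq_combine_set_length_version[OF K' Vs(1)] Vs(3) by blast
      then obtain K1 K2 where "Ks = [K1, K2]" by (auto simp: numeral_2_eq_2 length_Suc_conv)
      then obtain a b where ab: "a \<in> k" "b \<in> k" "Ks = [?p a, ?p b]" using Ks(2) by auto
      then have "?p m = ?p (a \<otimes> u \<oplus> b \<otimes> v)"
        using Ks(3) comb2[OF ab(1,2) uvc] unfolding Vs2 uv ab(3) by simp
      moreover have "m \<in> carrier B" "a \<otimes> u \<oplus> b \<otimes> v \<in> carrier B" using m M.Icarr ab kc uvc by auto
      ultimately show "\<exists>a\<in>k. \<exists>b\<in>k. \<exists>j\<in>J. m = a \<otimes> u \<oplus> b \<otimes> v \<oplus> j" using peq ab by blast
    next
      fix a b assume ab: "a \<in> k" "b \<in> k" "a \<otimes> u \<oplus> b \<otimes> v \<in> J"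
      then have abc: "a \<in> carrier B" "b \<in> carrier B" using kc by auto
      have "?p (a \<otimes> u \<oplus> b \<otimes> v) = J" by (rule J.a_rcos_const[OF ab(3)])
      then have "ring.combine ?Q [?p a, ?p b] Vs = \<zero>\<^bsub>?Q\<^esub>"
        unfolding Vs2 uv comb2[OF ab(1,2) uvc] zeroQ .
      from Q.independent_imp_trivial_combine[OF K' Vs(2) _ this] ab Vs(3)
      have "?p a = \<zero>\<^bsub>?Q\<^esub>" "?p b = \<zero>\<^bsub>?Q\<^esub>" by auto
      then have "?p a = ?p \<zero>" "?p b = ?p \<zero>" by simp_all
      then show "a = \<zero>" "b = \<zero>" using inj_onD[OF inj] ab k0 by metis+
    qed
  next
    assume "cotangent_basis_exists B k M"
    then obtain u v where uv: "u \<in> M" "v \<in> M"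
      and span: "\<forall>m\<in>M. \<exists>a\<in>k. \<exists>b\<in>k. \<exists>j\<in>J. m = a \<otimes> u \<oplus> b \<otimes> v \<oplus> j"
      and ind: "\<forall>a\<in>k. \<forall>b\<in>k. a \<otimes> u \<oplus> b \<otimes> v \<in> J \<longrightarrow> a = \<zero> \<and> b = \<zero>"
      unfolding cotangent_basis_exists_def J_def[symmetric] by (elim bexE conjE) (rule that; assumption)
    have uvc: "u \<in> carrier B" "v \<in> carrier B" using uv M.Icarr by auto
    let ?Vs = "[?p u, ?p v]"
    have Vc: "set ?Vs \<subseteq> carrier ?Q" using uvc by auto
    have p00: "?p \<zero> = \<zero>\<^bsub>?Q\<^esub>" by simp
    have comb: "a = \<zero> \<and> b = \<zero>" if "a \<in> k" "b \<in> k" "?p (a \<otimes> u \<oplus> b \<otimes> v) = \<zero>\<^bsub>?Q\<^esub>" for a b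
    proof -
      have "a \<otimes> u \<oplus> b \<otimes> v \<in> carrier B" using that kc uvc by auto
      then have "a \<otimes> u \<oplus> b \<otimes> v \<in> J" using that(3) p0 zeroQ by simp
      then show ?thesis using ind that by blast
    qed
    have "ring.independent ?Q (?p ` k) ?Vs"
    proof (rule Q.trivial_combine_imp_independent[OF K' Vc])
      fix Ks assume Ks: "set Ks \<subseteq> ?p ` k" "ring.combine ?Q Ks ?Vs = \<zero>\<^bsub>?Q\<^esub>"
      show "set (take (length ?Vs) Ks) \<subseteq> {\<zero>\<^bsub>?Q\<^esub>}"
      proof (cases Ks)
        case (Cons K1 Ks')
        then obtain a where a: "a \<in> k" "K1 = ?p a" using Ks(1) by auto
        show ?thesis
        proof (cases Ks')
          case Nil
          have "ring.combine ?Q Ks ?Vs = ?p (a \<otimes> u \<oplus> \<zero> \<otimes> v)"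
            unfolding Cons Nil a(2) by (rule comb1[OF a(1) uvc])
          then have "a = \<zero>" using comb[of a \<zero>] a k0 Ks(2) by simp
          then show ?thesis using Cons Nil a p00 by simp
        next
          case (Cons K2 Ks'')
          then obtain b where b: "b \<in> k" "K2 = ?p b" using Ks(1) \<open>Ks = K1 # Ks'\<close> by auto
          have "ring.combine ?Q Ks ?Vs = ?p (a \<otimes> u \<oplus> b \<otimes> v)"
            unfolding Cons \<open>Ks = K1 # Ks'\<close> a(2) b(2) using comb2[OF a(1) b(1) uvc] by simp
          then have "a = \<zero> \<and> b = \<zero>" using comb[of a b] a b Ks(2) by simp
          then show ?thesis using Cons \<open>Ks = K1 # Ks'\<close> a b p00 by simp
        qed
      qed simp
    qed
    moreover have "ring.Span ?Q (?p ` k) ?Vs = ?p ` M"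
    proof -
      have "?p ` M \<subseteq> {ring.combine ?Q Ks ?Vs | Ks. length Ks = length ?Vs \<and> set Ks \<subseteq> ?p ` k}"
      proof
        fix y assume "y \<in> ?p ` M"
        then obtain m where m: "m \<in> M" "y = ?p m" by blast
        from bspec[OF span m(1)] obtain a b j
          where ab: "a \<in> k" "b \<in> k" "j \<in> J" "m = a \<otimes> u \<oplus> b \<otimes> v \<oplus> j" by (elim bexE) (rule that; assumption)
        have c: "a \<otimes> u \<oplus> b \<otimes> v \<in> carrier B" using ab kc uvc by auto
        have "y = ?p (a \<otimes> u \<oplus> b \<otimes> v)"
          unfolding m(2) using peq[OF M.Icarr[OF m(1)] c] ab by blast
        also have "\<dots> = ring.combine ?Q [?p a, ?p b] ?Vs"
          by (rule comb2[OF ab(1,2) uvc, symmetric])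
        finally show "y \<in> {ring.combine ?Q Ks ?Vs | Ks. length Ks = length ?Vs \<and> set Ks \<subseteq> ?p ` k}"
          using ab by (intro CollectI exI[of _ "[?p a, ?p b]"]) auto
      qed
      moreover have "{ring.combine ?Q Ks ?Vs | Ks. length Ks = length ?Vs \<and> set Ks \<subseteq> ?p ` k} \<subseteq> ?p ` M"
      proof
        fix y assume "y \<in> {ring.combine ?Q Ks ?Vs | Ks. length Ks = length ?Vs \<and> set Ks \<subseteq> ?p ` k}"
        then obtain Ks where Ks: "y = ring.combine ?Q Ks ?Vs" "length Ks = 2" "set Ks \<subseteq> ?p ` k" by auto
        then obtain K1 K2 where "Ks = [K1, K2]" by (auto simp: numeral_2_eq_2 length_Suc_conv)
        then obtain a b where ab: "a \<in> k" "b \<in> k" "Ks = [?p a, ?p b]" using Ks(3) by auto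
        then have "y = ?p (a \<otimes> u \<oplus> b \<otimes> v)" using Ks(1) comb2[OF ab(1,2) uvc] by simp
        moreover have "a \<otimes> u \<oplus> b \<otimes> v \<in> M" using ab kc uv M.I_l_closed by (auto intro!: M.a_closed)
        ultimately show "y \<in> ?p ` M" by blast
      qed
      ultimately show ?thesis
        unfolding Q.Span_eq_combine_set_length_version[OF K' Vc] by blast
    qed
    ultimately have "ring.dimension ?Q (length ?Vs) (?p ` k) (?p ` M)" by (rule Q.dimensionI[OF K'])
    then show "ring.dimension ?Q 2 (?p ` k) (?p ` M)" by (simp add: numeral_2_eq_2)
  qed
qed

inductive_set ideal_square :: "'t::comm_ring_1 set \<Rightarrow> 't set" for m where
  prod: "x \<in> m \<Longrightarrow> y \<in> m \<Longrightarrow> x * y \<in> ideal_square m"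
| sum: "x \<in> ideal_square m \<Longrightarrow> y \<in> ideal_square m \<Longrightarrow> x + y \<in> ideal_square m"

text \<open>Maximal ideals of a subring \<open>A\<close>; the last clause says that \<open>A / m\<close> is a field.\<close>

definition maximal_in :: "'t::comm_ring_1 set \<Rightarrow> 't set \<Rightarrow> bool" where
  "maximal_in A m \<longleftrightarrow> m \<subseteq> A \<and> 0 \<in> m \<and> 1 \<notin> m \<and> (\<forall>x\<in>m. \<forall>y\<in>m. x + y \<in> m) \<and>
     (\<forall>a\<in>A. \<forall>x\<in>m. a * x \<in> m) \<and> (\<forall>x\<in>A - m. \<exists>y\<in>A. x * y - 1 \<in> m)"

definition cotangent_basis_in :: "'t::comm_ring_1 set \<Rightarrow> 't set \<Rightarrow> bool" where
  "cotangent_basis_in k m \<longleftrightarrow> (\<exists>u\<in>m. \<exists>v\<in>m.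
     (\<forall>x\<in>m. \<exists>a\<in>k. \<exists>b\<in>k. \<exists>j\<in>ideal_square m. x = a * u + b * v + j) \<and>
     (\<forall>a\<in>k. \<forall>b\<in>k. a * u + b * v \<in> ideal_square m \<longrightarrow> a = 0 \<and> b = 0))"

text \<open>The elements of the normalization ring are classes of pairs of cosets.  To compute with them, the
  ring is replaced by an isomorphic subring \<open>A\<close> of a type-class ring; \<open>c0\<close> embeds the ground field.\<close>

locale ring_model =
  fixes N :: "('n, 'b) ring_scheme" (structure) and A :: "'t::comm_ring_1 set" and \<theta> :: "'t \<Rightarrow> 'n"
    and c0 :: "'k::field \<Rightarrow> 't"
  assumes A: "0 \<in> A" "1 \<in> A" "\<And>x y. x \<in> A \<Longrightarrow> y \<in> A \<Longrightarrow> x + y \<in> A"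
      "\<And>x y. x \<in> A \<Longrightarrow> y \<in> A \<Longrightarrow> x * y \<in> A" "\<And>x. x \<in> A \<Longrightarrow> - x \<in> A"
    and bij: "bij_betw \<theta> A (carrier N)"
    and theta_add: "\<And>x y. x \<in> A \<Longrightarrow> y \<in> A \<Longrightarrow> \<theta> (x + y) = \<theta> x \<oplus> \<theta> y"
    and theta_mult: "\<And>x y. x \<in> A \<Longrightarrow> y \<in> A \<Longrightarrow> \<theta> (x * y) = \<theta> x \<otimes> \<theta> y"
    and theta_one: "\<theta> 1 = \<one>" and theta_zero: "\<theta> 0 = \<zero>"
    and c0: "\<And>a. c0 a \<in> A" "\<And>a b. c0 (a + b) = c0 a + c0 b" "\<And>a b. c0 (a * b) = c0 a * c0 b" "c0 1 = 1"
begin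

definition AR :: "'t ring" where
  "AR = \<lparr>carrier = A, monoid.mult = (*), one = 1, ring.zero = 0, add = (+)\<rparr>"

lemma AR_cring: "cring AR"
proof (rule cringI)
  show "abelian_group AR"
    by (rule abelian_groupI) (auto simp: AR_def algebra_simps A intro: bexI[of _ "- _"])
  show "comm_monoid AR"
    by (rule comm_monoidI) (auto simp: AR_def algebra_simps A)
qed (auto simp: AR_def algebra_simps)

lemma theta_iso: "\<theta> \<in> ring_iso AR N"
  by (rule ring_iso_memI) (use bij in \<open>auto simp: AR_def theta_add theta_mult theta_one bij_betw_def\<close>)

lemma cring_N: "cring N"
proof -
  interpret AR: cring AR by (rule AR_cring)
  have "cring (N\<lparr>zero := \<theta> \<zero>\<^bsub>AR\<^esub>\<rparr>)" by (rule AR.ring_iso_imp_img_cring[OF theta_iso])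
  moreover have "N\<lparr>zero := \<theta> \<zero>\<^bsub>AR\<^esub>\<rparr> = N" by (simp add: AR_def theta_zero)
  ultimately show ?thesis by simp
qed

lemma inj: "inj_on \<theta> A" and surj: "\<theta> ` A = carrier N"
  using bij by (auto simp: bij_betw_def)

lemma theta_eq: "x \<in> A \<Longrightarrow> y \<in> A \<Longrightarrow> \<theta> x = \<theta> y \<longleftrightarrow> x = y"
  using inj by (auto dest: inj_onD)

lemma theta_uminus: "x \<in> A \<Longrightarrow> \<theta> (- x) = \<ominus> \<theta> x"
proof -
  interpret cring N by (rule cring_N)
  assume x: "x \<in> A"
  have c: "\<theta> x \<in> carrier N" "\<theta> (- x) \<in> carrier N" using x surj A by auto
  have "\<theta> (- x) \<oplus> \<theta> x = \<zero>" using theta_add[of "- x" x] x A theta_zero by simp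
  then show ?thesis using c minus_equality by simp
qed

lemma c0_zero: "c0 0 = 0" using c0(2)[of 0 0] by simp

lemma subfield_scalars: "subfield (\<theta> ` range c0) N"
proof -
  interpret cring N by (rule cring_N)
  let ?K = "\<theta> ` range c0"
  have uminus: "c0 (- a) = - c0 a" for a using c0(2)[of a "- a"] c0_zero by (simp add: eq_neg_iff_add_eq_0 add.commute)
  have sub: "?K \<subseteq> carrier N" using surj c0(1) by blast
  have "subring ?K N"
  proof (rule subringI[OF sub])
    show "\<one> \<in> ?K" using c0(4) theta_one by (metis imageI rangeI)
    show "\<ominus> h \<in> ?K" if "h \<in> ?K" for h
      using that c0(1) by (auto simp flip: theta_uminus uminus)
    show "h1 \<otimes> h2 \<in> ?K" if "h1 \<in> ?K" "h2 \<in> ?K" for h1 h2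
      using that c0 by (auto simp flip: theta_mult c0(3))
    show "h1 \<oplus> h2 \<in> ?K" if "h1 \<in> ?K" "h2 \<in> ?K" for h1 h2
      using that c0 by (auto simp flip: theta_add c0(2))
  qed
  then have subc: "subcring ?K N"
    using sub m_comm by (intro subcringI) blast+
  have "Units (N\<lparr>carrier := ?K\<rparr>) = ?K - {\<zero>}"
  proof
    show "Units (N\<lparr>carrier := ?K\<rparr>) \<subseteq> ?K - {\<zero>}"
    proof
      fix y assume "y \<in> Units (N\<lparr>carrier := ?K\<rparr>)"
      then obtain x where x: "y \<in> ?K" "x \<in> ?K" "x \<otimes> y = \<one>" unfolding Units_def by auto
      have "y \<noteq> \<zero>"
      proof
        assume "y = \<zero>"
        then have "x \<otimes> \<zero> = \<one>" using x by simp
        moreover have "x \<otimes> \<zero> = \<zero>" by (rule r_null) (use x sub in blast)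
        ultimately have "\<zero> = \<one>" by simp
        then have "\<theta> 0 = \<theta> 1" using theta_zero theta_one by simp
        then show False using theta_eq A by auto
      qed
      then show "y \<in> ?K - {\<zero>}" using x by blast
    qed
    show "?K - {\<zero>} \<subseteq> Units (N\<lparr>carrier := ?K\<rparr>)"
    proof
      fix y assume y: "y \<in> ?K - {\<zero>}"
      then obtain a where a: "y = \<theta> (c0 a)" by auto
      then have "a \<noteq> 0" using y c0_zero theta_zero by auto
      then have "c0 (inverse a) * c0 a = 1" using c0(3)[of "inverse a" a] c0(4) by simp
      then have "\<theta> (c0 (inverse a)) \<otimes> y = \<one>" using a c0(1) theta_mult theta_one by metis
      moreover from this have "y \<otimes> \<theta> (c0 (inverse a)) = \<one>" using sub a y m_comm by (metis DiffD1 imageI rangeI subsetD)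
      ultimately show "y \<in> Units (N\<lparr>carrier := ?K\<rparr>)" using y unfolding Units_def by auto
    qed
  qed
  then show ?thesis by (intro subfieldI subc)
qed

lemma image_ideal_square:
  assumes "m \<subseteq> A"
  shows "ideal_prod N (\<theta> ` m) (\<theta> ` m) = \<theta> ` ideal_square m" and "ideal_square m \<subseteq> A"
proof -
  show sqA: "ideal_square m \<subseteq> A"
  proof
    fix x assume "x \<in> ideal_square m" then show "x \<in> A"
      by induction (use assms in \<open>auto intro!: A(3,4)\<close>)
  qed
  show "ideal_prod N (\<theta> ` m) (\<theta> ` m) = \<theta> ` ideal_square m"
  proof (intro equalityI subsetI)
    fix s assume "s \<in> ideal_prod N (\<theta> ` m) (\<theta> ` m)"
    then show "s \<in> \<theta> ` ideal_square m"
    proof induction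
      case (prod i j)
      then obtain x y where "x \<in> m" "y \<in> m" "i = \<theta> x" "j = \<theta> y" by blast
      then have "i \<otimes> j = \<theta> (x * y)" using assms theta_mult by (simp add: subset_iff)
      then show ?case using \<open>x \<in> m\<close> \<open>y \<in> m\<close> by (auto intro!: imageI ideal_square.prod)
    next
      case (sum s1 s2)
      then obtain x y where "x \<in> ideal_square m" "y \<in> ideal_square m" "s1 = \<theta> x" "s2 = \<theta> y" by blast
      then have "s1 \<oplus> s2 = \<theta> (x + y)" using sqA theta_add by (simp add: subset_iff)
      then show ?case using \<open>x \<in> ideal_square m\<close> \<open>y \<in> ideal_square m\<close> by (auto intro!: imageI ideal_square.sum)
    qed
  next
    fix s assume "s \<in> \<theta> ` ideal_square m"
    then obtain x where x: "x \<in> ideal_square m" "s = \<theta> x" by blast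
    from x(1) have "\<theta> x \<in> ideal_prod N (\<theta> ` m) (\<theta> ` m)"
    proof induction
      case (prod x y)
      then have "\<theta> (x * y) = \<theta> x \<otimes> \<theta> y" using assms theta_mult by (simp add: subset_iff)
      then show ?case using prod by (auto intro!: ideal_prod.prod)
    next
      case (sum x y)
      then have "\<theta> (x + y) = \<theta> x \<oplus> \<theta> y" using sqA theta_add by (simp add: subset_iff)
      then show ?case using sum by (auto intro!: ideal_prod.sum)
    qed
    with x show "s \<in> ideal_prod N (\<theta> ` m) (\<theta> ` m)" by simp
  qed
qed

lemma cotangent_basis_transfer:
  assumes m: "m \<subseteq> A"
  shows "cotangent_basis_exists N (\<theta> ` range c0) (\<theta> ` m) \<longleftrightarrow> cotangent_basis_in (range c0) m"
proof -
  note sq = image_ideal_square[OF m]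
  have lin: "\<theta> a \<otimes> \<theta> u \<oplus> \<theta> b \<otimes> \<theta> v = \<theta> (a * u + b * v)"
    if "a \<in> range c0" "b \<in> range c0" "u \<in> m" "v \<in> m" for a b u v
  proof -
    have "a \<in> A" "b \<in> A" "u \<in> A" "v \<in> A" using that m c0(1) by auto
    then show ?thesis using A(4) by (simp add: theta_add theta_mult)
  qed
  have linA: "a * u + b * v \<in> A" if "a \<in> range c0" "b \<in> range c0" "u \<in> m" "v \<in> m" for a b u v
    using that m c0(1) by (auto intro!: A(3,4))
  have lin2: "\<theta> x = \<theta> a \<otimes> \<theta> u \<oplus> \<theta> b \<otimes> \<theta> v \<oplus> \<theta> j \<longleftrightarrow> x = a * u + b * v + j"
    if h: "a \<in> range c0" "b \<in> range c0" "u \<in> m" "v \<in> m" "x \<in> m" "j \<in> ideal_square m" for a b u v x j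
  proof -
    have "\<theta> a \<otimes> \<theta> u \<oplus> \<theta> b \<otimes> \<theta> v \<oplus> \<theta> j = \<theta> (a * u + b * v + j)"
      using lin[OF h(1-4)] linA[OF h(1-4)] h(6) sq(2) theta_add by auto
    moreover have "a * u + b * v + j \<in> A" "x \<in> A" using linA[OF h(1-4)] h sq(2) m A by auto
    ultimately show ?thesis using theta_eq by metis
  qed
  have mem: "\<theta> x \<in> \<theta> ` ideal_square m \<longleftrightarrow> x \<in> ideal_square m" if "x \<in> A" for x
    using that sq(2) theta_eq by (metis (no_types, lifting) imageE imageI subsetD)
  have z: "\<theta> a = \<zero> \<longleftrightarrow> a = 0" if "a \<in> range c0" for a
    using that c0(1) theta_eq[of a 0] theta_zero A by auto
  have "cotangent_basis_exists N (\<theta> ` range c0) (\<theta> ` m) \<longleftrightarrow> (\<exists>u\<in>m. \<exists>v\<in>m.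
     (\<forall>x\<in>m. \<exists>a\<in>range c0. \<exists>b\<in>range c0. \<exists>j\<in>ideal_square m. \<theta> x = \<theta> a \<otimes> \<theta> u \<oplus> \<theta> b \<otimes> \<theta> v \<oplus> \<theta> j) \<and>
     (\<forall>a\<in>range c0. \<forall>b\<in>range c0. \<theta> a \<otimes> \<theta> u \<oplus> \<theta> b \<otimes> \<theta> v \<in> \<theta> ` ideal_square m \<longrightarrow> \<theta> a = \<zero> \<and> \<theta> b = \<zero>))"
    unfolding cotangent_basis_exists_def sq(1) by (simp only: Set.ball_simps Set.bex_simps)
  also have "\<dots> \<longleftrightarrow> cotangent_basis_in (range c0) m"
    unfolding cotangent_basis_in_def
    by (intro bex_cong refl conj_cong ball_cong)
      (simp_all only: lin2, simp_all only: lin linA mem z)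
  finally show ?thesis .
qed

lemma maximal_in_imp_maximalideal:
  assumes "maximal_in A m"
  shows "maximalideal (\<theta> ` m) N"
proof -
  interpret cring N by (rule cring_N)
  have m: "m \<subseteq> A" "0 \<in> m" "1 \<notin> m" "\<And>x y. x \<in> m \<Longrightarrow> y \<in> m \<Longrightarrow> x + y \<in> m"
    "\<And>a x. a \<in> A \<Longrightarrow> x \<in> m \<Longrightarrow> a * x \<in> m" "\<And>x. x \<in> A \<Longrightarrow> x \<notin> m \<Longrightarrow> \<exists>y\<in>A. x * y - 1 \<in> m"
    using assms unfolding maximal_in_def by blast+
  have neg: "- x \<in> m" if "x \<in> m" for x using m(5)[of "- 1" x] that A by simp
  have sub: "\<theta> ` m \<subseteq> carrier N" using m(1) surj by blast
  have lcl: "x \<otimes> a \<in> \<theta> ` m" if h: "a \<in> \<theta> ` m" "x \<in> carrier N" for a x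
  proof -
    obtain y where "y \<in> A" "x = \<theta> y" using h(2) surj by auto
    moreover obtain b where "b \<in> m" "a = \<theta> b" using h(1) by auto
    ultimately have "x \<otimes> a = \<theta> (y * b)" "y * b \<in> m" using theta_mult m(1,5) by (auto simp: subset_iff)
    then show ?thesis by simp
  qed
  have id: "ideal (\<theta> ` m) N"
  proof (rule idealI)
    show "ring N" by (rule ring_axioms)
    show "subgroup (\<theta> ` m) (add_monoid N)"
    proof (rule add.subgroupI)
      show "\<theta> ` m \<subseteq> carrier N" by (rule sub)
      show "\<theta> ` m \<noteq> {}" using m by blast
      show "\<ominus> a \<in> \<theta> ` m" if "a \<in> \<theta> ` m" for a
      proof -
        obtain x where x: "x \<in> m" "a = \<theta> x" using \<open>a \<in> \<theta> ` m\<close> by blast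
        then have "\<ominus> a = \<theta> (- x)" using theta_uminus m(1) by (simp add: subset_iff)
        then show ?thesis using neg x by simp
      qed
      show "a \<oplus> b \<in> \<theta> ` m" if "a \<in> \<theta> ` m" "b \<in> \<theta> ` m" for a b
      proof -
        obtain x y where "x \<in> m" "a = \<theta> x" "y \<in> m" "b = \<theta> y" using \<open>a \<in> \<theta> ` m\<close> \<open>b \<in> \<theta> ` m\<close> by blast
        then have "a \<oplus> b = \<theta> (x + y)" "x + y \<in> m" using theta_add m(1,4) by (auto simp: subset_iff)
        then show ?thesis by simp
      qed
    qed
    show "x \<otimes> a \<in> \<theta> ` m" if "a \<in> \<theta> ` m" "x \<in> carrier N" for a x by (rule lcl[OF that])
    show "a \<otimes> x \<in> \<theta> ` m" if "a \<in> \<theta> ` m" "x \<in> carrier N" for a x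
      using lcl[OF that] that sub m_comm[of a x] by auto
  qed
  show ?thesis
  proof (rule maximalidealI[OF id])
    have "\<theta> 1 \<notin> \<theta> ` m" using m theta_eq A by (metis (no_types, lifting) imageE subsetD)
    then show "carrier N \<noteq> \<theta> ` m" using theta_one by auto
  next
    fix J assume J: "ideal J N" "\<theta> ` m \<subseteq> J" "J \<subseteq> carrier N"
    interpret J: ideal J N by fact
    show "J = \<theta> ` m \<or> J = carrier N"
    proof (cases "J \<subseteq> \<theta> ` m")
      case False
      then obtain w where w: "w \<in> J" "w \<notin> \<theta> ` m" by auto
      then have "w \<in> \<theta> ` A" using J(3) surj by auto
      then obtain x where x: "x \<in> A" "\<theta> x \<in> J" "\<theta> x \<notin> \<theta> ` m" using w by auto
      then have "x \<notin> m" by auto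
      then obtain y where y: "y \<in> A" "x * y - 1 \<in> m" using m(6)[OF x(1)] by auto
      have mA: "- (x * y - 1) \<in> A" using neg[OF y(2)] m(1) by blast
      have "\<one> = \<theta> (x * y + - (x * y - 1))" using theta_one by simp
      also have "\<dots> = \<theta> (x * y) \<oplus> \<theta> (- (x * y - 1))" by (rule theta_add[OF A(4)[OF x(1) y(1)] mA])
      also have "\<dots> = \<theta> x \<otimes> \<theta> y \<oplus> \<theta> (- (x * y - 1))" by (simp only: theta_mult[OF x(1) y(1)])
      finally have "\<one> = \<theta> x \<otimes> \<theta> y \<oplus> \<theta> (- (x * y - 1))" .
      moreover have "\<theta> x \<otimes> \<theta> y \<in> J" by (rule J.I_r_closed[OF x(2)]) (use y(1) surj in auto)
      moreover have "\<theta> (- (x * y - 1)) \<in> J" by (rule subsetD[OF J(2) imageI[OF neg[OF y(2)]]])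
      ultimately have "\<one> \<in> J" using J.a_closed by simp
      then show ?thesis using J.one_imp_carrier by simp
    qed (use J in simp)
  qed
qed

lemma maximalideal_imp_maximal_in:
  assumes "maximalideal M N"
  shows "\<exists>m. M = \<theta> ` m \<and> maximal_in A m"
proof -
  interpret cring N by (rule cring_N)
  interpret M: maximalideal M N by fact
  define m where "m = {x \<in> A. \<theta> x \<in> M}"
  have Mm: "M = \<theta> ` m"
  proof (intro equalityI subsetI)
    fix z assume z: "z \<in> M"
    then have "z \<in> \<theta> ` A" using M.a_subset surj by auto
    then show "z \<in> \<theta> ` m" using z by (auto simp: m_def)
  qed (auto simp: m_def)
  have "maximal_in A m"
    unfolding maximal_in_def
  proof (intro conjI ballI)
    show "m \<subseteq> A" by (auto simp: m_def)
    show "0 \<in> m" using A theta_zero M.zero_closed by (simp add: m_def)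
    show "1 \<notin> m" using theta_one M.one_imp_carrier M.I_notcarr by (auto simp: m_def)
    show "x + y \<in> m" if "x \<in> m" "y \<in> m" for x y
      using that A theta_add[of x y] M.a_closed by (simp add: m_def)
    show "a * x \<in> m" if "a \<in> A" "x \<in> m" for a x
    proof -
      have "\<theta> a \<in> carrier N" using that(1) surj by blast
      then have "\<theta> a \<otimes> \<theta> x \<in> M" using that(2) M.I_l_closed by (simp add: m_def)
      then show ?thesis using that A(4) theta_mult[of a x] by (simp add: m_def)
    qed
    show "\<exists>y\<in>A. x * y - 1 \<in> m" if x: "x \<in> A - m" for x
    proof -
      have xc: "\<theta> x \<in> carrier N" using that surj by blast
      let ?J = "M <+>\<^bsub>N\<^esub> PIdl (\<theta> x)"
      have J: "ideal ?J N" by (rule add_ideals[OF M.is_ideal cgenideal_ideal[OF xc]])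
      have "M \<subseteq> ?J"
      proof
        fix z assume z: "z \<in> M"
        have "\<zero> \<in> PIdl (\<theta> x)" using cgenideal_ideal[OF xc] by (simp add: additive_subgroup.zero_closed ideal.axioms(1))
        then have "z \<oplus> \<zero> \<in> ?J" using z unfolding set_add_def' by blast
        then show "z \<in> ?J" using z M.Icarr by simp
      qed
      moreover have "\<theta> x \<in> ?J"
      proof -
        have "\<zero> \<oplus> \<theta> x \<in> ?J" using M.zero_closed cgenideal_self[OF xc] unfolding set_add_def' by blast
        then show ?thesis using xc by simp
      qed
      moreover have "\<theta> x \<notin> M" using x by (simp add: m_def)
      ultimately have "?J = carrier N" using M.I_maximal[OF J] ideal.Icarr[OF J] by blast
      then have "\<one> \<in> ?J" by simp
      then obtain z w where zw: "z \<in> M" "w \<in> PIdl (\<theta> x)" "\<one> = z \<oplus> w" unfolding set_add_def' by blast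
      then obtain t where t: "t \<in> carrier N" "w = t \<otimes> \<theta> x" unfolding cgenideal_def by blast
      obtain y where y: "y \<in> A" "t = \<theta> y" using t surj by blast
      obtain z' where z': "z' \<in> m" "z = \<theta> z'" using zw Mm by blast
      have z'A: "z' \<in> A" using z' by (simp add: m_def)
      have xA: "x \<in> A" using x by simp
      have "\<theta> 1 = z \<oplus> t \<otimes> \<theta> x" using zw(3) t(2) theta_one by simp
      also have "\<dots> = \<theta> z' \<oplus> \<theta> (y * x)" by (simp only: y(2) z'(2) theta_mult[OF y(1) xA])
      also have "\<dots> = \<theta> (z' + y * x)" by (rule theta_add[symmetric, OF z'A A(4)[OF y(1) xA]])
      finally have "\<theta> 1 = \<theta> (z' + y * x)" .
      then have "1 = z' + y * x" using theta_eq[OF A(2) A(3)[OF z'A A(4)[OF y(1) xA]]] by simp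
      then have "x * y - 1 = - z'" by (simp add: algebra_simps)
      moreover have "- z' \<in> m" using z' theta_uminus[OF z'A] A by (auto simp: m_def)
      ultimately show ?thesis using y by metis
    qed
  qed
  then show ?thesis using Mm by blast
qed

theorem all_cotangent_dim_2_iff:
  "(\<forall>M. maximalideal M N \<longrightarrow> cotangent_dim N (\<theta> ` range c0) M 2) \<longleftrightarrow>
   (\<forall>m. maximal_in A m \<longrightarrow> cotangent_basis_in (range c0) m)"
proof -
  interpret cring N by (rule cring_N)
  have key: "cotangent_dim N (\<theta> ` range c0) (\<theta> ` m) 2 \<longleftrightarrow> cotangent_basis_in (range c0) m"
    if "maximal_in A m" for m
  proof -
    interpret M: maximalideal "\<theta> ` m" N by (rule maximal_in_imp_maximalideal[OF that])
    have "\<one> \<notin> \<theta> ` m" using M.one_imp_carrier M.I_notcarr by blast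
    moreover have "m \<subseteq> A" using that by (simp add: maximal_in_def)
    ultimately show ?thesis
      using cotangent_dim_2_iff[OF cring_N subfield_scalars M.is_ideal] cotangent_basis_transfer by simp
  qed
  then show ?thesis
    using maximal_in_imp_maximalideal maximalideal_imp_maximal_in by metis
qed

end

section \<open>The normalization ring inside a field of rational functions\<close>

text \<open>The situation of an irreducible variety: \<open>\<phi>\<close> restricts polynomials to the variety, and its codomain is
the function field, which consists of the fractions of such restrictions.\<close>

locale function_field_model =
  fixes \<phi> :: "'p::comm_ring_1 \<Rightarrow> 'f::field"
  assumes phi_add: "\<And>x y. \<phi> (x + y) = \<phi> x + \<phi> y" and phi_mult: "\<And>x y. \<phi> (x * y) = \<phi> x * \<phi> y"
    and phi_one: "\<phi> 1 = 1"
    and fractions: "\<And>z. \<exists>a b. \<phi> b \<noteq> 0 \<and> \<phi> a = z * \<phi> b"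
begin

definition "ker = {f. \<phi> f = 0}"

definition R :: "'p set ring" where "R = ring_of_type_algebra Quot ker"

definition cls :: "'f \<Rightarrow> 'p set" where "cls y = {f. \<phi> f = y}"

text \<open>The element of the fraction field, as a class of pairs of cosets, that corresponds to \<open>z\<close>.\<close>

definition \<theta> :: "'f \<Rightarrow> ('p set \<times> 'p set) set" where
  "\<theta> z = {(cls u, cls v) | u v. u \<in> range \<phi> \<and> v \<in> range \<phi> \<and> v \<noteq> 0 \<and> u = z * v}"

lemma phi_zero: "\<phi> 0 = 0" using phi_add[of 0 0] by (metis add_cancel_right_right add_0)

lemma phi_diff: "\<phi> (x - y) = \<phi> x - \<phi> y"
  using phi_add[of "x - y" y] by (simp add: eq_diff_eq)

lemma coset: "ker +>\<^bsub>ring_of_type_algebra\<^esub> f = cls (\<phi> f)"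
proof -
  have "g \<in> cls (\<phi> f) \<longleftrightarrow> (\<exists>h. \<phi> h = 0 \<and> g = h + f)" for g
  proof
    assume "g \<in> cls (\<phi> f)"
    then show "\<exists>h. \<phi> h = 0 \<and> g = h + f"
      by (intro exI[of _ "g - f"]) (simp add: cls_def phi_diff)
  qed (auto simp: cls_def phi_add)
  then show ?thesis unfolding a_r_coset_def' by (auto simp: ker_def ring_of_type_algebra_def)
qed

lemma cls_inj: "u \<in> range \<phi> \<Longrightarrow> cls u = cls v \<longleftrightarrow> u = v"
  by (auto simp: cls_def)

lemma carrier_R: "carrier R = cls ` range \<phi>"
  unfolding R_def FactRing_def A_RCOSETS_def' coset
  by (auto simp: coset A_RCOSETS_def' ring_of_type_algebra_def)

lemma range_mult: "u \<in> range \<phi> \<Longrightarrow> v \<in> range \<phi> \<Longrightarrow> u * v \<in> range \<phi>"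
  by (auto simp flip: phi_mult)

lemma range_add: "u \<in> range \<phi> \<Longrightarrow> v \<in> range \<phi> \<Longrightarrow> u + v \<in> range \<phi>"
  by (auto simp flip: phi_add)

lemma mult_R: "u \<in> range \<phi> \<Longrightarrow> v \<in> range \<phi> \<Longrightarrow> cls u \<otimes>\<^bsub>R\<^esub> cls v = cls (u * v)"
proof -
  assume "u \<in> range \<phi>" "v \<in> range \<phi>"
  then obtain f g where fg: "u = \<phi> f" "v = \<phi> g" by blast
  have "f \<otimes>\<^bsub>ring_of_type_algebra\<^esub> g = f * g" for f g :: 'p by (simp add: ring_of_type_algebra_def)
  then show ?thesis
    unfolding R_def FactRing_def rcoset_mult_def coset using fg
    by (auto simp: cls_def phi_mult coset)
qed

lemma add_R: "u \<in> range \<phi> \<Longrightarrow> v \<in> range \<phi> \<Longrightarrow> cls u \<oplus>\<^bsub>R\<^esub> cls v = cls (u + v)"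
proof -
  assume "u \<in> range \<phi>" "v \<in> range \<phi>"
  then obtain f g where fg: "u = \<phi> f" "v = \<phi> g" by blast
  have "k \<in> cls (u + v) \<longleftrightarrow> (\<exists>a b. a \<in> cls u \<and> b \<in> cls v \<and> k = a + b)" for k
  proof
    assume "k \<in> cls (u + v)"
    then show "\<exists>a b. a \<in> cls u \<and> b \<in> cls v \<and> k = a + b"
      using fg by (intro exI[of _ f] exI[of _ "k - f"]) (simp add: cls_def phi_diff)
  qed (auto simp: cls_def phi_add)
  then have "cls (u + v) = {a + b | a b. a \<in> cls u \<and> b \<in> cls v}" by blast
  moreover have "cls u <+>\<^bsub>ring_of_type_algebra\<^esub> cls v = {a + b | a b. a \<in> cls u \<and> b \<in> cls v}"
    by (auto simp: set_add_def' ring_of_type_algebra_def)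
  ultimately show ?thesis unfolding R_def FactRing_def by simp
qed

lemma one_R: "\<one>\<^bsub>R\<^esub> = cls 1"
proof -
  have "\<one>\<^bsub>(ring_of_type_algebra :: 'p ring)\<^esub> = 1" by (simp add: ring_of_type_algebra_def)
  then show ?thesis unfolding R_def FactRing_def by (simp add: coset phi_one)
qed

lemma zero_R: "\<zero>\<^bsub>R\<^esub> = cls 0"
  unfolding R_def FactRing_def by (auto simp: ker_def cls_def)

lemma carrier_R_nonzero: "carrier R - {\<zero>\<^bsub>R\<^esub>} = cls ` (range \<phi> - {0})"
  unfolding carrier_R zero_R using cls_inj by auto

lemma range_01: "0 \<in> range \<phi>" "1 \<in> range \<phi>"
  using phi_zero phi_one by (metis rangeI)+

lemma fraction_eq:
  assumes "u \<in> range \<phi>" "v \<in> range \<phi>" "v \<noteq> 0"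
  shows "fraction R (cls u) (cls v) = \<theta> (u / v)"
proof -
  have "(c, d) \<in> fraction R (cls u) (cls v) \<longleftrightarrow> (c, d) \<in> \<theta> (u / v)" for c d
  proof
    assume "(c, d) \<in> fraction R (cls u) (cls v)"
    then have "c \<in> cls ` range \<phi>" "d \<in> cls ` (range \<phi> - {0})" and eq: "cls u \<otimes>\<^bsub>R\<^esub> d = c \<otimes>\<^bsub>R\<^esub> cls v"
      unfolding fraction_def fraction_rel_def carrier_R_nonzero[symmetric] carrier_R[symmetric] by auto
    then obtain u' v' where uv: "c = cls u'" "d = cls v'" "u' \<in> range \<phi>" "v' \<in> range \<phi>" "v' \<noteq> 0" by blast
    then have "cls (u * v') = cls (u' * v)" using eq assms mult_R by simp
    then have "u * v' = u' * v" using cls_inj range_mult assms uv by metis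
    then have "u' = u / v * v'" using assms(3) by (simp add: field_simps)
    then show "(c, d) \<in> \<theta> (u / v)" unfolding \<theta>_def using uv by blast
  next
    assume "(c, d) \<in> \<theta> (u / v)"
    then obtain u' v' where uv: "c = cls u'" "d = cls v'" "u' \<in> range \<phi>" "v' \<in> range \<phi>" "v' \<noteq> 0" "u' = u / v * v'"
      unfolding \<theta>_def by blast
    then have "u * v' = u' * v" using assms(3) by simp
    then have "cls u \<otimes>\<^bsub>R\<^esub> d = c \<otimes>\<^bsub>R\<^esub> cls v" using uv assms mult_R by simp
    moreover have "cls u \<in> carrier R" "c \<in> carrier R" using carrier_R assms uv by auto
    moreover have "cls v \<in> carrier R - {\<zero>\<^bsub>R\<^esub>}" "d \<in> carrier R - {\<zero>\<^bsub>R\<^esub>}"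
      unfolding carrier_R_nonzero using assms uv by auto
    ultimately show "(c, d) \<in> fraction R (cls u) (cls v)"
      unfolding fraction_def fraction_rel_def by blast
  qed
  then show ?thesis by auto
qed

lemma obtain_frac: obtains u v where "u \<in> range \<phi>" "v \<in> range \<phi>" "v \<noteq> 0" "z = u / v"
proof -
  obtain a b where ab: "\<phi> b \<noteq> 0" "\<phi> a = z * \<phi> b" using fractions by blast
  then have "z = \<phi> a / \<phi> b" by simp
  then show ?thesis using that ab(1) by blast
qed

lemma theta_elem:
  assumes "(c, d) \<in> \<theta> z"
  obtains u v where "c = cls u" "d = cls v" "u \<in> range \<phi>" "v \<in> range \<phi>" "v \<noteq> 0" "z = u / v"
proof -
  obtain u v where uv: "c = cls u" "d = cls v" "u \<in> range \<phi>" "v \<in> range \<phi>" "v \<noteq> 0" "u = z * v"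
    using assms unfolding \<theta>_def by blast
  then have "z = u / v" by simp
  then show ?thesis by (rule that[OF uv(1-5)])
qed

lemma theta_nonempty: "\<exists>p. p \<in> \<theta> z"
proof -
  obtain u v where "u \<in> range \<phi>" "v \<in> range \<phi>" "v \<noteq> 0" "z = u / v" by (rule obtain_frac)
  then have "(cls u, cls v) \<in> \<theta> z" unfolding \<theta>_def by (intro CollectI exI[of _ u] exI[of _ v]) simp
  then show ?thesis by blast
qed

lemma theta_inj: "\<theta> z = \<theta> w \<longleftrightarrow> z = w"
proof
  assume eq: "\<theta> z = \<theta> w"
  obtain c d where cd: "(c, d) \<in> \<theta> z" using theta_nonempty by force
  then obtain u v where uv: "c = cls u" "d = cls v" "u \<in> range \<phi>" "v \<in> range \<phi>" "v \<noteq> 0" "z = u / v"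
    by (rule theta_elem)
  from cd eq have "(c, d) \<in> \<theta> w" by simp
  then obtain u' v' where uv': "c = cls u'" "d = cls v'" "u' \<in> range \<phi>" "v' \<in> range \<phi>" "v' \<noteq> 0" "w = u' / v'"
    by (rule theta_elem)
  have "u = u'" "v = v'" using uv uv' cls_inj by metis+
  then show "z = w" using uv uv' by simp
qed simp

abbreviation "L \<equiv> fraction_field R"

lemma carrier_L: "carrier L = range \<theta>"
proof -
  have L: "x \<in> carrier L \<longleftrightarrow> (\<exists>a\<in>carrier R. \<exists>b\<in>carrier R - {\<zero>\<^bsub>R\<^esub>}. x = fraction R a b)" for x
    by (auto simp: fraction_field_def fraction_def quotient_def)
  show ?thesis
  proof (intro equalityI subsetI)
    fix x assume "x \<in> carrier L"
    then obtain a b where ab: "a \<in> carrier R" "b \<in> carrier R - {\<zero>\<^bsub>R\<^esub>}" "x = fraction R a b" using L by blast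
    obtain u where u: "u \<in> range \<phi>" "a = cls u" using ab(1) carrier_R by auto
    obtain v where v: "v \<in> range \<phi>" "v \<noteq> 0" "b = cls v" using ab(2) unfolding carrier_R_nonzero by auto
    show "x \<in> range \<theta>" using ab(3) u(2) v(3) fraction_eq[OF u(1) v(1,2)] by simp
  next
    fix x assume "x \<in> range \<theta>"
    then obtain z where z: "x = \<theta> z" by blast
    obtain u v where uv: "u \<in> range \<phi>" "v \<in> range \<phi>" "v \<noteq> 0" "z = u / v" by (rule obtain_frac)
    have "cls u \<in> carrier R" using uv(1) carrier_R by simp
    moreover have "cls v \<in> carrier R - {\<zero>\<^bsub>R\<^esub>}" unfolding carrier_R_nonzero using uv(2,3) by simp
    moreover have "x = fraction R (cls u) (cls v)" using z uv(4) fraction_eq[OF uv(1-3)] by simp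
    ultimately show "x \<in> carrier L" using L by blast
  qed
qed

lemma UN_constant: "(\<And>x. x \<in> S \<Longrightarrow> f x = c) \<Longrightarrow> \<exists>x. x \<in> S \<Longrightarrow> (\<Union>x\<in>S. f x) = c"
  by auto

lemma mult_L: "\<theta> z \<otimes>\<^bsub>L\<^esub> \<theta> w = \<theta> (z * w)"
proof -
  have "(\<Union>(a, b)\<in>\<theta> z. \<Union>(c, d)\<in>\<theta> w. fraction R (a \<otimes>\<^bsub>R\<^esub> c) (b \<otimes>\<^bsub>R\<^esub> d)) = \<theta> (z * w)"
  proof (rule UN_constant[OF _ theta_nonempty], clarify, rule UN_constant[OF _ theta_nonempty], clarify)
    fix a b c d assume "(a, b) \<in> \<theta> z" "(c, d) \<in> \<theta> w"
    obtain u v where uv: "a = cls u" "b = cls v" "u \<in> range \<phi>" "v \<in> range \<phi>" "v \<noteq> 0" "z = u / v"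
      using \<open>(a, b) \<in> \<theta> z\<close> by (rule theta_elem)
    obtain u' v' where uv': "c = cls u'" "d = cls v'" "u' \<in> range \<phi>" "v' \<in> range \<phi>" "v' \<noteq> 0" "w = u' / v'"
      using \<open>(c, d) \<in> \<theta> w\<close> by (rule theta_elem)
    show "fraction R (a \<otimes>\<^bsub>R\<^esub> c) (b \<otimes>\<^bsub>R\<^esub> d) = \<theta> (z * w)"
      using uv uv' by (simp add: mult_R fraction_eq range_mult)
  qed
  then show ?thesis by (simp add: fraction_field_def)
qed

lemma add_L: "\<theta> z \<oplus>\<^bsub>L\<^esub> \<theta> w = \<theta> (z + w)"
proof -
  have "(\<Union>(a, b)\<in>\<theta> z. \<Union>(c, d)\<in>\<theta> w. fraction R (a \<otimes>\<^bsub>R\<^esub> d \<oplus>\<^bsub>R\<^esub> c \<otimes>\<^bsub>R\<^esub> b) (b \<otimes>\<^bsub>R\<^esub> d)) = \<theta> (z + w)"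
  proof (rule UN_constant[OF _ theta_nonempty], clarify, rule UN_constant[OF _ theta_nonempty], clarify)
    fix a b c d assume "(a, b) \<in> \<theta> z" "(c, d) \<in> \<theta> w"
    obtain u v where uv: "a = cls u" "b = cls v" "u \<in> range \<phi>" "v \<in> range \<phi>" "v \<noteq> 0" "z = u / v"
      using \<open>(a, b) \<in> \<theta> z\<close> by (rule theta_elem)
    obtain u' v' where uv': "c = cls u'" "d = cls v'" "u' \<in> range \<phi>" "v' \<in> range \<phi>" "v' \<noteq> 0" "w = u' / v'"
      using \<open>(c, d) \<in> \<theta> w\<close> by (rule theta_elem)
    have "fraction R (a \<otimes>\<^bsub>R\<^esub> d \<oplus>\<^bsub>R\<^esub> c \<otimes>\<^bsub>R\<^esub> b) (b \<otimes>\<^bsub>R\<^esub> d) = \<theta> ((u * v' + u' * v) / (v * v'))"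
      using uv(1-5) uv'(1-5) by (simp add: mult_R add_R fraction_eq range_mult range_add)
    also have "(u * v' + u' * v) / (v * v') = z + w" using uv uv' by (simp add: field_simps)
    finally show "fraction R (a \<otimes>\<^bsub>R\<^esub> d \<oplus>\<^bsub>R\<^esub> c \<otimes>\<^bsub>R\<^esub> b) (b \<otimes>\<^bsub>R\<^esub> d) = \<theta> (z + w)" .
  qed
  then show ?thesis by (simp add: fraction_field_def)
qed

lemma one_L: "\<one>\<^bsub>L\<^esub> = \<theta> 1"
  using fraction_eq[of 1 1] range_01 by (simp add: fraction_field_def one_R)

lemma zero_L: "\<zero>\<^bsub>L\<^esub> = \<theta> 0"
  using fraction_eq[of 0 1] range_01 by (simp add: fraction_field_def one_R zero_R)

sublocale L: ring_model L UNIV \<theta> "\<lambda>c :: 'f. c"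
  by unfold_locales (auto simp: bij_betw_def inj_on_def theta_inj carrier_L mult_L add_L one_L zero_L)

lemma pow_L: "\<theta> z [^]\<^bsub>L\<^esub> (n::nat) = \<theta> (z ^ n)"
proof -
  interpret L: cring L by (rule L.cring_N)
  show ?thesis by (induction n) (simp_all add: one_L mult_L mult.commute)
qed

primrec horner_list :: "'f list \<Rightarrow> 'f \<Rightarrow> 'f" where
  "horner_list [] z = 0"
| "horner_list (a # as) z = a * z ^ length as + horner_list as z"

lemma eval_L: "ring.eval L (map \<theta> xs) (\<theta> z) = \<theta> (horner_list xs z)"
proof -
  interpret L: cring L by (rule L.cring_N)
  show ?thesis by (induction xs) (simp_all add: zero_L mult_L add_L pow_L)
qed

lemma horner_list_sum: "horner_list xs z = (\<Sum>i<length xs. rev xs ! i * z ^ i)"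
proof (induction xs)
  case (Cons a xs)
  have "(\<Sum>i<length xs. rev (a # xs) ! i * z ^ i) = (\<Sum>i<length xs. rev xs ! i * z ^ i)"
    by (rule sum.cong) (auto simp: nth_append)
  then show ?case by (simp add: Cons nth_append)
qed simp

lemma integral_closure_eq:
  assumes A: "\<And>a. a \<in> A \<Longrightarrow> - a \<in> A" "1 \<in> A"
  shows "integral_closure L (\<theta> ` A) = \<theta> ` {z. integral_over A z}"
proof (intro equalityI subsetI)
  fix x assume "x \<in> integral_closure L (\<theta> ` A)"
  then obtain f where x: "x \<in> carrier L" and f: "f \<in> carrier (univ_poly L (\<theta> ` A))" "f \<noteq> []" "hd f = \<one>\<^bsub>L\<^esub>"
    "ring.eval L f x = \<zero>\<^bsub>L\<^esub>" unfolding integral_closure_def by blast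
  obtain z where z: "x = \<theta> z" using x carrier_L by auto
  have "set f \<subseteq> \<theta> ` A" using f by (auto simp: univ_poly_def polynomial_def)
  then have "\<exists>xs. f = map \<theta> xs \<and> set xs \<subseteq> A"
  proof (induction f)
    case (Cons y ys)
    then obtain xs where "ys = map \<theta> xs" "set xs \<subseteq> A" by auto
    moreover obtain a where "a \<in> A" "y = \<theta> a" using Cons.prems by auto
    ultimately show ?case by (intro exI[of _ "a # xs"]) simp
  qed simp
  then obtain xs where xs: "f = map \<theta> xs" "set xs \<subseteq> A" by auto
  with f(2) obtain a ys where ys: "xs = a # ys" by (cases xs) auto
  then have a: "a = 1" using f(3) xs one_L theta_inj by simp
  have "horner_list xs z = 0" using f(4) eval_L[of xs z] xs z zero_L theta_inj by simp
  then have "z ^ length ys = (\<Sum>i<length ys. - (rev ys ! i) * z ^ i)"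
    using ys a horner_list_sum[of ys z] by (simp add: eq_neg_iff_add_eq_0 sum_negf)
  moreover have "- (rev ys ! i) \<in> A" if "i < length ys" for i
  proof -
    have "rev ys ! i \<in> set (rev ys)" by (rule nth_mem) (simp add: that)
    then show ?thesis using A(1) xs(2) ys by auto
  qed
  ultimately have "integral_over A z" unfolding integral_over_def
    by (intro exI[of _ "length ys"] exI[of _ "\<lambda>i. - (rev ys ! i)"]) simp
  then show "x \<in> \<theta> ` {z. integral_over A z}" using z by simp
next
  fix x assume "x \<in> \<theta> ` {z. integral_over A z}"
  then obtain z where z: "x = \<theta> z" "integral_over A z" by blast
  then obtain n c where c: "\<And>i. i < n \<Longrightarrow> c i \<in> A" and zn: "z ^ n = (\<Sum>i<n. c i * z ^ i)"
    unfolding integral_over_def by blast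
  define ys where "ys = rev (map (\<lambda>i. - c i) [0..<n])"
  have "horner_list ys z = - (z ^ n)"
    unfolding horner_list_sum zn by (simp add: ys_def sum_negf[symmetric])
  then have "horner_list (1 # ys) z = 0" by (simp add: ys_def)
  then have "ring.eval L (map \<theta> (1 # ys)) x = \<zero>\<^bsub>L\<^esub>" using eval_L[of "1 # ys" z] z(1) zero_L by simp
  moreover have "map \<theta> (1 # ys) \<in> carrier (univ_poly L (\<theta> ` A))"
  proof -
    have "set ys \<subseteq> A" using c A by (auto simp: ys_def)
    then show ?thesis using A theta_inj zero_L by (auto simp: univ_poly_def polynomial_def)
  qed
  moreover have "hd (map \<theta> (1 # ys)) = \<one>\<^bsub>L\<^esub>" using one_L by simp
  ultimately show "x \<in> integral_closure L (\<theta> ` A)"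
    unfolding integral_closure_def using carrier_L z(1) by blast
qed

lemma fraction_embed: "fraction R (cls u) \<one>\<^bsub>R\<^esub> = \<theta> u" if "u \<in> range \<phi>"
  using fraction_eq[OF that range_01(2)] by (simp add: one_R)

lemma image_embed: "(\<lambda>a. fraction R a \<one>\<^bsub>R\<^esub>) ` carrier R = \<theta> ` range \<phi>"
  unfolding carrier_R image_image using fraction_embed by (intro image_cong refl) auto

end

text \<open>When the restrictions to \<open>Z\<close> are represented as rational functions on the torus, and the integral
  elements over them are the Laurent polynomials with exponents in \<open>M\<close>, the normalization ring can be
  replaced by the semigroup algebra of \<open>M\<close>.\<close>

theorem smooth_normalization_iff:
  fixes Z :: "('k::field ^ 'm::finite) set" and \<phi> :: "('k, 'm) mpoly \<Rightarrow> 'k rat_fun"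
  assumes model: "function_field_model \<phi>"
    and ker: "vanishing_ideal Z = {f. \<phi> f = 0}"
    and const: "\<And>c. \<phi> (Poly_Mapping.single 0 c) = const_fun c"
    and M: "add_submonoid M"
    and int: "{z. integral_over (range \<phi>) z} = emb ` supported M"
  shows "smooth_normalization Z \<longleftrightarrow>
     (\<forall>m. maximal_in (supported M) m \<longrightarrow> cotangent_basis_in (range (Poly_Mapping.single 0 :: 'k \<Rightarrow> 'k laurent)) m)"
proof -
  interpret function_field_model \<phi> by (rule model)
  have Zker: "vanishing_ideal Z = ker" by (simp add: ker ker_def)
  have R: "coordinate_ring Z = R" by (simp add: coordinate_ring_def R_def Zker)
  have neg: "- a \<in> range \<phi>" if "a \<in> range \<phi>" for a
  proof -
    from that obtain f where "a = \<phi> f" by auto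
    then have "\<phi> (0 - f) = - a" by (simp only: phi_diff phi_zero) simp
    then show ?thesis by (metis rangeI)
  qed
  define N where "N = L\<lparr>carrier := \<theta> ` emb ` supported M\<rparr>"
  have IC: "integral_closure L (\<theta> ` range \<phi>) = \<theta> ` emb ` supported M"
    using integral_closure_eq[of "range \<phi>"] neg range_01(2) int by metis
  have N: "normalization_ring Z = N"
    unfolding normalization_ring_def Let_def R image_embed IC N_def ..
  let ?c0 = "Poly_Mapping.single 0 :: 'k \<Rightarrow> 'k laurent"
  have scal: "normalization_scalars Z = (\<lambda>F. \<theta> (emb F)) ` range ?c0"
  proof -
    have "normalization_scalars Z = range (\<lambda>c. fraction R (cls (\<phi> (Poly_Mapping.single 0 c))) \<one>\<^bsub>R\<^esub>)"
      unfolding normalization_scalars_def Let_def R Zker coset by simp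
    also have "\<dots> = range (\<lambda>c. \<theta> (emb (?c0 c)))"
    proof -
      have "fraction R (cls (\<phi> (Poly_Mapping.single 0 c))) \<one>\<^bsub>R\<^esub> = \<theta> (emb (?c0 c))" for c
      proof -
        have eq: "\<phi> (Poly_Mapping.single 0 c) = emb (?c0 c)" by (simp add: const emb_single)
        show ?thesis using fraction_embed[OF rangeI, of "Poly_Mapping.single 0 c"] unfolding eq .
      qed
      then show ?thesis by simp
    qed
    finally show ?thesis by (simp add: image_image)
  qed
  interpret ring_model N "supported M" "\<lambda>F. \<theta> (emb F)" ?c0
  proof
    show "bij_betw (\<lambda>F. \<theta> (emb F)) (supported M) (carrier N)"
      by (auto simp: N_def bij_betw_def inj_on_def theta_inj emb_eq_iff image_image)
    show "?c0 c \<in> supported M" for c using M by (simp add: supported_def add_submonoid_def)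
  qed (use supported_simps[OF M] in \<open>auto simp: N_def mult_L add_L one_L zero_L emb_simps mult_single single_add\<close>)
  show ?thesis
    unfolding smooth_normalization_def N scal by (rule all_cotangent_dim_2_iff)
qed

section \<open>Maximal ideals of semigroup algebras\<close>

text \<open>Substitution of \<open>U\<close> for the inner and of \<open>V\<close> for the outer variable.\<close>

definition subst2 :: "('k::field \<Rightarrow> 't::comm_ring_1) \<Rightarrow> 't \<Rightarrow> 't \<Rightarrow> 'k poly poly \<Rightarrow> 't" where
  "subst2 C U V p = poly (map_poly (\<lambda>r. poly (map_poly C r) U) p) V"

locale coeff_subst =
  fixes C :: "'k::field \<Rightarrow> 't::comm_ring_1" and U V :: 't
  assumes C_hom: "\<And>a b. C (a + b) = C a + C b" "\<And>a b. C (a * b) = C a * C b" "C 1 = 1"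
begin

lemma C_zero: "C 0 = 0" using C_hom(1)[of 0 0] by simp

lemma C_uminus: "C (- a) = - C a"
  using C_hom(1)[of a "- a"] C_zero by (simp add: eq_neg_iff_add_eq_0 add.commute)

abbreviation "subst1 r \<equiv> poly (map_poly C r) U"
abbreviation "\<eta> \<equiv> subst2 C U V"

lemma subst1_pCons: "subst1 (pCons a r) = C a + U * subst1 r"
  by (simp add: Polynomial.map_poly_pCons C_zero)

lemma subst1_add: "subst1 (r + s) = subst1 r + subst1 s"
proof (induction r arbitrary: s)
  case (pCons a r) then show ?case by (cases s) (simp add: subst1_pCons C_hom algebra_simps)
qed (simp add: C_zero)

lemma subst1_smult: "subst1 (Polynomial.smult c r) = C c * subst1 r"
  by (induction r) (simp_all add: subst1_pCons C_hom algebra_simps)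

lemma subst1_mult: "subst1 (r * s) = subst1 r * subst1 s"
  by (induction r) (simp_all add: subst1_pCons subst1_add subst1_smult C_zero algebra_simps)

lemma eta_pCons: "\<eta> (pCons a r) = subst1 a + V * \<eta> r"
  by (simp add: subst2_def Polynomial.map_poly_pCons C_zero)

lemma eta_zero: "\<eta> 0 = 0" by (simp add: subst2_def)

lemma eta_add: "\<eta> (r + s) = \<eta> r + \<eta> s"
proof (induction r arbitrary: s)
  case (pCons a r) then show ?case by (cases s) (simp add: eta_pCons subst1_add algebra_simps)
qed (simp add: eta_zero)

lemma eta_smult: "\<eta> (Polynomial.smult c r) = subst1 c * \<eta> r"
  by (induction r) (simp_all add: eta_pCons subst1_mult eta_zero algebra_simps)

lemma eta_mult: "\<eta> (r * s) = \<eta> r * \<eta> s"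
  by (induction r) (simp_all add: eta_pCons eta_add eta_smult eta_zero C_zero algebra_simps)

lemma eta_one: "\<eta> 1 = 1"
  by (simp add: one_pCons eta_pCons subst1_pCons eta_zero C_hom)

lemma eta_diff: "\<eta> (r - s) = \<eta> r - \<eta> s"
  using eta_add[of "r - s" s] by (simp add: eq_diff_eq)

lemma eta_power: "\<eta> (r ^ n) = \<eta> r ^ n"
  by (induction n) (simp_all add: eta_one eta_mult)

lemma eta_U: "\<eta> [:[:0, 1:]:] = U" and eta_V: "\<eta> [:0, 1:] = V" and eta_C: "\<eta> [:[:c:]:] = C c"
  by (simp_all add: eta_pCons subst1_pCons eta_zero C_zero C_hom)

lemma eta_monom: "\<eta> (Polynomial.monom (Polynomial.monom c i) j) = C c * U ^ i * V ^ j"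
proof (induction j)
  case 0
  have "subst1 (Polynomial.monom c i) = C c * U ^ i"
    by (induction i) (simp_all add: monom_0 monom_Suc subst1_pCons C_zero algebra_simps)
  then show ?case by (simp add: monom_0 eta_pCons eta_zero)
next
  case (Suc j)
  then show ?case by (simp add: monom_Suc eta_pCons C_zero algebra_simps)
qed

end

text \<open>A Nullstellensatz for a ring \<open>A\<close> whose elements become polynomials in \<open>U\<close> and \<open>V\<close> after multiplication
by a power of \<open>U\<close>, and also by one of \<open>V\<close> if \<open>V\<close> is a unit.  This covers the polynomial rings and the
Laurent polynomial rings in both variables; the aim is that a maximal ideal contains \<open>U - c\<close> for some
constant \<open>c\<close>.\<close>

locale maximal_point = coeff_subst C U V
  for C :: "'k::alg_closed_field \<Rightarrow> 't::comm_ring_1" and U V :: 't +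
  fixes A m :: "'t set" and u2 :: bool
  assumes maxm: "maximal_in A m"
    and A: "\<And>x y. x \<in> A \<Longrightarrow> y \<in> A \<Longrightarrow> x + y \<in> A"
      "\<And>x y. x \<in> A \<Longrightarrow> y \<in> A \<Longrightarrow> x * y \<in> A" "\<And>x. x \<in> A \<Longrightarrow> - x \<in> A"
    and UV: "U \<in> A" "V \<in> A" and C_in: "\<And>c. C c \<in> A"
    and unit_V: "u2 \<Longrightarrow> \<exists>V'\<in>A. V * V' = 1"
    and clear: "\<And>F. F \<in> A \<Longrightarrow> \<exists>a b p. (b = 0 \<or> u2) \<and> F * U ^ a * V ^ b = subst2 C U V p"
begin

lemma m_simps: "m \<subseteq> A" "0 \<in> m" "1 \<notin> m" "\<And>x y. x \<in> m \<Longrightarrow> y \<in> m \<Longrightarrow> x + y \<in> m"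
    "\<And>a x. a \<in> A \<Longrightarrow> x \<in> m \<Longrightarrow> a * x \<in> m" "\<And>x. x \<in> A \<Longrightarrow> x \<notin> m \<Longrightarrow> \<exists>y\<in>A. x * y - 1 \<in> m"
  using maxm unfolding maximal_in_def by blast+

lemma one_A: "1 \<in> A" using C_in[of 1] C_hom(3) by simp
lemma zero_A: "0 \<in> A" using m_simps(1,2) by blast

lemma m_diff: "x \<in> m \<Longrightarrow> y \<in> m \<Longrightarrow> x - y \<in> m"
  using m_simps(4)[of x "- y"] m_simps(5)[of "- 1" y] A(3)[OF one_A] by simp

lemma m_prime: "x \<in> A \<Longrightarrow> y \<in> A \<Longrightarrow> x * y \<in> m \<Longrightarrow> x \<in> m \<or> y \<in> m"
proof (rule ccontr)
  assume xy: "x \<in> A" "y \<in> A" "x * y \<in> m" "\<not> (x \<in> m \<or> y \<in> m)"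
  obtain z where z: "z \<in> A" "x * z - 1 \<in> m" using m_simps(6)[OF xy(1)] xy(4) by auto
  have "z * (x * y) - y * (x * z - 1) \<in> m" by (intro m_diff m_simps(5) xy z)
  then show False using xy(4) by (simp add: algebra_simps)
qed

lemma unit_notin: "x * y = 1 \<Longrightarrow> y \<in> A \<Longrightarrow> x \<notin> m"
  using m_simps(3) m_simps(5)[of y x] by (auto simp: mult.commute)

lemma subst1_in: "subst1 r \<in> A"
  by (induction r) (auto simp: subst1_pCons zero_A intro!: A UV C_in)

lemma eta_in: "\<eta> r \<in> A"
  by (induction r) (auto simp: eta_pCons eta_zero zero_A intro!: A UV subst1_in)

definition "P = {p. \<eta> p \<in> m}"

lemma P_simps: "0 \<in> P" "1 \<notin> P" "p \<in> P \<Longrightarrow> q \<in> P \<Longrightarrow> p + q \<in> P" "p \<in> P \<Longrightarrow> q \<in> P \<Longrightarrow> p - q \<in> P"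
  "q \<in> P \<Longrightarrow> p * q \<in> P" "p * q \<in> P \<Longrightarrow> p \<in> P \<or> q \<in> P"
  using m_simps m_diff m_prime eta_in
  by (auto simp: P_def eta_zero eta_one eta_add eta_diff eta_mult)

text \<open>An inverse modulo \<open>m\<close>, cleared of its denominator.\<close>

lemma nonmember_inverse:
  assumes "d \<notin> P"
  shows "\<exists>h a b. (b = 0 \<or> u2) \<and> d * h - [:[:0, 1:]:] ^ a * [:0, 1:] ^ b \<in> P"
proof -
  obtain F where F: "F \<in> A" "\<eta> d * F - 1 \<in> m" using m_simps(6)[OF eta_in] assms unfolding P_def by auto
  obtain a b p where p: "b = 0 \<or> u2" "F * U ^ a * V ^ b = \<eta> p" using clear[OF F(1)] by blast
  have "U ^ a * V ^ b \<in> A"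
    using eta_in[of "[:[:0, 1:]:] ^ a * [:0, 1:] ^ b"] by (simp only: eta_mult eta_power eta_U eta_V)
  from m_simps(5)[OF this F(2)] have "\<eta> d * \<eta> p - U ^ a * V ^ b \<in> m"
    by (simp add: p(2)[symmetric] algebra_simps)
  then have "d * p - [:[:0, 1:]:] ^ a * [:0, 1:] ^ b \<in> P"
    unfolding P_def by (simp only: mem_Collect_eq eta_diff eta_mult eta_power eta_U eta_V)
  then show ?thesis using p(1) by blast
qed

lemma eval2_X: "eval2 [:[:0, 1:]:] c d = c" and eval2_Y: "eval2 [:0, 1:] c d = d"
  and eval2_lin: "eval2 [:[:- e, 1:]:] c d = c - e"
  by (simp_all add: eval2_pCons)

text \<open>If no polynomial in the inner variable lay in the ideal, take an element of minimal degree in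
  the outer variable.  Every other element is a pseudo-multiple of it, so an inverse of \<open>U - c\<close>
  modulo the ideal is refuted by evaluating at a zero of that element over a generic \<open>c\<close>.\<close>

lemma contains_inner_poly: "\<exists>r. r \<noteq> 0 \<and> [:r:] \<in> P"
proof (rule ccontr)
  assume "\<not> ?thesis"
  then have noP: "\<And>r. r \<noteq> 0 \<Longrightarrow> [:r:] \<notin> P" by blast
  show False
  proof (cases "P = {0}")
    case True
    obtain h a b where "[:[:- 1, 1:]:] * h - [:[:0, 1:]:] ^ a * [:0, 1:] ^ b \<in> P"
      using nonmember_inverse[OF noP[of "[:- 1, 1:]"]] by auto
    then have "[:[:- 1, 1:]:] * h - [:[:0, 1:]:] ^ a * [:0, 1:] ^ b = 0" using True by blast
    then have "eval2 ([:[:- 1, 1:]:] * h - [:[:0, 1:]:] ^ a * [:0, 1:] ^ b) 1 1 = 0" by simp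
    then show False by (simp only: eval2_simps eval2_X eval2_Y eval2_lin) simp
  next
    case False
    then obtain g0 where g0: "g0 \<in> P \<and> g0 \<noteq> 0" using P_simps(1) by blast
    define g where "g = arg_min Polynomial.degree (\<lambda>d. d \<in> P \<and> d \<noteq> 0)"
    have g: "g \<in> P" "g \<noteq> 0" and gmin: "\<And>e. e \<in> P \<Longrightarrow> e \<noteq> 0 \<Longrightarrow> Polynomial.degree g \<le> Polynomial.degree e"
      using arg_min_nat_lemma[of "\<lambda>d. d \<in> P \<and> d \<noteq> 0", OF g0, of Polynomial.degree] unfolding g_def by blast+
    let ?l = "Polynomial.lead_coeff g"
    have deg: "Polynomial.degree g \<noteq> 0"
    proof
      assume "Polynomial.degree g = 0"
      then obtain r where "g = [:r:]" by (rule degree_eq_zeroE)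
      then show False using noP g by auto
    qed
    have g00: "Polynomial.coeff g 0 \<noteq> 0" if u2
    proof
      assume "Polynomial.coeff g 0 = 0"
      then obtain g' where g': "g = pCons 0 g'" by (cases g) auto
      then have "[:0, 1:] * g' \<in> P" using g by simp
      moreover have "[:0, 1:] \<notin> P" using unit_V[OF that] unit_notin unfolding P_def by (auto simp: eta_V)
      ultimately have "g' \<in> P" using P_simps(6) by blast
      moreover have "g' \<noteq> 0" using g' g by auto
      ultimately show False using gmin[of g'] g' by simp
    qed
    let ?q = "?l * (if u2 then Polynomial.coeff g 0 else 1) * [:0, 1:]"
    have "?q \<noteq> 0" using g g00 by auto
    then obtain c where c: "poly ?q c \<noteq> 0" using exists_nonroot by blast
    then have lc: "poly ?l c \<noteq> 0" and c0: "c \<noteq> 0" and gc: "u2 \<Longrightarrow> poly (Polynomial.coeff g 0) c \<noteq> 0" by auto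
    define gc where "gc = map_poly (\<lambda>r. poly r c) g"
    have "Polynomial.coeff gc (Polynomial.degree g) \<noteq> 0" using lc by (simp add: gc_def coeff_map_poly)
    then have "Polynomial.degree gc > 0" using deg le_degree[of gc "Polynomial.degree g"] by simp
    then obtain \<rho> where "poly gc \<rho> = 0" using alg_closed_imp_poly_has_root by blast
    then have root: "eval2 g c \<rho> = 0" by (simp add: eval2_map_poly gc_def)
    have rho: "\<rho> \<noteq> 0" if u2
    proof
      assume "\<rho> = 0"
      then have "poly (Polynomial.coeff g 0) c = 0" using root by (cases g) (simp add: eval2_pCons)
      then show False using gc that by simp
    qed
    obtain h a b where h: "b = 0 \<or> u2" "[:[:- c, 1:]:] * h - [:[:0, 1:]:] ^ a * [:0, 1:] ^ b \<in> P"
      using nonmember_inverse[OF noP[of "[:- c, 1:]"]] by auto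
    let ?f = "[:[:- c, 1:]:] * h - [:[:0, 1:]:] ^ a * [:0, 1:] ^ b"
    obtain q r where qr: "pseudo_divmod ?f g = (q, r)" by (cases "pseudo_divmod ?f g")
    let ?k = "Suc (Polynomial.degree ?f) - Polynomial.degree g"
    from pseudo_divmod[OF g(2) qr]
    have eq: "Polynomial.smult (?l ^ ?k) ?f = g * q + r" and r: "r = 0 \<or> Polynomial.degree r < Polynomial.degree g"
      by auto
    have "r = [:?l ^ ?k:] * ?f - q * g" using eq by (simp add: mult.commute)
    moreover have "[:?l ^ ?k:] * ?f - q * g \<in> P" by (rule P_simps(4)[OF P_simps(5)[OF h(2)] P_simps(5)[OF g(1)]])
    ultimately have "r \<in> P" by (simp only:)
    then have "r = 0" using r gmin by (meson leD)
    then have "[:?l ^ ?k:] * ?f = g * q" using eq by simp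
    then have "eval2 ([:?l ^ ?k:] * ?f) c \<rho> = eval2 (g * q) c \<rho>" by (rule arg_cong)
    then have "eval2 [:?l ^ ?k:] c \<rho> * eval2 ?f c \<rho> = 0"
      unfolding eval2_simps(2)[of "[:?l ^ ?k:]" ?f] eval2_simps(2)[of g q] root by simp
    moreover have "eval2 [:?l ^ ?k:] c \<rho> \<noteq> 0" using lc by (simp add: eval2_pCons)
    ultimately have "eval2 ?f c \<rho> = 0" by (simp only: mult_eq_0_iff simp_thms)
    then have "c ^ a * \<rho> ^ b = 0" by (simp only: eval2_simps eval2_X eval2_Y eval2_lin) simp
    then show False using c0 rho h(1) by auto
  qed
qed

text \<open>A polynomial of least degree from \<open>contains_inner_poly\<close> has a linear factor, and \<open>m\<close> is prime.\<close>

lemma contains_U_minus_const: "\<exists>c. U - C c \<in> m"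
proof -
  obtain r0 where r0: "r0 \<noteq> 0 \<and> [:r0:] \<in> P" using contains_inner_poly by blast
  define r where "r = arg_min Polynomial.degree (\<lambda>r. r \<noteq> 0 \<and> [:r:] \<in> P)"
  have r: "r \<noteq> 0" "[:r:] \<in> P" and rmin: "\<And>e. e \<noteq> 0 \<Longrightarrow> [:e:] \<in> P \<Longrightarrow> Polynomial.degree r \<le> Polynomial.degree e"
    using arg_min_nat_lemma[of "\<lambda>r. r \<noteq> 0 \<and> [:r:] \<in> P", OF r0, of Polynomial.degree] unfolding r_def by blast+
  have "Polynomial.degree r \<noteq> 0"
  proof
    assume "Polynomial.degree r = 0"
    then obtain c where c: "r = [:c:]" by (rule degree_eq_zeroE)
    then have "C c \<in> m" using r(2) by (simp add: P_def eta_C)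
    moreover have "C c * C (inverse c) = 1" using c r(1) by (simp add: C_hom(3) flip: C_hom(2))
    ultimately show False using unit_notin C_in by blast
  qed
  then obtain c where "poly r c = 0" using alg_closed_imp_poly_has_root by blast
  then obtain r' where r': "r = [:- c, 1:] * r'" by (auto simp: poly_eq_0_iff_dvd)
  then have "r' \<noteq> 0" using r by auto
  have "[:r:] = [:[:- c, 1:]:] * [:r':]" using r' by simp
  then have "[:[:- c, 1:]:] \<in> P \<or> [:r':] \<in> P" using r(2) P_simps(6) by metis
  moreover have "Polynomial.degree r = Suc (Polynomial.degree r')"
    using degree_mult_eq[of "[:- c, 1:]" r'] r' \<open>r' \<noteq> 0\<close> by simp
  ultimately have "[:[:- c, 1:]:] \<in> P" using rmin[OF \<open>r' \<noteq> 0\<close>] by auto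
  then have "\<eta> [:[:- c, 1:]:] \<in> m" by (simp add: P_def)
  then have "U - C c \<in> m" by (simp add: eta_pCons subst1_pCons eta_zero C_zero C_hom C_uminus algebra_simps)
  then show ?thesis by blast
qed

end

section \<open>Regular semigroups\<close>

text \<open>The flags say which of the two coordinates may be negative.\<close>

definition quadrant :: "bool \<Rightarrow> bool \<Rightarrow> (int \<times> int) set" where
  "quadrant u1 u2 = {m. (u1 \<or> 0 \<le> fst m) \<and> (u2 \<or> 0 \<le> snd m)}"

lemma quadrant_add_submonoid: "add_submonoid (quadrant u1 u2)"
  by (auto simp: add_submonoid_def quadrant_def)

abbreviation lconst :: "'k::field \<Rightarrow> 'k laurent" where "lconst \<equiv> Poly_Mapping.single 0"

abbreviation lmono :: "int \<times> int \<Rightarrow> 'k::field laurent" where "lmono z \<equiv> Poly_Mapping.single z 1"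

lemma lmono_origin [simp]: "lmono (0, 0) = (1 :: 'k::field laurent)"
  by (metis single_one zero_prod_def)

lemma lmono_power: "lmono z ^ n = lmono (zmult n z)"
  by (induction n) (simp_all add: mult_single)

lemma supported_single: "m \<in> S \<Longrightarrow> Poly_Mapping.single m c \<in> supported S"
  by (simp add: supported_def)

interpretation lconst: coeff_subst lconst U V for U V :: "'k::field laurent"
  by unfold_locales (simp_all add: single_add mult_single)

text \<open>Both orders of the variables are needed, since \<open>maximal_point\<close> locates only the first one.\<close>

lemma quadrant_clear:
  fixes F :: "'k::alg_closed_field laurent"
  assumes F: "F \<in> supported (quadrant u1 u2)"
  shows "\<exists>N p. F * lmono (1, 0) ^ (if u1 then N else 0) * lmono (0, 1) ^ (if u2 then N else 0) =
      subst2 lconst (lmono (1, 0)) (lmono (0, 1)) p" (is ?A)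
    and "\<exists>N p. F * lmono (0, 1) ^ (if u2 then N else 0) * lmono (1, 0) ^ (if u1 then N else 0) =
      subst2 lconst (lmono (0, 1)) (lmono (1, 0)) p" (is ?B)
proof -
  obtain N where N: "exps_ge N F" using exps_ge_exists by blast
  define a where "a = (if u1 then N else 0)"
  define b where "b = (if u2 then N else 0)"
  have nn: "0 \<le> fst z + int a \<and> 0 \<le> snd z + int b" if "z \<in> Poly_Mapping.keys F" for z
  proof -
    have "z \<in> quadrant u1 u2" "- int N \<le> fst z" "- int N \<le> snd z"
      using that F N by (auto simp: supported_def exps_ge_def)
    then show ?thesis by (auto simp: a_def b_def quadrant_def)
  qed
  have shift: "F * lmono (1, 0) ^ a * lmono (0, 1) ^ b =
      (\<Sum>z\<in>Poly_Mapping.keys F. Poly_Mapping.single (fst z + int a, snd z + int b) (Poly_Mapping.lookup F z))"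
  proof -
    have "F * lmono (1, 0) ^ a * lmono (0, 1) ^ b = F * lmono (int a, int b)"
      by (simp add: lmono_power zmult_def mult.assoc mult_single)
    also have "\<dots> = (\<Sum>z\<in>Poly_Mapping.keys F. Poly_Mapping.single z (Poly_Mapping.lookup F z)) * lmono (int a, int b)"
      using pm_sum_singles[of F] by metis
    also have "\<dots> = (\<Sum>z\<in>Poly_Mapping.keys F. Poly_Mapping.single (fst z + int a, snd z + int b) (Poly_Mapping.lookup F z))"
      unfolding sum_distrib_right
      by (intro sum.cong refl) (simp add: mult_single plus_prod_def)
    finally show ?thesis .
  qed
  have mono1: "Poly_Mapping.single (int i, int j) c = lconst c * lmono (1, 0) ^ i * lmono (0, 1) ^ j" for i j and c :: 'k
    by (simp add: lmono_power zmult_def mult_single)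
  have mono2: "Poly_Mapping.single (int i, int j) c = lconst c * lmono (0, 1) ^ j * lmono (1, 0) ^ i" for i j and c :: 'k
    by (simp add: lmono_power zmult_def mult_single)
  have sums: "\<exists>p. (\<Sum>z\<in>K. subst2 lconst U V (f z)) = subst2 lconst U V p" if "finite K"
    for U V :: "'k laurent" and f :: "int \<times> int \<Rightarrow> 'k poly poly" and K
    using that
  proof induction
    case empty show ?case by (intro exI[of _ 0]) (simp add: lconst.eta_zero)
  next
    case (insert x K)
    then obtain p where p: "(\<Sum>z\<in>K. subst2 lconst U V (f z)) = subst2 lconst U V p" by blast
    have "(\<Sum>z\<in>insert x K. subst2 lconst U V (f z)) = subst2 lconst U V (f x + p)"
      using insert.hyps p by (simp add: lconst.eta_add)
    then show ?case by blast
  qed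
  have t1: "Poly_Mapping.single (fst z + int a, snd z + int b) (Poly_Mapping.lookup F z) =
      subst2 lconst (lmono (1, 0)) (lmono (0, 1))
        (Polynomial.monom (Polynomial.monom (Poly_Mapping.lookup F z) (nat (fst z + int a))) (nat (snd z + int b)))"
    if "z \<in> Poly_Mapping.keys F" for z
    unfolding lconst.eta_monom mono1[symmetric] using nn[OF that] by simp
  have t2: "Poly_Mapping.single (fst z + int a, snd z + int b) (Poly_Mapping.lookup F z) =
      subst2 lconst (lmono (0, 1)) (lmono (1, 0))
        (Polynomial.monom (Polynomial.monom (Poly_Mapping.lookup F z) (nat (snd z + int b))) (nat (fst z + int a)))"
    if "z \<in> Poly_Mapping.keys F" for z
    unfolding lconst.eta_monom mono2[symmetric] using nn[OF that] by simp
  have "\<exists>p. F * lmono (1, 0) ^ a * lmono (0, 1) ^ b = subst2 lconst (lmono (1, 0)) (lmono (0, 1)) p"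
    unfolding shift using sums[OF finite_keys] t1 by (simp cong: sum.cong)
  then show ?A unfolding a_def b_def by blast
  have "\<exists>p. F * lmono (0, 1) ^ b * lmono (1, 0) ^ a = subst2 lconst (lmono (0, 1)) (lmono (1, 0)) p"
  proof -
    have "F * lmono (0, 1) ^ b * lmono (1, 0) ^ a = F * lmono (1, 0) ^ a * lmono (0, 1) ^ b"
      by (simp add: mult_ac)
    then show ?thesis unfolding shift using sums[OF finite_keys] t2 by (simp cong: sum.cong)
  qed
  then show ?B unfolding a_def b_def by blast
qed

lemma maximal_quadrant_point:
  fixes m :: "'k::alg_closed_field laurent set"
  assumes m: "maximal_in (supported (quadrant u1 u2)) m"
  shows "\<exists>c. lmono (1, 0) - lconst c \<in> m" "\<exists>d. lmono (0, 1) - lconst d \<in> m"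
proof -
  let ?A = "supported (quadrant u1 u2) :: 'k laurent set"
  note S = supported_simps[OF quadrant_add_submonoid[of u1 u2]]
  have in1: "lmono (1, 0) \<in> ?A" "lmono (0, 1) \<in> ?A" "lconst c \<in> ?A" for c
    by (auto intro!: supported_single simp: quadrant_def)
  have unit1: "\<exists>V'\<in>?A. lmono (1, 0) * V' = 1" if u1
    using that by (intro bexI[of _ "lmono (-1, 0)"] supported_single) (auto simp: mult_single quadrant_def)
  have unit2: "\<exists>V'\<in>?A. lmono (0, 1) * V' = 1" if u2
    using that by (intro bexI[of _ "lmono (0, -1)"] supported_single) (auto simp: mult_single quadrant_def)
  have "maximal_point lconst (lmono (1, 0)) (lmono (0, 1)) ?A m u2"
  proof
    fix F assume "F \<in> ?A"
    from quadrant_clear(1)[OF this]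
    show "\<exists>a b p. (b = 0 \<or> u2) \<and> F * lmono (1, 0) ^ a * lmono (0, 1) ^ b = subst2 lconst (lmono (1, 0)) (lmono (0, 1)) p"
      by (cases u2) fastforce+
  qed (use m S(3-5) in1 unit2 in \<open>auto simp: single_add mult_single\<close>)
  then show "\<exists>c. lmono (1, 0) - lconst c \<in> m" by (rule maximal_point.contains_U_minus_const)
  have "maximal_point lconst (lmono (0, 1)) (lmono (1, 0)) ?A m u1"
  proof
    fix F assume "F \<in> ?A"
    from quadrant_clear(2)[OF this]
    show "\<exists>a b p. (b = 0 \<or> u1) \<and> F * lmono (0, 1) ^ a * lmono (1, 0) ^ b = subst2 lconst (lmono (0, 1)) (lmono (1, 0)) p"
      by (cases u1) fastforce+
  qed (use m S(3-5) in1 unit1 in \<open>auto simp: single_add mult_single\<close>)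
  then show "\<exists>d. lmono (0, 1) - lconst d \<in> m" by (rule maximal_point.contains_U_minus_const)
qed

lemma powi_add:
  fixes c :: "'k::field"
  assumes "c \<noteq> 0 \<or> 0 \<le> i \<and> 0 \<le> j"
  shows "c powi (i + j) = c powi i * c powi j"
proof (cases "c \<noteq> 0 \<or> i + j \<noteq> 0")
  case True then show ?thesis by (rule power_int_add)
next
  case False
  then have "i = 0" "j = 0" using assms by auto
  then show ?thesis by simp
qed

lemma powi_derivative:
  fixes c :: "'k::field"
  assumes "c \<noteq> 0 \<or> 0 \<le> i \<and> 0 \<le> j"
  shows "of_int (i + j) * c powi (i + j - 1) =
    of_int i * c powi (i - 1) * c powi j + of_int j * c powi (j - 1) * c powi i"
proof -
  have "of_int i * c powi (i + j - 1) = of_int i * c powi (i - 1) * c powi j" if "c \<noteq> 0 \<or> 0 \<le> i \<and> 0 \<le> j" for i j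
  proof (cases "i = 0")
    case False
    then have "c \<noteq> 0 \<or> 0 \<le> i - 1 \<and> 0 \<le> j" using that by auto
    from powi_add[OF this] show ?thesis by (simp add: algebra_simps)
  qed simp
  from this[OF assms] this[of j i] assms show ?thesis
    by (auto simp: distrib_right add.commute)
qed

text \<open>A maximal ideal belongs to a point \<open>(c, d)\<close>, and \<open>x - c\<close>, \<open>y - d\<close> generate it.  The partial derivatives at
the point vanish on its square and tell the two generators apart.  If a coordinate of the point is
zero, the exponents of that coordinate are nonnegative, so that evaluation and derivatives exist.\<close>

theorem quadrant_cotangent_basis:
  fixes m :: "'k::alg_closed_field laurent set"
  assumes m: "maximal_in (supported (quadrant u1 u2)) m"
  shows "cotangent_basis_in (range lconst) m"
proof -
  let ?Q = "quadrant u1 u2"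
  let ?A = "supported ?Q :: 'k laurent set"
  note S = supported_simps[OF quadrant_add_submonoid[of u1 u2]]
  obtain c where c: "lmono (1, 0) - lconst c \<in> m" using maximal_quadrant_point(1)[OF m] by blast
  obtain d where d: "lmono (0, 1) - lconst d \<in> m" using maximal_quadrant_point(2)[OF m] by blast
  define u where "u = lmono (1, 0) - lconst c"
  define v where "v = lmono (0, 1) - lconst d"
  have uv: "u \<in> m" "v \<in> m" using c d by (auto simp: u_def v_def)
  have mA: "m \<subseteq> ?A" "1 \<notin> m" and m_add: "\<And>x y. x \<in> m \<Longrightarrow> y \<in> m \<Longrightarrow> x + y \<in> m"
    and m_mult: "\<And>a x. a \<in> ?A \<Longrightarrow> x \<in> m \<Longrightarrow> a * x \<in> m"
    using m unfolding maximal_in_def by blast+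
  have lc: "lconst a \<in> ?A" for a by (auto intro!: supported_single simp: quadrant_def)
  have unit: "x \<notin> m" if "x * y = 1" "y \<in> ?A" for x y
    using that m_mult[of y x] mA(2) by (auto simp: mult.commute)
  have m_diff: "x - y \<in> m" if "x \<in> m" "y \<in> m" for x y
    using m_add[OF that(1) m_mult[of "- 1" y]] that S(5)[OF S(2)] by simp
  have c0: "c \<noteq> 0" if u1
  proof
    assume "c = 0"
    then have "lmono (1, 0) \<in> m" using c by simp
    moreover have "lmono (1, 0) * lmono (-1, 0) = (1 :: 'k laurent)" by (simp add: mult_single)
    moreover have "lmono (-1, 0) \<in> ?A" using that by (auto intro!: supported_single simp: quadrant_def)
    ultimately show False using unit by blast
  qed
  have d0: "d \<noteq> 0" if u2
  proof
    assume "d = 0"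
    then have "lmono (0, 1) \<in> m" using d by simp
    moreover have "lmono (0, 1) * lmono (0, -1) = (1 :: 'k laurent)" by (simp add: mult_single)
    moreover have "lmono (0, -1) \<in> ?A" using that by (auto intro!: supported_single simp: quadrant_def)
    ultimately show False using unit by blast
  qed
  define pt where "pt = tpow (c, d)"
  have cnn: "c \<noteq> 0 \<or> 0 \<le> fst z \<and> 0 \<le> fst w" "d \<noteq> 0 \<or> 0 \<le> snd z \<and> 0 \<le> snd w" if "z \<in> ?Q" "w \<in> ?Q" for z w
    using that c0 d0 by (auto simp: quadrant_def)
  have pt_add: "pt (z + w) = pt z * pt w" if "z \<in> ?Q" "w \<in> ?Q" for z w
    unfolding pt_def tpow_def using powi_add[OF cnn(1)[OF that]] powi_add[OF cnn(2)[OF that]] by simp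
  define ev :: "'k laurent \<Rightarrow> 'k" where "ev = lin_ext (\<lambda>a. a) pt"
  have ev_single: "ev (Poly_Mapping.single z a) = a * pt z" for z a unfolding ev_def by (rule lin_ext_single) simp
  have ev_add: "ev (F + G) = ev F + ev G" for F G unfolding ev_def by (rule lin_ext_add) simp
  have ev_0: "ev 0 = 0" by (simp add: ev_def)
  \<comment> \<open>the ideal generated by \<open>u\<close> and \<open>v\<close>\<close>
  define I where "I = {P * u + Q * v | P Q. P \<in> ?A \<and> Q \<in> ?A}"
  have I_add: "x + y \<in> I" if xy: "x \<in> I" "y \<in> I" for x y
  proof -
    obtain P Q where P: "x = P * u + Q * v" "P \<in> ?A" "Q \<in> ?A" using xy(1) unfolding I_def by blast
    obtain P' Q' where P': "y = P' * u + Q' * v" "P' \<in> ?A" "Q' \<in> ?A" using xy(2) unfolding I_def by blast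
    have "x + y = (P + P') * u + (Q + Q') * v" using P P' by (simp add: algebra_simps)
    moreover have "P + P' \<in> ?A" "Q + Q' \<in> ?A" using P P' by (auto intro: S)
    ultimately show ?thesis unfolding I_def by blast
  qed
  have I_mult: "a * x \<in> I" if ax: "a \<in> ?A" "x \<in> I" for a x
  proof -
    obtain P Q where P: "x = P * u + Q * v" "P \<in> ?A" "Q \<in> ?A" using ax(2) unfolding I_def by blast
    have "a * x = (a * P) * u + (a * Q) * v" using P by (simp add: algebra_simps)
    moreover have "a * P \<in> ?A" "a * Q \<in> ?A" using P ax by (auto intro: S)
    ultimately show ?thesis unfolding I_def by blast
  qed
  have Iu: "u \<in> I" unfolding I_def by (intro CollectI exI[of _ 1] exI[of _ 0]) (simp add: S)
  have Iv: "v \<in> I" unfolding I_def by (intro CollectI exI[of _ 0] exI[of _ 1]) (simp add: S)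
  have I0: "0 \<in> I" using I_mult[OF S(1) Iu] by simp
  have Im: "I \<subseteq> m" using uv unfolding I_def by (auto intro!: m_add m_mult)
  \<comment> \<open>exponents of monomials that are congruent to their value at the point\<close>
  define G where "G = {z \<in> ?Q. lmono z - lconst (pt z) \<in> I}"
  have G_add: "z + w \<in> G" if zw: "z \<in> G" "w \<in> G" for z w
  proof -
    have q: "z \<in> ?Q" "w \<in> ?Q" using zw by (auto simp: G_def)
    have e: "lmono (z + w) - lconst (pt (z + w)) =
      lmono z * (lmono w - lconst (pt w)) + lconst (pt w) * (lmono z - lconst (pt z))"
      unfolding pt_add[OF q] by (simp add: algebra_simps mult_single)
    have "lmono (z + w) - lconst (pt (z + w)) \<in> I"
      unfolding e using zw by (intro I_add I_mult lc supported_single) (auto simp: G_def)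
    moreover have "z + w \<in> ?Q" using q by (auto simp: quadrant_def)
    ultimately show ?thesis by (simp add: G_def)
  qed
  have G0: "0 \<in> G" using I0 by (auto simp: G_def quadrant_def pt_def)
  have G_mult: "zmult n z \<in> G" if "z \<in> G" for n z
    by (induction n) (use that G_add G0 in auto)
  have G1: "(1, 0) \<in> G" "(0, 1) \<in> G" using Iu Iv by (auto simp: G_def quadrant_def pt_def tpow_def u_def v_def)
  have inv_aux: "lmono (- z) - lconst (pt (- z)) = - (lmono (- z) * lconst (pt (- z))) * (lmono z - lconst (pt z))"
    if "pt z * pt (- z) = 1" for z
    using that by (simp add: algebra_simps mult_single)
  have G2: "(-1, 0) \<in> G" if u1
  proof -
    have "pt (1, 0) * pt (- (1, 0)) = 1" using c0[OF that] by (simp add: pt_def tpow_def power_int_minus)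
    from inv_aux[OF this] have "lmono (- 1, 0) - lconst (pt (- 1, 0)) = - (lmono (- 1, 0) * lconst (pt (- 1, 0))) * u"
      by (simp add: pt_def tpow_def u_def)
    moreover have q: "(-1, 0) \<in> ?Q" using that by (simp add: quadrant_def)
    have "- (lmono (- 1, 0) * lconst (pt (- 1, 0))) * u \<in> I"
      by (rule I_mult[OF S(5)[OF S(4)[OF supported_single[OF q] lc]] Iu])
    ultimately show ?thesis using q by (simp add: G_def)
  qed
  have G3: "(0, -1) \<in> G" if u2
  proof -
    have "pt (0, 1) * pt (- (0, 1)) = 1" using d0[OF that] by (simp add: pt_def tpow_def power_int_minus)
    from inv_aux[OF this] have "lmono (0, - 1) - lconst (pt (0, - 1)) = - (lmono (0, - 1) * lconst (pt (0, - 1))) * v"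
      by (simp add: pt_def tpow_def v_def)
    moreover have q: "(0, -1) \<in> ?Q" using that by (simp add: quadrant_def)
    have "- (lmono (0, - 1) * lconst (pt (0, - 1))) * v \<in> I"
      by (rule I_mult[OF S(5)[OF S(4)[OF supported_single[OF q] lc]] Iv])
    ultimately show ?thesis using q by (simp add: G_def)
  qed
  have QG: "z \<in> G" if z: "z \<in> ?Q" for z
  proof -
    have "(fst z, 0) \<in> G"
    proof (cases "0 \<le> fst z")
      case True then show ?thesis using G_mult[OF G1(1), of "nat (fst z)"] by (simp add: zmult_def)
    next
      case False
      then have u1 using z by (auto simp: quadrant_def)
      from G_mult[OF G2[OF this], of "nat (- fst z)"] False show ?thesis by (simp add: zmult_def)
    qed
    moreover have "(0, snd z) \<in> G"
    proof (cases "0 \<le> snd z")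
      case True then show ?thesis using G_mult[OF G1(2), of "nat (snd z)"] by (simp add: zmult_def)
    next
      case False
      then have u2 using z by (auto simp: quadrant_def)
      from G_mult[OF G3[OF this], of "nat (- snd z)"] False show ?thesis by (simp add: zmult_def)
    qed
    ultimately show ?thesis using G_add[of "(fst z, 0)" "(0, snd z)"] by simp
  qed
  have red: "F - lconst (ev F) \<in> I" if "F \<in> ?A" for F
  proof -
    have "Poly_Mapping.keys F \<subseteq> ?Q" using that by (simp add: supported_def)
    then show ?thesis
    proof (induction F rule: pm_induct_on)
      case zero then show ?case using I0 by (simp add: ev_0)
    next
      case (single z a)
      have "Poly_Mapping.single z a - lconst (ev (Poly_Mapping.single z a)) = lconst a * (lmono z - lconst (pt z))"
        by (simp add: ev_single algebra_simps mult_single)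
      then show ?case using QG[OF single] I_mult[OF lc] by (auto simp: G_def)
    next
      case (add F G)
      have "F + G - lconst (ev (F + G)) = (F - lconst (ev F)) + (G - lconst (ev G))"
        by (simp add: ev_add single_add algebra_simps)
      then show ?case using I_add[OF add(3,4)] by (simp only:)
    qed
  qed
  have ev_m: "ev F = 0" if "F \<in> m" for F
  proof (rule ccontr)
    assume ne: "ev F \<noteq> 0"
    have "F \<in> ?A" using that mA by blast
    then have "F - lconst (ev F) \<in> m" using red Im by blast
    from m_diff[OF that this] have "lconst (ev F) \<in> m" by simp
    moreover have "lconst (ev F) * lconst (inverse (ev F)) = 1" using ne by (simp add: mult_single)
    ultimately show False using unit lc by blast
  qed
  \<comment> \<open>the linear form with values \<open>\<delta>\<close> on monomials, a derivation at the point if \<open>\<delta>\<close> obeys the Leibniz rule\<close>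
  define D :: "(int \<times> int \<Rightarrow> 'k) \<Rightarrow> 'k laurent \<Rightarrow> 'k" where "D = (\<lambda>\<delta>. lin_ext (\<lambda>a. a) \<delta>)"
  have D_single: "D \<delta> (Poly_Mapping.single z a) = a * \<delta> z" for \<delta> z a unfolding D_def by (rule lin_ext_single) simp
  have D_add: "D \<delta> (F + G) = D \<delta> F + D \<delta> G" for \<delta> F G unfolding D_def by (rule lin_ext_add) simp
  have D_0: "D \<delta> 0 = 0" for \<delta> by (simp add: D_def)
  have D_mult: "D \<delta> (F * G) = ev F * D \<delta> G + D \<delta> F * ev G"
    if leib: "\<And>z w. z \<in> ?Q \<Longrightarrow> w \<in> ?Q \<Longrightarrow> \<delta> (z + w) = pt z * \<delta> w + \<delta> z * pt w"
      and FG: "F \<in> ?A" "G \<in> ?A" for \<delta> F G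
  proof -
    have "Poly_Mapping.keys F \<subseteq> ?Q" "Poly_Mapping.keys G \<subseteq> ?Q" using FG by (auto simp: supported_def)
    then show ?thesis
    proof (induction F rule: pm_induct_on)
      case (single z a)
      from \<open>Poly_Mapping.keys G \<subseteq> ?Q\<close> show ?case
      proof (induction G rule: pm_induct_on)
        case (single w b)
        then show ?case using leib[OF \<open>z \<in> ?Q\<close> \<open>w \<in> ?Q\<close>]
          by (simp add: mult_single D_single ev_single algebra_simps)
      qed (simp_all add: D_0 ev_0 D_add ev_add algebra_simps)
    qed (simp_all add: D_0 ev_0 D_add ev_add algebra_simps)
  qed
  have D_sq: "D \<delta> j = 0"
    if leib: "\<And>z w. z \<in> ?Q \<Longrightarrow> w \<in> ?Q \<Longrightarrow> \<delta> (z + w) = pt z * \<delta> w + \<delta> z * pt w"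
      and j: "j \<in> ideal_square m" for \<delta> j
    using j
  proof induction
    case (prod x y)
    then show ?case using D_mult[OF leib, of x y] mA ev_m by (simp add: subset_iff)
  qed (simp add: D_add)
  \<comment> \<open>the partial derivatives of a monomial at the point\<close>
  define \<delta>1 where "\<delta>1 = (\<lambda>z :: int \<times> int. of_int (fst z) * c powi (fst z - 1) * d powi snd z)"
  define \<delta>2 where "\<delta>2 = (\<lambda>z :: int \<times> int. of_int (snd z) * d powi (snd z - 1) * c powi fst z)"
  have leib1: "\<delta>1 (z + w) = pt z * \<delta>1 w + \<delta>1 z * pt w" if "z \<in> ?Q" "w \<in> ?Q" for z w
    unfolding \<delta>1_def pt_def tpow_def
    using powi_derivative[OF cnn(1)[OF that]] powi_add[OF cnn(2)[OF that]] by (simp add: algebra_simps)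
  have leib2: "\<delta>2 (z + w) = pt z * \<delta>2 w + \<delta>2 z * pt w" if "z \<in> ?Q" "w \<in> ?Q" for z w
    unfolding \<delta>2_def pt_def tpow_def
    using powi_derivative[OF cnn(2)[OF that]] powi_add[OF cnn(1)[OF that]] by (simp add: algebra_simps)
  have neg_sq: "j \<in> ideal_square m \<Longrightarrow> - j \<in> ideal_square m" for j
  proof (induction rule: ideal_square.induct)
    case (prod x y)
    have "- x \<in> m" using m_mult[of "- 1" x] prod S(5)[OF S(2)] by simp
    from ideal_square.prod[OF this prod(2)] show ?case by simp
  next
    case (sum x y)
    then show ?case using ideal_square.sum[of "- x" m "- y"] by simp
  qed
  show ?thesis
    unfolding cotangent_basis_in_def
  proof (rule bexI[OF _ uv(1)], rule bexI[OF _ uv(2)], intro conjI ballI impI)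
    fix x assume x: "x \<in> m"
    then have "x \<in> ?A" using mA by blast
    then have "x \<in> I" using red[of x] ev_m[OF x] by simp
    then obtain P Q where P: "x = P * u + Q * v" "P \<in> ?A" "Q \<in> ?A" unfolding I_def by blast
    let ?j = "(P - lconst (ev P)) * u + (Q - lconst (ev Q)) * v"
    have "?j \<in> ideal_square m"
      using red[OF P(2)] red[OF P(3)] Im uv by (intro ideal_square.sum ideal_square.prod) auto
    moreover have "x = lconst (ev P) * u + lconst (ev Q) * v + ?j" using P(1) by (simp add: algebra_simps)
    ultimately show "\<exists>a\<in>range lconst. \<exists>b\<in>range lconst. \<exists>j\<in>ideal_square m. x = a * u + b * v + j" by blast
  next
    fix a b assume ab: "a \<in> range lconst" "b \<in> range (lconst :: 'k \<Rightarrow> _)" "a * u + b * v \<in> ideal_square m"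
    obtain \<alpha> \<beta> where al: "a = lconst \<alpha>" "b = lconst \<beta>" using ab by blast
    have "a * u + b * v = Poly_Mapping.single (1, 0) \<alpha> + Poly_Mapping.single (0, 1) \<beta> + lconst (- (\<alpha> * c) - \<beta> * d)"
      by (simp add: al u_def v_def algebra_simps mult_single single_diff single_uminus single_add)
    then have "D \<delta>1 (a * u + b * v) = \<alpha>" "D \<delta>2 (a * u + b * v) = \<beta>"
      by (simp_all add: D_add D_single \<delta>1_def \<delta>2_def)
    then have "\<alpha> = 0" "\<beta> = 0" using D_sq[OF leib1 ab(3)] D_sq[OF leib2 ab(3)] by auto
    then show "a = 0" "b = 0" using al by auto
  qed
qed

section \<open>Pointed semigroups with three irreducible elements\<close>

definition irreducible_in :: "(int \<times> int) set \<Rightarrow> int \<times> int \<Rightarrow> bool" where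
  "irreducible_in M z \<longleftrightarrow> z \<in> M \<and> z \<noteq> 0 \<and> (\<forall>a\<in>M. \<forall>b\<in>M. z = a + b \<longrightarrow> a = 0 \<or> b = 0)"

text \<open>A matrix of size three that factors through a space of dimension two has determinant zero.\<close>

lemma rank_two_identity:
  fixes a b u v :: "nat \<Rightarrow> 'k::field"
  assumes "\<And>i k. i < 3 \<Longrightarrow> k < 3 \<Longrightarrow> a i * u k + b i * v k = (if i = k then 1 else 0)"
  shows False
proof -
  have e: "a 0 * u 0 + b 0 * v 0 = 1" "a 0 * u 1 + b 0 * v 1 = 0" "a 0 * u 2 + b 0 * v 2 = 0"
    "a 1 * u 0 + b 1 * v 0 = 0" "a 1 * u 1 + b 1 * v 1 = 1" "a 1 * u 2 + b 1 * v 2 = 0"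
    "a 2 * u 0 + b 2 * v 0 = 0" "a 2 * u 1 + b 2 * v 1 = 0" "a 2 * u 2 + b 2 * v 2 = 1"
    using assms[of 0 0] assms[of 0 1] assms[of 0 2] assms[of 1 0] assms[of 1 1] assms[of 1 2]
      assms[of 2 0] assms[of 2 1] assms[of 2 2] by auto
  have "(a 0 * u 0 + b 0 * v 0) * ((a 1 * u 1 + b 1 * v 1) * (a 2 * u 2 + b 2 * v 2) - (a 1 * u 2 + b 1 * v 2) * (a 2 * u 1 + b 2 * v 1))
     - (a 0 * u 1 + b 0 * v 1) * ((a 1 * u 0 + b 1 * v 0) * (a 2 * u 2 + b 2 * v 2) - (a 1 * u 2 + b 1 * v 2) * (a 2 * u 0 + b 2 * v 0))
     + (a 0 * u 2 + b 0 * v 2) * ((a 1 * u 0 + b 1 * v 0) * (a 2 * u 1 + b 2 * v 1) - (a 1 * u 1 + b 1 * v 1) * (a 2 * u 0 + b 2 * v 0)) = 0"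
    by (simp add: algebra_simps)
  then show False unfolding e by simp
qed

text \<open>The elements without constant term form a maximal ideal.  The coefficient at an irreducible exponent
vanishes on its square, so three irreducible exponents give three independent linear forms on the
cotangent space.\<close>

theorem three_irreducibles_singular:
  fixes E :: "int \<times> int \<Rightarrow> int"
  assumes M: "add_submonoid M" and E: "\<And>z w. E (z + w) = E z + E w"
    and pos: "\<And>z. z \<in> M \<Longrightarrow> z \<noteq> 0 \<Longrightarrow> 0 < E z"
    and irr: "\<And>i. i < (3::nat) \<Longrightarrow> irreducible_in M (z i)" and dist: "inj_on z {..<3}"
  shows "\<exists>m :: 'k::field laurent set. maximal_in (supported M) m \<and> \<not> cotangent_basis_in (range lconst) m"
proof -
  let ?A = "supported M :: 'k laurent set"
  note S = supported_simps[OF M]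
  define m where "m = {F \<in> ?A. Poly_Mapping.lookup F 0 = 0}"
  have M0: "0 \<in> M" "\<And>a b. a \<in> M \<Longrightarrow> b \<in> M \<Longrightarrow> a + b \<in> M" using M by (auto simp: add_submonoid_def)
  have E0: "E 0 = 0" using E[of 0 0] by simp
  have sum0: "a = 0 \<and> b = 0" if "a \<in> M" "b \<in> M" "a + b = 0" for a b
  proof -
    have "E a + E b = 0" using that E E0 by metis
    moreover have "0 \<le> E a" "0 \<le> E b" using pos that E0 by (metis less_imp_le order_refl)+
    ultimately have "E a = 0" "E b = 0" by auto
    then show ?thesis using pos that by (metis less_irrefl)
  qed
  have keys_m: "Poly_Mapping.keys F \<subseteq> M - {0}" if "F \<in> m" for F
    using that by (auto simp: m_def supported_def in_keys_iff)
  have m_iff: "F \<in> m \<longleftrightarrow> Poly_Mapping.keys F \<subseteq> M - {0}" for F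
    by (auto simp: m_def supported_def in_keys_iff)
  have lc: "lconst a \<in> ?A" for a using M0 by (auto intro!: supported_single)
  have "maximal_in ?A m"
    unfolding maximal_in_def
  proof (intro conjI ballI)
    show "m \<subseteq> ?A" by (auto simp: m_def)
    show "0 \<in> m" by (simp add: m_iff)
    show "1 \<notin> m" by (simp add: m_def)
    show "x + y \<in> m" if "x \<in> m" "y \<in> m" for x y
      using that S(3)[of x y] by (simp add: m_def lookup_add)
    show am: "a * x \<in> m" if "a \<in> ?A" "x \<in> m" for a x
      unfolding m_iff
    proof (rule keys_mult_subset)
      fix p q assume "p \<in> Poly_Mapping.keys a" "q \<in> Poly_Mapping.keys x"
      then have "p \<in> M" "q \<in> M" "q \<noteq> 0" using that keys_m[OF that(2)] by (auto simp: supported_def)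
      then show "p + q \<in> M - {0}" using sum0 M0 by blast
    qed
    show "\<exists>y\<in>?A. x * y - 1 \<in> m" if x: "x \<in> ?A - m" for x
    proof -
      let ?c = "Poly_Mapping.lookup x 0"
      have c: "?c \<noteq> 0" using x by (auto simp: m_def)
      have x1: "x - lconst ?c \<in> m" using x S(6)[of x "lconst ?c"] lc by (simp add: m_def lookup_minus)
      have "x * lconst (inverse ?c) - 1 = lconst (inverse ?c) * (x - lconst ?c)"
        using c by (simp add: algebra_simps mult_single)
      then show ?thesis using am[OF lc x1] lc by metis
    qed
  qed
  moreover have "\<not> cotangent_basis_in (range lconst) m"
  proof
    assume "cotangent_basis_in (range lconst) m"
    then obtain u v where uv: "\<forall>x\<in>m. \<exists>a\<in>range lconst. \<exists>b\<in>range lconst. \<exists>j\<in>ideal_square m. x = a * u + b * v + j"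
      unfolding cotangent_basis_in_def by (elim bexE conjE) (rule that)
    have sq: "Poly_Mapping.lookup j (z k) = 0" if "j \<in> ideal_square m" "k < 3" for j k
      using that(1)
    proof induction
      case (prod x y)
      have "Poly_Mapping.keys (x * y) \<subseteq> UNIV - {z k}"
      proof (rule keys_mult_subset)
        fix p q assume "p \<in> Poly_Mapping.keys x" "q \<in> Poly_Mapping.keys y"
        then have "p \<in> M" "q \<in> M" "p \<noteq> 0" "q \<noteq> 0" using keys_m prod by blast+
        then show "p + q \<in> UNIV - {z k}" using irr[OF that(2)] unfolding irreducible_in_def by fastforce
      qed
      then show ?case by (auto simp: in_keys_iff)
    qed (simp add: lookup_add)
    have zm: "lmono (z i) \<in> m" if "i < 3" for i using irr[OF that] by (simp add: m_iff irreducible_in_def)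
    have "\<exists>a b. \<forall>k<3. a * Poly_Mapping.lookup u (z k) + b * Poly_Mapping.lookup v (z k) = (if i = k then 1 else 0)"
      if i: "i < 3" for i :: nat
    proof -
      obtain a b j where abj: "a \<in> range lconst" "b \<in> range lconst" "j \<in> ideal_square m" "lmono (z i) = a * u + b * v + j"
        using bspec[OF uv zm[OF i]] by (elim bexE) (rule that)
      obtain \<alpha> \<beta> where "a = lconst \<alpha>" "b = lconst \<beta>" using abj(1,2) by auto
      then have ab: "j \<in> ideal_square m" "lmono (z i) = lconst \<alpha> * u + lconst \<beta> * v + j" using abj by simp_all
      have lk: "Poly_Mapping.lookup (lconst a * F) w = a * Poly_Mapping.lookup F w" for a and F :: "'k laurent" and w
        by (simp add: mult_map_scale_conv_mult[symmetric] Poly_Mapping.map.rep_eq when_def)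
      have "\<alpha> * Poly_Mapping.lookup u (z k) + \<beta> * Poly_Mapping.lookup v (z k) = (if i = k then 1 else 0)" if k: "k < 3" for k
      proof -
        have "Poly_Mapping.lookup (lmono (z i)) (z k) = (if i = k then 1 else (0 :: 'k))"
          using dist i k by (auto simp: lookup_single when_def dest: inj_onD)
        then show ?thesis unfolding ab(2) by (simp add: lookup_add lk sq[OF ab(1) k])
      qed
      then show ?thesis by blast
    qed
    then obtain a b where "\<And>i k. i < 3 \<Longrightarrow> k < 3 \<Longrightarrow>
      a i * Poly_Mapping.lookup u (z k) + b i * Poly_Mapping.lookup v (z k) = (if i = k then 1 else 0)" by metis
    from rank_two_identity[of a "\<lambda>k. Poly_Mapping.lookup u (z k)" b "\<lambda>k. Poly_Mapping.lookup v (z k)", OF this]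
    show False .
  qed
  ultimately show ?thesis by blast
qed

no_notation vec_index (infixl "$" 100)
no_notation fps_nth (infixl "$" 75)

section \<open>Planes and their Pluecker coordinates\<close>

abbreviation minor :: "'k::field ^ 'n \<Rightarrow> 'k ^ 'n \<Rightarrow> 'n \<Rightarrow> 'n \<Rightarrow> 'k" where
  "minor u v i j \<equiv> u $ i * v $ j - u $ j * v $ i"

lemma in_span_pair: "w \<in> vec.span {u, v} \<longleftrightarrow> (\<exists>a b. w = a *s u + b *s v)"
proof -
  have "w \<in> vec.span {u, v} \<longleftrightarrow> (\<exists>a b. w - a *s u = b *s v)"
    by (simp add: vec.span_breakdown_eq[of w u] vec.span_singleton image_iff)
  then show ?thesis by (metis add_diff_cancel_left' diff_add_cancel add.commute)
qed

lemma minor_nonzero_dim: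
  fixes u v :: "'k::field ^ 'n::finite"
  assumes "minor u v i j \<noteq> 0"
  shows "vec.dim (vec.span {u, v}) = 2"
proof -
  have "u \<notin> vec.span {v}"
    using assms by (auto simp: vec.span_singleton)
  moreover have "v \<noteq> 0" using assms by auto
  ultimately have "vec.independent {u, v}"
    by (simp add: vec.independent_insert)
  moreover have "u \<noteq> v" using assms by auto
  ultimately show ?thesis by (simp add: vec.dim_eq_card_independent)
qed

lemma dim_minor_nonzero:
  fixes u v :: "'k::field ^ 'n::finite"
  assumes "vec.dim (vec.span {u, v}) = 2"
  shows "\<exists>i j. minor u v i j \<noteq> 0"
proof (rule ccontr)
  assume "\<not> ?thesis"
  then have z: "minor u v i j = 0" for i j by blast
  have "\<exists>w. {u, v} \<subseteq> vec.span {w}"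
  proof (cases "u = 0")
    case True
    then show ?thesis by (intro exI[of _ v]) (auto simp: vec.span_zero vec.span_base)
  next
    case False
    then obtain i where i: "u $ i \<noteq> 0" by (metis Finite_Cartesian_Product.vec_eq_iff zero_index)
    have "v = (v $ i / u $ i) *s u"
    proof (rule Finite_Cartesian_Product.vec_eq_iff[THEN iffD2, rule_format])
      fix j
      have "u $ i * v $ j = u $ j * v $ i" using z[of i j] by simp
      then show "v $ j = ((v $ i / u $ i) *s u) $ j" using i by (simp add: field_simps)
    qed
    then have "v \<in> vec.span {u}" by (auto simp: vec.span_singleton)
    then show ?thesis by (intro exI[of _ u]) (auto simp: vec.span_base)
  qed
  then obtain w where "{u, v} \<subseteq> vec.span {w}" by blast
  then have "vec.dim {u, v} \<le> card {w}" by (rule vec.dim_le_card) simp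
  then show False using assms by simp
qed

text \<open>The scaling of coordinates that is needed to normalize \<open>p\<^sub>i\<^sub>j\<close> to one.\<close>

lemma pluecker_scale:
  assumes "pluecker W p" "c \<noteq> 0"
  shows "pluecker W (c *s p)"
proof -
  obtain u v where uv: "vec.span {u, v} = W" "\<forall>i j. p $ (i, j) = minor u v i j"
    using assms(1) unfolding pluecker_def by blast
  have "w \<in> vec.span {c *s u, v} \<longleftrightarrow> w \<in> vec.span {u, v}" for w
  proof
    assume "w \<in> vec.span {c *s u, v}"
    then obtain a b where "w = a *s (c *s u) + b *s v" unfolding in_span_pair by blast
    then have "w = (a * c) *s u + b *s v" by simp
    then show "w \<in> vec.span {u, v}" unfolding in_span_pair by blast
  next
    assume "w \<in> vec.span {u, v}"
    then obtain a b where "w = a *s u + b *s v" unfolding in_span_pair by blast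
    then have "w = (a / c) *s (c *s u) + b *s v" using assms(2) by simp
    then show "w \<in> vec.span {c *s u, v}" unfolding in_span_pair by blast
  qed
  then have "vec.span {c *s u, v} = W" using uv(1) by blast
  moreover have "\<forall>i j. (c *s p) $ (i, j) = minor (c *s u) v i j"
    unfolding vector_smult_component uv(2)[rule_format] by (simp add: algebra_simps)
  ultimately show ?thesis unfolding pluecker_def by blast
qed

section \<open>Evaluation of polynomials\<close>

definition mono_val :: "'k::field ^ 'm::finite \<Rightarrow> ('m \<Rightarrow>\<^sub>0 nat) \<Rightarrow> 'k" where
  "mono_val x m = (\<Prod>i\<in>UNIV. (x $ i) ^ Poly_Mapping.lookup m i)"

lemma peval_lin_ext: "peval f x = lin_ext (\<lambda>c. c) (mono_val x) f"
  by (simp add: peval_def lin_ext_def mono_val_def)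

lemma mono_val_zero [simp]: "mono_val x 0 = 1" by (simp add: mono_val_def)

lemma mono_val_add: "mono_val x (m + n) = mono_val x m * mono_val x n"
  by (simp add: mono_val_def lookup_add power_add prod.distrib)

lemma mono_val_single: "mono_val x (Poly_Mapping.single i n) = (x $ i) ^ n"
proof -
  have "mono_val x (Poly_Mapping.single i n) = (\<Prod>j\<in>UNIV. if j = i then (x $ i) ^ n else 1)"
    unfolding mono_val_def by (rule prod.cong) (auto simp: lookup_single when_def)
  then show ?thesis by simp
qed

interpretation peval: monomial_eval "\<lambda>c :: 'k::field. c" "mono_val (x :: 'k ^ 'm::finite)"
  by unfold_locales (auto simp: mono_val_add)

lemma peval_simps:
  "peval (f + g) x = peval f x + peval g x" "peval (f * g) x = peval f x * peval g x"
  "peval 1 x = 1" "peval (f - g) x = peval f x - peval g x" "peval 0 x = 0"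
  "peval (sum h A) x = (\<Sum>a\<in>A. peval (h a) x)" "peval (prod h A) x = (\<Prod>a\<in>A. peval (h a) x)"
  "peval (f ^ n) x = peval f x ^ n"
  "peval (Poly_Mapping.single m c) x = c * mono_val x m"
  by (simp_all add: peval_lin_ext peval.eval_add peval.eval_mult peval.eval_one peval.eval_diff
      peval.eval_sum peval.eval_prod peval.eval_power peval.eval_single)

lemma of_int_nat_parts: "of_int n = (of_nat (nat n) - of_nat (nat (- n)) :: 'r::ring_1)"
  by (cases "0 \<le> n") simp_all

lemma peval_of_int: "peval (of_int n) x = of_int n"
proof -
  have "peval (of_nat k) x = of_nat k" for k
    by (induction k) (simp_all add: peval_simps)
  then show ?thesis by (simp only: of_int_nat_parts peval_simps)
qed

text \<open>Substituting polynomials for the variables.\<close>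

definition subst_poly :: "('m::finite \<Rightarrow> 't::comm_ring_1) \<Rightarrow> ('m \<Rightarrow>\<^sub>0 nat) \<Rightarrow> 't" where
  "subst_poly \<sigma> m = (\<Prod>i\<in>UNIV. \<sigma> i ^ Poly_Mapping.lookup m i)"

lemma monomial_eval_subst:
  assumes "\<And>a b. h (a + b) = h a + h b" "\<And>a b. h (a * b) = h a * h b" "h 1 = 1"
  shows "monomial_eval h (subst_poly \<sigma>)"
  by unfold_locales (use assms in \<open>auto simp: subst_poly_def lookup_add power_add prod.distrib\<close>)

lemma subst_poly_single: "subst_poly \<sigma> (Poly_Mapping.single i n) = \<sigma> i ^ n"
proof -
  have "subst_poly \<sigma> (Poly_Mapping.single i n) = (\<Prod>j\<in>UNIV. if j = i then \<sigma> i ^ n else 1)"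
    unfolding subst_poly_def by (rule prod.cong) (auto simp: lookup_single when_def)
  then show ?thesis by simp
qed

lemma subst_poly_image:
  assumes "monomial_eval h \<mu>" 
  shows "lin_ext h \<mu> (subst_poly \<sigma> m) = (\<Prod>i\<in>UNIV. lin_ext h \<mu> (\<sigma> i) ^ Poly_Mapping.lookup m i)"
proof -
  interpret monomial_eval h \<mu> by (rule assms)
  show ?thesis unfolding subst_poly_def by (simp add: eval_prod eval_power)
qed

definition poly_compose :: "('k::field, 'm::finite) mpoly \<Rightarrow> ('m \<Rightarrow> ('k, 'n) mpoly) \<Rightarrow> ('k, 'n::finite) mpoly" where
  "poly_compose F \<sigma> = lin_ext (Poly_Mapping.single 0) (subst_poly \<sigma>) F"

lemma single0_hom: "Poly_Mapping.single (0 :: 'm::comm_monoid_add) (a + b :: 'k::comm_ring_1) = Poly_Mapping.single 0 a + Poly_Mapping.single 0 b"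
  "Poly_Mapping.single (0 :: 'm::comm_monoid_add) (a * b :: 'k::comm_ring_1) = Poly_Mapping.single 0 a * Poly_Mapping.single 0 b"
  by (simp_all add: single_add mult_single)

lemma monomial_eval_compose: "monomial_eval (Poly_Mapping.single 0 :: 'k::field \<Rightarrow> ('m::comm_monoid_add \<Rightarrow>\<^sub>0 'k)) (subst_poly \<sigma>)"
  by (rule monomial_eval_subst) (simp_all add: single0_hom)

lemma peval_compose: "peval (poly_compose F \<sigma>) x = peval F (\<chi> i. peval (\<sigma> i) x)"
proof (induction F rule: pm_induct)
  case (single m c)
  have "peval (subst_poly \<sigma> m) x = mono_val (\<chi> i. peval (\<sigma> i) x) m"
    by (simp add: subst_poly_def mono_val_def peval_simps)
  then show ?case
    by (simp add: poly_compose_def monomial_eval.eval_single[OF monomial_eval_compose] peval_simps)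
qed (simp_all add: poly_compose_def monomial_eval.eval_add[OF monomial_eval_compose] peval_simps)

lemma peval_det: "peval (Determinants.det M) x = Determinants.det (\<chi> i j. peval (M $ i $ j) x)"
  by (simp add: Determinants.det_def peval_simps peval_of_int)

subsection \<open>Derivatives\<close>

lemma peval_partial_deriv:
  "peval (partial_deriv i f) x =
     lin_ext (\<lambda>c. c) (\<lambda>m. of_nat (Poly_Mapping.lookup m i) * mono_val x (m - Poly_Mapping.single i 1)) f"
  unfolding partial_deriv_def peval_simps lin_ext_def by (rule sum.cong) (simp_all add: mult_ac)

text \<open>The truncated subtraction in the exponent matters only when the coefficient is zero.\<close>

lemma mono_val_deriv:
  "x $ i * (of_nat (Poly_Mapping.lookup m i) * mono_val x (m - Poly_Mapping.single i 1)) =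
    of_nat (Poly_Mapping.lookup m i) * mono_val x m"
proof (cases "Poly_Mapping.lookup m i = 0")
  case False
  have "m = Poly_Mapping.single i 1 + (m - Poly_Mapping.single i 1)"
    by (rule poly_mapping_eqI) (use False in \<open>auto simp: lookup_add lookup_minus lookup_single when_def\<close>)
  then have "mono_val x m = x $ i * mono_val x (m - Poly_Mapping.single i 1)"
    by (metis mono_val_add mono_val_single power_one_right)
  then show ?thesis by simp
qed simp

definition dir_deriv :: "('k::field, 'm::finite) mpoly \<Rightarrow> 'k ^ 'm \<Rightarrow> 'k ^ 'm \<Rightarrow> 'k" where
  "dir_deriv f x v = (\<Sum>i\<in>UNIV. peval (partial_deriv i f) x * v $ i)"

lemma dir_deriv_add: "dir_deriv (f + g) x v = dir_deriv f x v + dir_deriv g x v"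
  unfolding dir_deriv_def peval_partial_deriv by (simp add: lin_ext_add sum.distrib algebra_simps)

lemma peval_partial_deriv_add:
  "peval (partial_deriv i (f + g)) x = peval (partial_deriv i f) x + peval (partial_deriv i g) x"
  unfolding peval_partial_deriv by (rule lin_ext_add) simp

lemma peval_partial_deriv_scale:
  "peval (partial_deriv i (Poly_Mapping.single 0 c * f)) x = c * peval (partial_deriv i f) x"
proof (induction f rule: pm_induct)
  case (single m a)
  then show ?case by (simp add: peval_partial_deriv mult_single lin_ext_single)
next
  case (add f g)
  then show ?case by (simp add: distrib_left peval_partial_deriv_add)
qed (simp add: peval_partial_deriv)

text \<open>Along \<open>v\<close> with coordinates \<open>v\<^sub>i = w\<^sub>i x\<^sub>i\<close> a monomial is an eigenvector of the derivative.\<close>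

lemma dir_deriv_single:
  assumes "\<And>i. v $ i = w i * x $ i"
  shows "dir_deriv (Poly_Mapping.single m c) x v =
    c * mono_val x m * (\<Sum>i\<in>UNIV. of_nat (Poly_Mapping.lookup m i) * w i)"
proof -
  have "peval (partial_deriv i (Poly_Mapping.single m c)) x * v $ i =
     c * mono_val x m * (of_nat (Poly_Mapping.lookup m i) * w i)" for i
  proof -
    have "peval (partial_deriv i (Poly_Mapping.single m c)) x * v $ i =
      c * w i * (x $ i * (of_nat (Poly_Mapping.lookup m i) * mono_val x (m - Poly_Mapping.single i 1)))"
      by (simp add: peval_partial_deriv lin_ext_single assms mult_ac)
    then show ?thesis unfolding mono_val_deriv by (simp add: mult_ac)
  qed
  then show ?thesis unfolding dir_deriv_def by (simp add: sum_distrib_left)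
qed

section \<open>The torus of a toric surface\<close>

definition det2 :: "int \<times> int \<Rightarrow> int \<times> int \<Rightarrow> int" where
  "det2 a b = fst a * snd b - snd a * fst b"

lemma toric_weight_zero [simp]: "toric_weight \<gamma> 0 = 0"
  by (simp add: toric_weight_def zero_prod_def[symmetric])

lemma fst_sum': "fst (sum f A) = (\<Sum>a\<in>A. fst (f a))" and snd_sum': "snd (sum f A) = (\<Sum>a\<in>A. snd (f a))"
  by (induction A rule: infinite_finite_induct; simp)+

lemma toric_weight_coords:
  "fst (toric_weight \<gamma> m) = (\<Sum>i\<in>UNIV. int (Poly_Mapping.lookup m i) * fst (\<gamma> i))"
  "snd (toric_weight \<gamma> m) = (\<Sum>i\<in>UNIV. int (Poly_Mapping.lookup m i) * snd (\<gamma> i))"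
  by (simp_all add: toric_weight_def fst_sum' snd_sum')

lemma toric_weight_add: "toric_weight \<gamma> (m + n) = toric_weight \<gamma> m + toric_weight \<gamma> n"
  by (simp add: prod_eq_iff toric_weight_coords lookup_add sum.distrib algebra_simps)

lemma toric_hom_lin_ext: "toric_hom \<gamma> f = lin_ext lconst (\<lambda>m. lmono (toric_weight \<gamma> m)) f"
  by (simp add: toric_hom_def lin_ext_def mult_single)

lemma toric_hom_simps:
  "toric_hom \<gamma> (f + g) = toric_hom \<gamma> f + toric_hom \<gamma> g" "toric_hom \<gamma> 0 = 0"
  "toric_hom \<gamma> (Poly_Mapping.single m c) = Poly_Mapping.single (toric_weight \<gamma> m) c"
  unfolding toric_hom_lin_ext by (simp_all add: lin_ext_add single_add lin_ext_single mult_single)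

abbreviation in_torus :: "'k::field \<times> 'k \<Rightarrow> bool" where
  "in_torus s \<equiv> fst s \<noteq> 0 \<and> snd s \<noteq> 0"

definition torus_pt :: "('n::finite \<Rightarrow> int \<times> int) \<Rightarrow> 'k::field \<times> 'k \<Rightarrow> 'k ^ 'n" where
  "torus_pt \<gamma> s = (\<chi> i. tpow s (\<gamma> i))"

lemma tpow_sum:
  assumes "in_torus s"
  shows "tpow s (\<Sum>i\<in>A. f i) = (\<Prod>i\<in>A. tpow s (f i))"
  by (induction A rule: infinite_finite_induct) (use assms in \<open>simp_all add: tpow_add\<close>)

lemma tpow_zmult: "in_torus s \<Longrightarrow> tpow s (zmult n z) = tpow s z ^ n"
  by (induction n) (simp_all add: tpow_add)

lemma toric_weight_zmult: "toric_weight \<gamma> m = (\<Sum>i\<in>UNIV. zmult (Poly_Mapping.lookup m i) (\<gamma> i))"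
  by (simp add: toric_weight_def zmult_def)

lemma mono_val_torus: "in_torus s \<Longrightarrow> mono_val (torus_pt \<gamma> s) m = tpow s (toric_weight \<gamma> m)"
  by (simp add: mono_val_def torus_pt_def toric_weight_zmult tpow_sum tpow_zmult)

lemma peval_torus:
  assumes "in_torus s"
  shows "peval f (torus_pt \<gamma> s) = torus_eval s (toric_hom \<gamma> f)"
  by (induction f rule: pm_induct)
    (simp_all add: peval_simps toric_hom_simps lin_ext_add lin_ext_single mono_val_torus assms)

lemma torus_pt_in_surface: "in_torus s \<Longrightarrow> torus_pt \<gamma> s \<in> toric_surface \<gamma>"
  by (simp add: toric_surface_def zero_set_def peval_torus)

lemma toric_hom_eq_0I:
  fixes f :: "('k::alg_closed_field, 'n::finite) mpoly"
  assumes "\<And>s. in_torus s \<Longrightarrow> peval f (torus_pt \<gamma> s) = 0"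
  shows "toric_hom \<gamma> f = 0"
  by (rule laurent_eq_0I) (use assms peval_torus in metis)

lemma vanishing_ideal_toric_surface:
  fixes \<gamma> :: "'n::finite \<Rightarrow> int \<times> int"
  shows "vanishing_ideal (toric_surface \<gamma> :: ('k::alg_closed_field ^ 'n) set) = {f. toric_hom \<gamma> f = 0}"
proof (intro equalityI subsetI CollectI)
  fix f :: "('k, 'n) mpoly" assume "f \<in> vanishing_ideal (toric_surface \<gamma>)"
  then have f: "\<forall>x\<in>toric_surface \<gamma>. peval f x = 0" by (simp add: vanishing_ideal_def)
  have "peval f (torus_pt \<gamma> s) = 0" if "in_torus s" for s
    by (rule bspec[OF f torus_pt_in_surface[OF that]])
  then show "toric_hom \<gamma> f = 0" by (rule toric_hom_eq_0I)
qed (simp add: vanishing_ideal_def toric_surface_def zero_set_def)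

text \<open>With \<open>\<pi>\<close> one of the two projections, the derivative of the parametrization \<open>torus_pt\<close> along the
corresponding one-parameter subgroup.\<close>

definition log_vec :: "(int \<times> int \<Rightarrow> int) \<Rightarrow> ('n::finite \<Rightarrow> int \<times> int) \<Rightarrow> 'k::field \<times> 'k \<Rightarrow> 'k ^ 'n" where
  "log_vec \<pi> \<gamma> s = (\<chi> i. of_int (\<pi> (\<gamma> i)) * torus_pt \<gamma> s $ i)"

text \<open>The torus acts on the surface, and the derivatives of the action are tangent vectors.\<close>

lemma log_vec_tangent:
  fixes \<gamma> :: "'n::finite \<Rightarrow> int \<times> int" and s :: "'k::alg_closed_field \<times> 'k"
  assumes s: "in_torus s" and \<pi>: "\<pi> = fst \<or> \<pi> = snd"
  shows "log_vec \<pi> \<gamma> s \<in> tangent_space (toric_surface \<gamma>) (torus_pt \<gamma> s)"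
proof -
  have wt: "(\<Sum>i\<in>UNIV. of_nat (Poly_Mapping.lookup m i) * of_int (\<pi> (\<gamma> i))) = (of_int (\<pi> (toric_weight \<gamma> m)) :: 'k)" for m
    using \<pi> by (auto simp: toric_weight_coords)
  have "dir_deriv f (torus_pt \<gamma> s) (log_vec \<pi> \<gamma> s) =
      lin_ext (\<lambda>c. c) (\<lambda>z. of_int (\<pi> z) * tpow s z) (toric_hom \<gamma> f)" for f :: "('k, 'n) mpoly"
  proof (induction f rule: pm_induct)
    case zero
    then show ?case by (simp add: dir_deriv_def peval_partial_deriv toric_hom_simps)
  next
    case (single m c)
    have "dir_deriv (Poly_Mapping.single m c) (torus_pt \<gamma> s) (log_vec \<pi> \<gamma> s) =
      c * tpow s (toric_weight \<gamma> m) * of_int (\<pi> (toric_weight \<gamma> m))"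
      using dir_deriv_single[of "log_vec \<pi> \<gamma> s" "\<lambda>i. of_int (\<pi> (\<gamma> i))" "torus_pt \<gamma> s"]
      by (simp add: log_vec_def wt mono_val_torus s)
    then show ?case by (simp add: toric_hom_simps lin_ext_single mult_ac)
  next
    case (add f g)
    then show ?case by (simp add: dir_deriv_add toric_hom_simps lin_ext_add)
  qed
  then have "dir_deriv f (torus_pt \<gamma> s) (log_vec \<pi> \<gamma> s) = 0" if "toric_hom \<gamma> f = 0" for f :: "('k, 'n) mpoly"
    using that by simp
  then show ?thesis
    unfolding tangent_space_def vanishing_ideal_toric_surface mem_Collect_eq by (simp add: dir_deriv_def)
qed

text \<open>Binomials relating each generator to two generators that form a lattice basis bound the
  tangent space from above.\<close>

lemma tangent_space_torus:
  fixes \<gamma> :: "'n::finite \<Rightarrow> int \<times> int" and s :: "'k::alg_closed_field \<times> 'k"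
  assumes s: "in_torus s" and basis: "\<bar>det2 (\<gamma> i0) (\<gamma> j0)\<bar> = 1"
  shows "tangent_space (toric_surface \<gamma>) (torus_pt \<gamma> s) = vec.span {log_vec fst \<gamma> s, log_vec snd \<gamma> s}" (is "?T = ?S")
proof
  have sub: "vec.subspace ?T"
    unfolding vec.subspace_def tangent_space_def
    by (auto simp: algebra_simps sum.distrib sum_distrib_left[symmetric] simp flip: sum_distrib_left)
  show "?S \<subseteq> ?T"
    by (rule vec.span_minimal[OF _ sub]) (use log_vec_tangent[OF s] in auto)
  show "?T \<subseteq> ?S"
  proof
    fix v assume v: "v \<in> ?T"
    define \<delta> where "\<delta> = det2 (\<gamma> i0) (\<gamma> j0)"
    have dd: "\<delta> * \<delta> = 1" using basis unfolding \<delta>_def[symmetric] by (metis abs_mult_self_eq mult_1)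
    let ?x = "torus_pt \<gamma> s"
    have x0: "?x $ i \<noteq> 0" for i using s by (simp add: torus_pt_def tpow_nonzero)
    define w where "w i = v $ i / ?x $ i" for i
    have vw: "v $ i = w i * ?x $ i" for i using x0 by (simp add: w_def)
    define p where "p k = \<delta> * det2 (\<gamma> k) (\<gamma> j0)" for k
    define q where "q k = \<delta> * det2 (\<gamma> i0) (\<gamma> k)" for k
    have gk: "fst (\<gamma> k) = p k * fst (\<gamma> i0) + q k * fst (\<gamma> j0)" "snd (\<gamma> k) = p k * snd (\<gamma> i0) + q k * snd (\<gamma> j0)" for k
    proof -
      have "p k * fst (\<gamma> i0) + q k * fst (\<gamma> j0) = \<delta> * (det2 (\<gamma> i0) (\<gamma> j0) * fst (\<gamma> k))"
        unfolding p_def q_def det2_def by (simp add: algebra_simps)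
      then show "fst (\<gamma> k) = p k * fst (\<gamma> i0) + q k * fst (\<gamma> j0)" using dd by (simp flip: \<delta>_def mult.assoc)
      have "p k * snd (\<gamma> i0) + q k * snd (\<gamma> j0) = \<delta> * (det2 (\<gamma> i0) (\<gamma> j0) * snd (\<gamma> k))"
        unfolding p_def q_def det2_def by (simp add: algebra_simps)
      then show "snd (\<gamma> k) = p k * snd (\<gamma> i0) + q k * snd (\<gamma> j0)" using dd by (simp flip: \<delta>_def mult.assoc)
    qed
    \<comment> \<open>the binomial that expresses the generator \<open>k\<close> by \<open>i0\<close> and \<open>j0\<close>, with negative exponents moved to
      the other side\<close>
    have wk: "w k = of_int (p k) * w i0 + of_int (q k) * w j0" for k
    proof -
      define m1 where "m1 = Poly_Mapping.single k (1::nat) + Poly_Mapping.single i0 (nat (- p k)) + Poly_Mapping.single j0 (nat (- q k))"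
      define m2 where "m2 = Poly_Mapping.single i0 (nat (p k)) + Poly_Mapping.single j0 (nat (q k))"
      define f where "f = Poly_Mapping.single m1 (1::'k) + Poly_Mapping.single m2 (- 1)"
      have tw: "toric_weight \<gamma> (Poly_Mapping.single i n) = zmult n (\<gamma> i)" for i n
      proof -
        have "zmult (Poly_Mapping.lookup (Poly_Mapping.single i n) j) (\<gamma> j) = (if j = i then zmult n (\<gamma> i) else 0)" for j
          by (simp add: lookup_single when_def)
        then show ?thesis unfolding toric_weight_zmult by simp
      qed
      have m12: "toric_weight \<gamma> m1 = toric_weight \<gamma> m2"
      proof -
        have n: "int (nat (p k)) = p k + int (nat (- p k))" "int (nat (q k)) = q k + int (nat (- q k))" by simp_all
        show ?thesis
          unfolding m1_def m2_def toric_weight_add tw prod_eq_iff zmult_def fst_add snd_add fst_conv snd_conv n gk[of k]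
          by (simp add: algebra_simps)
      qed
      have "toric_hom \<gamma> f = 0" by (simp add: f_def toric_hom_simps m12 flip: single_add)
      then have "dir_deriv f ?x v = 0"
        using v unfolding tangent_space_def vanishing_ideal_toric_surface by (simp add: dir_deriv_def)
      then have "mono_val ?x m1 * (\<Sum>i\<in>UNIV. of_nat (Poly_Mapping.lookup m1 i) * w i) =
          mono_val ?x m2 * (\<Sum>i\<in>UNIV. of_nat (Poly_Mapping.lookup m2 i) * w i)"
        unfolding f_def dir_deriv_add dir_deriv_single[OF vw] by simp
      moreover have "mono_val ?x m1 = mono_val ?x m2" "mono_val ?x m1 \<noteq> 0"
        using s m12 by (simp_all add: mono_val_torus tpow_nonzero)
      ultimately have eq: "(\<Sum>i\<in>UNIV. of_nat (Poly_Mapping.lookup m1 i) * w i) = (\<Sum>i\<in>UNIV. of_nat (Poly_Mapping.lookup m2 i) * w i)"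
        by simp
      have one: "(\<Sum>i\<in>UNIV. of_nat (Poly_Mapping.lookup (Poly_Mapping.single j n) i) * w i) = of_nat n * w j" for j n
      proof -
        have "of_nat (Poly_Mapping.lookup (Poly_Mapping.single j n) i) * w i = (if i = j then of_nat n * w j else 0)" for i
          by (simp add: lookup_single when_def)
        then show ?thesis by simp
      qed
      have "w k + of_nat (nat (- p k)) * w i0 + of_nat (nat (- q k)) * w j0 = of_nat (nat (p k)) * w i0 + of_nat (nat (q k)) * w j0"
        using eq unfolding m1_def m2_def lookup_add of_nat_add distrib_right sum.distrib one by simp
      then have "w k = (of_nat (nat (p k)) - of_nat (nat (- p k))) * w i0 + (of_nat (nat (q k)) - of_nat (nat (- q k))) * w j0"
      proof -
        have "a = (c - x) + (d - y)" if "a + x + y = c + d" for a c d x y :: 'k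
        proof -
          have "a = (a + x + y) - y - x" by simp
          then show ?thesis unfolding that by (simp add: algebra_simps)
        qed
        then show ?thesis using \<open>w k + _ + _ = _\<close> unfolding left_diff_distrib by blast
      qed
      then show ?thesis unfolding of_int_nat_parts[symmetric] .
    qed
    let ?\<alpha> = "of_int \<delta> * (w i0 * of_int (snd (\<gamma> j0)) - w j0 * of_int (snd (\<gamma> i0)))"
    let ?\<beta> = "of_int \<delta> * (w j0 * of_int (fst (\<gamma> i0)) - w i0 * of_int (fst (\<gamma> j0)))"
    have "v = ?\<alpha> *s log_vec fst \<gamma> s + ?\<beta> *s log_vec snd \<gamma> s"
    proof (rule Finite_Cartesian_Product.vec_eq_iff[THEN iffD2, rule_format])
      fix k
      have "w k = ?\<alpha> * of_int (fst (\<gamma> k)) + ?\<beta> * of_int (snd (\<gamma> k))"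
        unfolding wk[of k] p_def q_def det2_def by (simp add: algebra_simps)
      then show "v $ k = (?\<alpha> *s log_vec fst \<gamma> s + ?\<beta> *s log_vec snd \<gamma> s) $ k"
        unfolding vw by (simp only: log_vec_def vec_lambda_beta vector_add_component vector_smult_component
            mult.assoc distrib_right)
    qed
    then show "v \<in> ?S" unfolding in_span_pair by blast
  qed
qed

lemma minor_log_vec:
  "minor (log_vec fst \<gamma> s) (log_vec snd \<gamma> s) k l = of_int (det2 (\<gamma> k) (\<gamma> l)) * (torus_pt \<gamma> s $ k * torus_pt \<gamma> s $ l)"
  by (simp add: log_vec_def det2_def algebra_simps)

text \<open>The Pluecker coordinates of the tangent plane at a torus point, by \<open>minor_log_vec\<close>.\<close>

definition torus_pluecker :: "('n::finite \<Rightarrow> int \<times> int) \<Rightarrow> 'k::field \<times> 'k \<Rightarrow> 'k ^ ('n \<times> 'n)" where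
  "torus_pluecker \<gamma> s = (\<chi> kl. of_int (det2 (\<gamma> (fst kl)) (\<gamma> (snd kl))) * (torus_pt \<gamma> s $ fst kl * torus_pt \<gamma> s $ snd kl))"

section \<open>The closure of the Gauss graph\<close>

lemma proper_subspace_annihilator:
  fixes W :: "('k::field ^ 'n::finite) set"
  assumes W: "vec.subspace W" and a: "a \<notin> W"
  shows "\<exists>w. w \<noteq> 0 \<and> (\<forall>u\<in>W. (\<Sum>l\<in>UNIV. u $ l * w $ l) = 0)"
proof -
  obtain B where B: "B \<subseteq> W" "vec.independent B" "W \<subseteq> vec.span B" "card B = vec.dim W"
    by (rule vec.basis_exists)
  have spanB: "vec.span B \<subseteq> W" by (rule vec.span_minimal[OF B(1) W])
  have ind: "vec.independent (insert a B)"
    by (rule vec.independent_insertI) (use a spanB B in blast)+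
  interpret vp: vector_space_pair "(*s) :: 'k \<Rightarrow> 'k ^ 'n \<Rightarrow> 'k ^ 'n" "(*) :: 'k \<Rightarrow> 'k \<Rightarrow> 'k"
    by unfold_locales
  obtain g where g: "Vector_Spaces.linear (*s) (*) g" "\<forall>x\<in>insert a B. g x = (if x = a then 1 else 0)"
    using vp.linear_independent_extend[OF ind, of "\<lambda>x. if x = a then 1 else 0"] by blast
  interpret g: Vector_Spaces.linear "(*s) :: 'k \<Rightarrow> 'k ^ 'n \<Rightarrow> 'k ^ 'n" "(*) :: 'k \<Rightarrow> 'k \<Rightarrow> 'k" g by (rule g(1))
  have ga: "g a = 1" using g(2) by simp
  have gB: "g b = 0" if "b \<in> B" for b
  proof -
    have "b \<noteq> a" using that B(1) a by blast
    then show ?thesis using g(2) that by simp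
  qed
  have gW: "g u = 0" if "u \<in> W" for u
    using g.eq_0_on_span[OF gB] that B(3) by blast
  define w where "w = (\<chi> l. g (axis l 1))"
  have expand: "g x = (\<Sum>l\<in>UNIV. x $ l * w $ l)" for x
  proof -
    have "g x = g (\<Sum>l\<in>UNIV. (x $ l) *s axis l 1)" by (simp add: basis_expansion)
    also have "\<dots> = (\<Sum>l\<in>UNIV. x $ l * w $ l)" by (simp add: g.sum g.scale w_def)
    finally show ?thesis .
  qed
  have "w \<noteq> 0"
  proof
    assume "w = 0"
    then have "g a = 0" by (simp add: expand)
    then show False using ga by simp
  qed
  then show ?thesis using gW expand by (intro exI[of _ w]) auto
qed

lemma mono_val_join:
  "mono_val (join_coords x p) m =
    (\<Prod>i\<in>UNIV. (x $ i) ^ Poly_Mapping.lookup m (Inl i)) * (\<Prod>ij\<in>UNIV. (p $ ij) ^ Poly_Mapping.lookup m (Inr ij))"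
  unfolding mono_val_def join_coords_def UNIV_Plus_UNIV[symmetric]
  by (subst prod.Plus) simp_all

lemma homogeneous_scale:
  fixes F :: "('k::field, 'n::finite + 'n \<times> 'n) mpoly"
  assumes "pluecker_homogeneous F"
  shows "\<exists>e. \<forall>x p c. peval F (join_coords x (c *s p)) = c ^ e * peval F (join_coords x p)"
proof -
  obtain e where e: "\<And>m. m \<in> Poly_Mapping.keys F \<Longrightarrow> (\<Sum>ij\<in>UNIV. Poly_Mapping.lookup m (Inr ij)) = e"
    using assms unfolding pluecker_homogeneous_def by blast
  have "peval F (join_coords x (c *s p)) = c ^ e * peval F (join_coords x p)" for x p c
    unfolding peval_lin_ext lin_ext_def sum_distrib_left
  proof (rule sum.cong[OF refl])
    fix m assume "m \<in> Poly_Mapping.keys F"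
    from e[OF this] show "Poly_Mapping.lookup F m * mono_val (join_coords x (c *s p)) m =
      c ^ e * (Poly_Mapping.lookup F m * mono_val (join_coords x p) m)"
      by (simp add: mono_val_join power_mult_distrib prod.distrib power_sum[symmetric] mult_ac)
  qed
  then show ?thesis by blast
qed

text \<open>Near a nonsingular point \<open>q\<close> the tangent spaces are the kernels of finitely many gradients.  Two
  coordinate projections complete these to a square matrix that is invertible at \<open>q\<close>, and
  Cramer's rule then gives Pluecker coordinates that are polynomial in the point.  So a polynomial
  condition on points and tangent planes extends from the torus to \<open>q\<close>.\<close>

theorem vanishing_on_gauss_graph:
  fixes \<gamma> :: "'n::finite \<Rightarrow> int \<times> int" and F :: "('k::alg_closed_field, 'n + 'n \<times> 'n) mpoly"
  defines "V \<equiv> toric_surface \<gamma> :: ('k ^ 'n) set"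
  assumes basis: "\<bar>det2 (\<gamma> i0) (\<gamma> j0)\<bar> = 1" and hom: "pluecker_homogeneous F"
    and tor: "\<And>s. in_torus s \<Longrightarrow> peval F (join_coords (torus_pt \<gamma> s) (torus_pluecker \<gamma> s)) = 0"
    and q: "q \<in> V" "vec.dim (tangent_space V q) = 2" and p: "pluecker (tangent_space V q) p"
  shows "peval F (join_coords q p) = 0"
proof -
  obtain e where e: "\<And>x p c. peval F (join_coords x (c *s p)) = c ^ e * peval F (join_coords x p)"
    using homogeneous_scale[OF hom] by blast
  have tan: "w \<in> tangent_space V x \<longleftrightarrow> (\<forall>f. toric_hom \<gamma> f = 0 \<longrightarrow> dir_deriv f x w = 0)" for w x
    by (simp add: tangent_space_def V_def vanishing_ideal_toric_surface dir_deriv_def)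
  obtain u v where uv: "vec.span {u, v} = tangent_space V q" and puv: "\<And>k l. p $ (k, l) = minor u v k l"
    using p unfolding pluecker_def by blast
  obtain i j where ij: "minor u v i j \<noteq> 0" using dim_minor_nonzero[of u v] q(2) uv by auto
  then have "i \<noteq> j" by auto
  define grad :: "('k, 'n) mpoly \<Rightarrow> 'k ^ 'n" where "grad f = (\<chi> l. peval (partial_deriv l f) q)" for f
  \<comment> \<open>the gradients of the equations, together with the two coordinate forms that are independent on
    the tangent plane; they span everything\<close>
  define U where "U = {grad f + a *s axis i 1 + b *s axis j 1 | f a b. toric_hom \<gamma> f = 0}"
  have grad_add: "grad (f + g) = grad f + grad g" for f g
    by (simp add: grad_def Finite_Cartesian_Product.vec_eq_iff peval_partial_deriv_add)
  have grad_scale: "grad (Poly_Mapping.single 0 c * f) = c *s grad f" for c f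
    by (simp add: grad_def Finite_Cartesian_Product.vec_eq_iff peval_partial_deriv_scale)
  have grad_0: "grad 0 = 0"
    by (simp add: grad_def Finite_Cartesian_Product.vec_eq_iff peval_partial_deriv)
  have toric_scale: "toric_hom \<gamma> (Poly_Mapping.single 0 c * f) = lconst c * toric_hom \<gamma> f" for c and f :: "('k, 'n) mpoly"
  proof (induction f rule: pm_induct)
    case (single m a) then show ?case by (simp add: mult_single toric_hom_simps)
  qed (simp_all add: toric_hom_simps distrib_left)
  have subU: "vec.subspace U"
    unfolding vec.subspace_def
  proof (intro conjI ballI allI)
    show "0 \<in> U" unfolding U_def
      by (intro CollectI exI[of _ 0]) (simp add: grad_0 toric_hom_simps)
  next
    fix x y assume "x \<in> U" "y \<in> U"
    then obtain f a b f' a' b' where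
      "x = grad f + a *s axis i 1 + b *s axis j 1" "toric_hom \<gamma> f = 0"
      "y = grad f' + a' *s axis i 1 + b' *s axis j 1" "toric_hom \<gamma> f' = 0" unfolding U_def by auto
    then have "x + y = grad (f + f') + (a + a') *s axis i 1 + (b + b') *s axis j 1" "toric_hom \<gamma> (f + f') = 0"
      by (simp_all add: grad_add toric_hom_simps vec.scale_left_distrib)
    then show "x + y \<in> U" unfolding U_def by blast
  next
    fix c x assume "x \<in> U"
    then obtain f a b where
      "x = grad f + a *s axis i 1 + b *s axis j 1" "toric_hom \<gamma> f = 0" unfolding U_def by auto
    then have "c *s x = grad (Poly_Mapping.single 0 c * f) + (c * a) *s axis i 1 + (c * b) *s axis j 1"
      "toric_hom \<gamma> (Poly_Mapping.single 0 c * f) = 0"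
      by (simp_all add: grad_scale toric_scale vec.scale_right_distrib)
    then show "c *s x \<in> U" unfolding U_def by blast
  qed
  have ax: "(\<Sum>l\<in>UNIV. axis k (1::'k) $ l * w $ l) = w $ k" for k :: 'n and w
  proof -
    have "axis k (1::'k) $ l * w $ l = (if l = k then w $ k else 0)" for l by (simp add: axis_def)
    then show ?thesis by simp
  qed
  have Uall: "a \<in> U" for a
  proof (rule ccontr)
    assume "a \<notin> U"
    then obtain w where w: "w \<noteq> 0" "\<And>y. y \<in> U \<Longrightarrow> (\<Sum>l\<in>UNIV. y $ l * w $ l) = 0"
      using proper_subspace_annihilator[OF subU] by blast
    have "grad f \<in> U" if "toric_hom \<gamma> f = 0" for f
      unfolding U_def using that by (intro CollectI exI[of _ f] exI[of _ 0]) simp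
    then have "(\<Sum>l\<in>UNIV. grad f $ l * w $ l) = 0" if "toric_hom \<gamma> f = 0" for f
      using w(2) that by simp
    then have "w \<in> tangent_space V q"
      unfolding tan by (simp add: dir_deriv_def grad_def)
    then obtain a b where ab: "w = a *s u + b *s v" unfolding uv[symmetric] in_span_pair by blast
    have "axis i 1 \<in> U" unfolding U_def
      by (intro CollectI exI[of _ 0] exI[of _ 1] exI[of _ 0]) (simp add: grad_0 toric_hom_simps)
    then have wi: "w $ i = 0" using w(2) ax by metis
    have "axis j 1 \<in> U" unfolding U_def
      by (intro CollectI exI[of _ 0] exI[of _ 0] exI[of _ 1]) (simp add: grad_0 toric_hom_simps)
    then have wj: "w $ j = 0" using w(2) ax by metis
    have "a * minor u v i j = w $ i * v $ j - w $ j * v $ i" "b * minor u v i j = w $ j * u $ i - w $ i * u $ j"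
      unfolding ab by (simp_all add: algebra_simps)
    then have "a = 0" "b = 0" using wi wj ij by simp_all
    then show False using ab w(1) by simp
  qed
  have "\<exists>f a b. toric_hom \<gamma> f = 0 \<and> axis k 1 = grad f + a *s axis i 1 + b *s axis j 1" for k
  proof -
    have "axis k 1 \<in> U" by (rule Uall)
    then show ?thesis unfolding U_def mem_Collect_eq by blast
  qed
  then obtain fk ak bk where fk: "\<And>k. toric_hom \<gamma> (fk k) = 0"
    and axk: "\<And>k. axis k 1 = grad (fk k) + ak k *s axis i 1 + bk k *s axis j 1" by metis
  \<comment> \<open>a square matrix of polynomials whose rows span at \<open>q\<close>; \<open>UP\<close> and \<open>VP\<close> solve, up to the factor \<open>\<Delta>\<close>, for
    the tangent vectors with \<open>(i, j)\<close>-coordinates \<open>(1, 0)\<close> and \<open>(0, 1)\<close>\<close>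
  define NP :: "('k, 'n) mpoly ^ 'n ^ 'n" where
    "NP = (\<chi> a b. if a = i then (if b = i then 1 else 0) else if a = j then (if b = j then 1 else 0)
       else partial_deriv b (fk a))"
  define N where "N x = (\<chi> a b. peval (NP $ a $ b) x)" for x
  define UP where "UP k = Determinants.det (\<chi> a b. if b = k then (if a = i then 1 else 0) else NP $ a $ b)" for k
  define VP where "VP k = Determinants.det (\<chi> a b. if b = k then (if a = j then 1 else 0) else NP $ a $ b)" for k
  define \<Delta> where "\<Delta> x = Determinants.det (N x)" for x
  define U' where "U' x = (\<chi> k. peval (UP k) x)" for x
  define V' where "V' x = (\<chi> k. peval (VP k) x)" for x
  define P' where "P' x = (\<chi> kl. minor (U' x) (V' x) (fst kl) (snd kl))" for x
  have N_row: "(N x *v w) $ a = (if a = i then w $ i else if a = j then w $ j else dir_deriv (fk a) x w)" for x w a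
  proof -
    have d: "(\<Sum>b\<in>UNIV. (if b = k then 1 else 0) * w $ b) = w $ k" for k :: 'n
      by (simp add: if_distrib[of "\<lambda>z. z * _"] cong: if_cong)
    have "peval (NP $ a $ b) x = (if a = i then (if b = i then 1 else 0) else if a = j then (if b = j then 1 else 0)
       else peval (partial_deriv b (fk a)) x)" for b
      by (simp add: NP_def peval_simps)
    then show ?thesis by (simp add: N_def matrix_vector_mult_def dir_deriv_def d)
  qed
  have U'_det: "U' x $ k = Determinants.det (\<chi> a b. if b = k then axis i 1 $ a else N x $ a $ b)" for x k
    unfolding U'_def UP_def peval_det vec_lambda_beta
    by (rule arg_cong[where f = Determinants.det])
      (simp add: Finite_Cartesian_Product.vec_eq_iff N_def peval_simps axis_def)
  have V'_det: "V' x $ k = Determinants.det (\<chi> a b. if b = k then axis j 1 $ a else N x $ a $ b)" for x k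
    unfolding V'_def VP_def peval_det vec_lambda_beta
    by (rule arg_cong[where f = Determinants.det])
      (simp add: Finite_Cartesian_Product.vec_eq_iff N_def peval_simps axis_def)
  have frame: "\<Delta> x * w $ k = w $ i * U' x $ k + w $ j * V' x $ k"
    if D: "\<Delta> x \<noteq> 0" and w: "w \<in> tangent_space V x" for x w k
  proof -
    have "invertible (N x)" using D by (simp add: \<Delta>_def invertible_det_nz)
    then obtain B where B: "N x ** B = Finite_Cartesian_Product.mat 1" "B ** N x = Finite_Cartesian_Product.mat 1" unfolding invertible_def by blast
    define y where "y = B *v axis i 1"
    define z where "z = B *v axis j 1"
    have Ny: "N x *v y = axis i 1" "N x *v z = axis j 1"
      unfolding y_def z_def by (simp_all add: matrix_vector_mul_assoc B)
    have "U' x $ k = y $ k * \<Delta> x" "V' x $ k = z $ k * \<Delta> x"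
      unfolding U'_det V'_det Ny[symmetric] \<Delta>_def by (rule cramer_lemma)+
    moreover have "w = w $ i *s y + w $ j *s z"
    proof -
      have "N x *v w = w $ i *s axis i 1 + w $ j *s axis j 1"
        unfolding Finite_Cartesian_Product.vec_eq_iff N_row
        using w fk \<open>i \<noteq> j\<close> unfolding tan by (auto simp: axis_def)
      also have "\<dots> = N x *v (w $ i *s y + w $ j *s z)"
        by (simp add: matrix_vector_right_distrib vector_scalar_commute Ny)
      finally have "B *v (N x *v w) = B *v (N x *v (w $ i *s y + w $ j *s z))" by simp
      then show ?thesis by (simp only: matrix_vector_mul_assoc B matrix_vector_mul_lid)
    qed
    then have "w $ k = w $ i * y $ k + w $ j * z $ k"
      by (metis vector_add_component vector_smult_component)
    ultimately show ?thesis by (simp add: algebra_simps)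
  qed
  have proportional: "(\<Delta> x * \<Delta> x) * minor w w' k l = minor w w' i j * P' x $ (k, l)"
    if D: "\<Delta> x \<noteq> 0" and w: "w \<in> tangent_space V x" "w' \<in> tangent_space V x" for x w w' k l
  proof -
    have "(\<Delta> x * \<Delta> x) * minor w w' k l = (\<Delta> x * w $ k) * (\<Delta> x * w' $ l) - (\<Delta> x * w $ l) * (\<Delta> x * w' $ k)"
      by (simp add: algebra_simps)
    also have "\<dots> = minor w w' i j * P' x $ (k, l)"
      unfolding frame[OF D w(1)] frame[OF D w(2)] by (simp add: P'_def algebra_simps)
    finally show ?thesis .
  qed
  define \<sigma> :: "'n + 'n \<times> 'n \<Rightarrow> ('k, 'n) mpoly" where
    "\<sigma> t = (case t of Inl l \<Rightarrow> Poly_Mapping.single (Poly_Mapping.single l 1) 1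
       | Inr kl \<Rightarrow> UP (fst kl) * VP (snd kl) - UP (snd kl) * VP (fst kl))" for t
  \<comment> \<open>\<open>H\<close> vanishes on the torus, hence on the surface; the factor \<open>det NP\<close> takes care of the torus points
    where the frame degenerates\<close>
  define H where "H = Determinants.det NP * poly_compose F \<sigma>"
  have H: "peval H x = \<Delta> x * peval F (join_coords x (P' x))" for x
  proof -
    have "(\<chi> t. peval (\<sigma> t) x) = join_coords x (P' x)"
      by (simp add: Finite_Cartesian_Product.vec_eq_iff join_coords_def \<sigma>_def peval_simps mono_val_single
          P'_def U'_def V'_def split: sum.split)
    then show ?thesis by (simp add: H_def peval_simps peval_compose peval_det \<Delta>_def N_def)
  qed
  have "peval H (torus_pt \<gamma> s) = 0" if s: "in_torus s" for s
  proof (cases "\<Delta> (torus_pt \<gamma> s) = 0")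
    case False
    let ?x = "torus_pt \<gamma> s"
    let ?a = "log_vec fst \<gamma> s" and ?b = "log_vec snd \<gamma> s"
    have ab: "?a \<in> tangent_space V ?x" "?b \<in> tangent_space V ?x"
      unfolding V_def by (rule log_vec_tangent[OF s]; simp)+
    let ?c = "minor ?a ?b i j"
    have eq: "(\<Delta> ?x * \<Delta> ?x) *s torus_pluecker \<gamma> s = ?c *s P' ?x"
      using proportional[OF False ab] by (simp add: Finite_Cartesian_Product.vec_eq_iff torus_pluecker_def minor_log_vec)
    have "torus_pluecker \<gamma> s $ (i0, j0) \<noteq> 0"
    proof -
      have "of_int (det2 (\<gamma> i0) (\<gamma> j0)) \<noteq> (0 :: 'k)" using basis by (auto simp: abs_if split: if_splits)
      then show ?thesis using s by (simp add: torus_pluecker_def torus_pt_def tpow_nonzero)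
    qed
    then have "?c \<noteq> 0" using arg_cong[OF eq, of "\<lambda>p. p $ (i0, j0)"] False by auto
    moreover have "?c ^ e * peval F (join_coords ?x (P' ?x)) = 0"
      unfolding e[symmetric] eq[symmetric] using tor[OF s] by (simp add: e)
    ultimately show ?thesis by (simp add: H)
  qed (simp add: H)
  then have "toric_hom \<gamma> H = 0" by (rule toric_hom_eq_0I)
  then have "peval H q = 0" using q(1) by (simp add: V_def toric_surface_def zero_set_def)
  moreover have Dq: "\<Delta> q \<noteq> 0"
  proof -
    have "w = 0" if Nw: "N q *v w = 0" for w
    proof (rule Finite_Cartesian_Product.vec_eq_iff[THEN iffD2, rule_format])
      fix k
      have row: "(N q *v w) $ a = 0" for a using Nw by simp
      have wij: "w $ i = 0" "w $ j = 0" using row[of i] row[of j] \<open>i \<noteq> j\<close> by (simp_all add: N_row split: if_splits)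
      show "w $ k = 0 $ k"
      proof (cases "k = i \<or> k = j")
        case False
        then have "dir_deriv (fk k) q w = 0" using row[of k] by (simp add: N_row)
        then have "(\<Sum>l\<in>UNIV. grad (fk k) $ l * w $ l) = 0" by (simp add: dir_deriv_def grad_def)
        moreover have "w $ k = (\<Sum>l\<in>UNIV. grad (fk k) $ l * w $ l) + ak k * w $ i + bk k * w $ j"
        proof -
          have "w $ k = (\<Sum>l\<in>UNIV. (grad (fk k) + ak k *s axis i 1 + bk k *s axis j 1) $ l * w $ l)"
            unfolding axk[symmetric] ax ..
          also have "\<dots> = (\<Sum>l\<in>UNIV. grad (fk k) $ l * w $ l) + ak k * (\<Sum>l\<in>UNIV. axis i 1 $ l * w $ l) + bk k * (\<Sum>l\<in>UNIV. axis j 1 $ l * w $ l)"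
            by (simp add: distrib_right sum.distrib sum_distrib_left mult.assoc)
          finally show ?thesis unfolding ax .
        qed
        ultimately show ?thesis using wij by simp
      qed (use wij in auto)
    qed
    then have "\<exists>B. B ** N q = Finite_Cartesian_Product.mat 1" unfolding matrix_left_invertible_ker by blast
    then show ?thesis by (simp add: \<Delta>_def invertible_det_nz[symmetric] invertible_left_inverse)
  qed
  ultimately have F0: "peval F (join_coords q (P' q)) = 0" by (simp add: H)
  have "u \<in> tangent_space V q" "v \<in> tangent_space V q"
    unfolding uv[symmetric] by (auto intro: vec.span_base)
  from proportional[OF Dq this] have eq: "(\<Delta> q * \<Delta> q) *s p = minor u v i j *s P' q"
    unfolding Finite_Cartesian_Product.vec_eq_iff by (simp only: split_paired_All vector_smult_component puv simp_thms)
  have "(\<Delta> q * \<Delta> q) ^ e * peval F (join_coords q p) = 0"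
    unfolding e[symmetric] eq unfolding e F0 by simp
  then show ?thesis using Dq by simp
qed

section \<open>Charts of the Nash blowup\<close>

text \<open>Two generators that form a lattice basis make the parametrization of the torus injective and all
torus points nonsingular.\<close>

locale toric_nash =
  fixes \<gamma> :: "'n::finite \<Rightarrow> int \<times> int" and i0 j0 :: 'n and V :: "('k::alg_closed_field ^ 'n) set"
  assumes basis: "\<bar>det2 (\<gamma> i0) (\<gamma> j0)\<bar> = 1" and V: "V = toric_surface \<gamma>"
begin

lemma torus_tangent:
  assumes s: "in_torus s"
  shows "tangent_space V (torus_pt \<gamma> s) \<in> grassmannian2" (is "?T \<in> _")
    and "pluecker (tangent_space V (torus_pt \<gamma> s)) (torus_pluecker \<gamma> s)"
proof -
  have T: "?T = vec.span {log_vec fst \<gamma> s, log_vec snd \<gamma> s}"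
    unfolding V by (rule tangent_space_torus[OF s basis])
  have "of_int (det2 (\<gamma> i0) (\<gamma> j0)) \<noteq> (0 :: 'k)" using basis by (auto simp: abs_if split: if_splits)
  then have "minor (log_vec fst \<gamma> s) (log_vec snd \<gamma> s) i0 j0 \<noteq> 0"
    unfolding minor_log_vec using s by (simp add: torus_pt_def tpow_nonzero)
  from minor_nonzero_dim[OF this] show "?T \<in> grassmannian2"
    unfolding T grassmannian2_def by (simp add: vec.subspace_span)
  show "pluecker ?T (torus_pluecker \<gamma> s)"
    unfolding pluecker_def T
    by (intro exI[of _ "log_vec fst \<gamma> s"] exI[of _ "log_vec snd \<gamma> s"] conjI refl allI)
      (simp only: minor_log_vec torus_pluecker_def vec_lambda_beta fst_conv snd_conv)
qed

lemma torus_in_nash: 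
  assumes s: "in_torus s"
  shows "(torus_pt \<gamma> s, tangent_space V (torus_pt \<gamma> s)) \<in> nash_blowup V"
proof -
  have "torus_pt \<gamma> s \<in> V - singular_locus V"
    using torus_pt_in_surface[OF s, of \<gamma>] torus_tangent(1)[OF s] V
    by (simp add: singular_locus_def grassmannian2_def)
  then have "(torus_pt \<gamma> s, tangent_space V (torus_pt \<gamma> s)) \<in> gauss_graph V" by (simp add: gauss_graph_def)
  then show ?thesis
    unfolding nash_blowup_def using hull_subset[of "gauss_graph V" zariski_closed] torus_tangent(1)[OF s]
      \<open>torus_pt \<gamma> s \<in> V - singular_locus V\<close> by auto
qed

text \<open>The zero set of \<open>F\<close> is closed and contains the Gauss graph.\<close>

lemma vanishing_on_nash:
  assumes hom: "pluecker_homogeneous F"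
    and tor: "\<And>s. in_torus s \<Longrightarrow> peval F (join_coords (torus_pt \<gamma> s) (torus_pluecker \<gamma> s)) = 0"
    and x: "(x, W) \<in> nash_blowup V" and p: "pluecker W p"
  shows "peval F (join_coords x p) = 0"
proof -
  let ?Z = "{(x, W). W \<in> grassmannian2 \<and> (\<forall>F\<in>{F}. \<forall>p. pluecker W p \<longrightarrow> peval F (join_coords x p) = 0)}"
  have closed: "zariski_closed ?Z" unfolding zariski_closed_def using hom by blast
  have "gauss_graph V \<subseteq> ?Z"
  proof
    fix z assume "z \<in> gauss_graph V"
    then obtain q where q: "z = (q, tangent_space V q)" "q \<in> V" "vec.dim (tangent_space V q) = 2"
      by (auto simp: gauss_graph_def singular_locus_def)
    have "vec.subspace (tangent_space V q)"
      unfolding vec.subspace_def tangent_space_def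
      by (auto simp: algebra_simps sum.distrib sum_distrib_left[symmetric] simp flip: sum_distrib_left)
    then have "tangent_space V q \<in> grassmannian2" using q by (simp add: grassmannian2_def)
    moreover have "peval F (join_coords q p) = 0" if "pluecker (tangent_space V q) p" for p
      using vanishing_on_gauss_graph[OF basis hom tor, of q p] q that V by simp
    ultimately show "z \<in> ?Z" using q(1) by simp
  qed
  then have "zariski_closed hull gauss_graph V \<subseteq> ?Z" using closed by (rule hull_minimal)
  then show ?thesis using x p unfolding nash_blowup_def by auto
qed

definition coord_var :: "'n \<Rightarrow> 'n \<Rightarrow> ('k, 'n + 'n \<times> 'n) mpoly" where
  "coord_var i j = Poly_Mapping.single (Poly_Mapping.single (Inr (i, j)) 1) 1"

text \<open>The coordinate \<open>p\<^sub>i\<^sub>j\<close> vanishes at the torus points, hence on the whole Nash blowup.\<close>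

lemma chart_empty:
  assumes "of_int (det2 (\<gamma> i) (\<gamma> j)) = (0 :: 'k)"
  shows "affine_chart i j (nash_blowup V) = {}"
proof -
  have hom: "pluecker_homogeneous (coord_var i j)"
    unfolding pluecker_homogeneous_def coord_var_def by (intro exI[of _ 1]) (simp add: lookup_single when_def)
  have val: "peval (coord_var i j) (join_coords x p) = p $ (i, j)" for x and p :: "'k ^ ('n \<times> 'n)"
    by (simp add: coord_var_def peval_simps mono_val_single join_coords_def)
  have "p $ (i, j) = 0" if "(x, W) \<in> nash_blowup V" "pluecker W p" for x W p
    using vanishing_on_nash[OF hom _ that] assms unfolding val by (simp add: torus_pluecker_def)
  then show ?thesis unfolding affine_chart_def by fastforce
qed

end

inductive_set monoid_span :: "(int \<times> int) set \<Rightarrow> (int \<times> int) set" for G where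
  zero: "0 \<in> monoid_span G"
| add: "g \<in> G \<Longrightarrow> z \<in> monoid_span G \<Longrightarrow> g + z \<in> monoid_span G"

lemma monoid_span_base: "g \<in> G \<Longrightarrow> g \<in> monoid_span G"
  using monoid_span.add[OF _ monoid_span.zero, of g G] by simp

lemma monoid_span_plus: "a \<in> monoid_span G \<Longrightarrow> b \<in> monoid_span G \<Longrightarrow> a + b \<in> monoid_span G"
  by (induction a rule: monoid_span.induct) (auto simp: add.assoc intro: monoid_span.intros)

lemma monoid_span_submonoid: "add_submonoid (monoid_span G)"
  by (simp add: add_submonoid_def monoid_span.zero monoid_span_plus)

text \<open>The set \<open>gens\<close> contains the exponents of the coordinate functions \<open>x\<^sub>k\<close> and \<open>p\<^sub>k\<^sub>l / p\<^sub>i\<^sub>j\<close> on the torus.  It is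
given by an equation, not by a definition, as it depends on the type \<open>'k\<close> through its characteristic.\<close>

locale toric_nash_chart = toric_nash \<gamma> i0 j0 V
  for \<gamma> :: "'n::finite \<Rightarrow> int \<times> int" and i0 j0 :: 'n and V :: "('k::alg_closed_field ^ 'n) set" +
  fixes i j :: 'n and gens :: "(int \<times> int) set"
  assumes ij: "of_int (det2 (\<gamma> i) (\<gamma> j)) \<noteq> (0 :: 'k)"
    and gens: "gens = range \<gamma> \<union> {\<gamma> k + \<gamma> l - \<gamma> i - \<gamma> j | k l. of_int (det2 (\<gamma> k) (\<gamma> l)) \<noteq> (0 :: 'k)}"
begin

text \<open>The coordinate functions \<open>x\<^sub>k\<close> and \<open>p\<^sub>k\<^sub>l / p\<^sub>i\<^sub>j\<close> of the chart, restricted to the torus.\<close>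

definition chart_coord :: "'n + 'n \<times> 'n \<Rightarrow> 'k laurent" where
  "chart_coord t = (case t of Inl l \<Rightarrow> lmono (\<gamma> l)
     | Inr kl \<Rightarrow> Poly_Mapping.single (\<gamma> (fst kl) + \<gamma> (snd kl) - \<gamma> i - \<gamma> j)
         (of_int (det2 (\<gamma> (fst kl)) (\<gamma> (snd kl))) / of_int (det2 (\<gamma> i) (\<gamma> j))))"

definition chart_hom :: "('k, 'n + 'n \<times> 'n) mpoly \<Rightarrow> 'k laurent" where
  "chart_hom = lin_ext lconst (subst_poly chart_coord)"

sublocale ch: monomial_eval "lconst :: 'k \<Rightarrow> 'k laurent" "subst_poly chart_coord"
  by (rule monomial_eval_subst) (simp_all add: single0_hom)

lemmas chart_hom_simps = ch.eval_add[folded chart_hom_def] ch.eval_mult[folded chart_hom_def]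
  ch.eval_one[folded chart_hom_def] ch.eval_single[folded chart_hom_def] ch.eval_sum[folded chart_hom_def]

definition chart_pt :: "'k \<times> 'k \<Rightarrow> 'k ^ ('n + 'n \<times> 'n)" where
  "chart_pt s = join_coords (torus_pt \<gamma> s) (inverse (torus_pluecker \<gamma> s $ (i, j)) *s torus_pluecker \<gamma> s)"

lemma torus_pluecker_ij: "in_torus s \<Longrightarrow> torus_pluecker \<gamma> s $ (i, j) \<noteq> 0" for s :: "'k \<times> 'k"
  using ij by (simp add: torus_pluecker_def torus_pt_def tpow_nonzero)

lemma peval_chart_pt:
  assumes s: "in_torus s"
  shows "peval f (chart_pt s) = torus_eval s (chart_hom f)"
proof -
  interpret t: monomial_eval "\<lambda>c :: 'k. c" "tpow s" by (rule monomial_eval_torus) (use s in auto)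
  have tp: "tpow s (a - b) = tpow s a / tpow s b" for a b
  proof -
    have "tpow s (a - b) * tpow s b = tpow s a" using tpow_add[of s "a - b" b] s by simp
    then show ?thesis using tpow_nonzero[of s b] s by (simp add: field_simps)
  qed
  have coord: "torus_eval s (chart_coord t) = chart_pt s $ t" for t
  proof (cases t)
    case (Inl l)
    then show ?thesis by (simp add: chart_coord_def chart_pt_def join_coords_def t.eval_single torus_pt_def)
  next
    case (Inr kl)
    have "torus_eval s (chart_coord t) = of_int (det2 (\<gamma> (fst kl)) (\<gamma> (snd kl))) / of_int (det2 (\<gamma> i) (\<gamma> j)) *
        (tpow s (\<gamma> (fst kl)) * tpow s (\<gamma> (snd kl)) / tpow s (\<gamma> i) / tpow s (\<gamma> j))"
      using s by (simp add: Inr chart_coord_def t.eval_single tp tpow_add)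
    also have "\<dots> = chart_pt s $ t"
      using s ij by (simp add: Inr chart_pt_def join_coords_def torus_pluecker_def torus_pt_def tpow_nonzero field_simps)
    finally show ?thesis .
  qed
  show ?thesis
  proof (induction f rule: pm_induct)
    case (single m c)
    have "torus_eval s (subst_poly chart_coord m) = mono_val (chart_pt s) m"
      by (simp add: subst_poly_image[OF t.monomial_eval_axioms] mono_val_def coord)
    then show ?case by (simp add: peval_simps chart_hom_simps t.eval_mult t.eval_single)
  next
    case (add f g)
    then show ?case by (simp only: peval_simps chart_hom_simps t.eval_add)
  qed (simp add: peval_simps chart_hom_def)
qed

abbreviation "Z \<equiv> affine_chart i j (nash_blowup V)"

lemma chart_pt_in_chart: "in_torus s \<Longrightarrow> chart_pt s \<in> Z"
  unfolding affine_chart_def chart_pt_def mem_Collect_eq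
  by (intro exI[of _ "torus_pt \<gamma> s"] exI[of _ "tangent_space V (torus_pt \<gamma> s)"]
      exI[of _ "inverse (torus_pluecker \<gamma> s $ (i, j)) *s torus_pluecker \<gamma> s"] conjI refl
      torus_in_nash pluecker_scale torus_tangent(2)) (use torus_pluecker_ij in auto)

definition pluecker_degree :: "('n + 'n \<times> 'n \<Rightarrow>\<^sub>0 nat) \<Rightarrow> nat" where
  "pluecker_degree m = (\<Sum>kl\<in>UNIV. Poly_Mapping.lookup m (Inr kl))"

text \<open>Homogenizing a polynomial with powers of \<open>p\<^sub>i\<^sub>j\<close> does not change its values on the chart, and then
  \<open>vanishing_on_nash\<close> applies.\<close>

lemma vanishing_ideal_chart: "vanishing_ideal Z = {f. chart_hom f = 0}"
proof (intro equalityI subsetI CollectI)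
  fix f assume "f \<in> vanishing_ideal Z"
  then have f: "\<forall>x\<in>Z. peval f x = 0" by (simp add: vanishing_ideal_def)
  show "chart_hom f = 0"
  proof (rule laurent_eq_0I)
    fix s :: "'k \<times> 'k" assume "fst s \<noteq> 0" "snd s \<noteq> 0"
    then have s: "in_torus s" by simp
    show "torus_eval s (chart_hom f) = 0"
      unfolding peval_chart_pt[OF s, symmetric] by (rule bspec[OF f chart_pt_in_chart[OF s]])
  qed
next
  fix f assume "f \<in> {f. chart_hom f = 0}"
  then have f: "chart_hom f = 0" by simp
  define d where "d = (\<Sum>m\<in>Poly_Mapping.keys f. pluecker_degree m)"
  have dm: "pluecker_degree m \<le> d" if "m \<in> Poly_Mapping.keys f" for m
    unfolding d_def by (rule member_le_sum) (use that in auto)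
  define hm where "hm m = m + Poly_Mapping.single (Inr (i, j)) (d - pluecker_degree m)" for m :: "'n + 'n \<times> 'n \<Rightarrow>\<^sub>0 nat"
  define F where "F = (\<Sum>m\<in>Poly_Mapping.keys f. Poly_Mapping.single (hm m) (Poly_Mapping.lookup f m))"
  have hom: "pluecker_homogeneous F"
    unfolding pluecker_homogeneous_def
  proof (intro exI[of _ d] ballI)
    fix m' assume "m' \<in> Poly_Mapping.keys F"
    moreover have "Poly_Mapping.keys F \<subseteq> hm ` Poly_Mapping.keys f"
      unfolding F_def by (rule order_trans[OF keys_sum]) auto
    ultimately obtain m where m: "m \<in> Poly_Mapping.keys f" "m' = hm m" by auto
    have "(\<Sum>kl\<in>UNIV. Poly_Mapping.lookup (Poly_Mapping.single (Inr (i, j)) n) (Inr kl :: 'n + 'n \<times> 'n)) = n" for n :: nat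
    proof -
      have "Poly_Mapping.lookup (Poly_Mapping.single (Inr (i, j)) n) (Inr kl :: 'n + 'n \<times> 'n) = (if kl = (i, j) then n else 0)" for kl
        by (auto simp: lookup_single when_def)
      then show ?thesis by simp
    qed
    then show "(\<Sum>ij\<in>UNIV. Poly_Mapping.lookup m' (Inr ij)) = d"
      using dm[OF m(1)] by (simp add: m(2) hm_def lookup_add sum.distrib pluecker_degree_def)
  qed
  have val: "peval F (join_coords x p) = peval f (join_coords x p)" if "p $ (i, j) = 1" for x and p :: "'k ^ ('n \<times> 'n)"
    unfolding F_def peval_simps
    by (simp add: hm_def mono_val_add mono_val_single join_coords_def that peval_lin_ext lin_ext_def)
  obtain e where e: "\<And>x p c. peval F (join_coords x (c *s p)) = c ^ e * peval F (join_coords x p)"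
    using homogeneous_scale[OF hom] by blast
  have tor: "peval F (join_coords (torus_pt \<gamma> s) (torus_pluecker \<gamma> s)) = 0" if s: "in_torus s" for s
  proof -
    let ?c = "torus_pluecker \<gamma> s $ (i, j)"
    have "peval F (chart_pt s) = peval f (chart_pt s)"
      unfolding chart_pt_def by (rule val) (simp add: torus_pluecker_ij[OF s])
    also have "\<dots> = 0" by (simp add: peval_chart_pt[OF s] f)
    finally have "inverse ?c ^ e * peval F (join_coords (torus_pt \<gamma> s) (torus_pluecker \<gamma> s)) = 0"
      unfolding chart_pt_def e .
    then show ?thesis using torus_pluecker_ij[OF s] by simp
  qed
  have "peval f y = 0" if y: "y \<in> Z" for y
  proof -
    obtain x W p where p: "y = join_coords x p" "(x, W) \<in> nash_blowup V" "pluecker W p" "p $ (i, j) = 1"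
      using y unfolding affine_chart_def by blast
    show ?thesis using vanishing_on_nash[OF hom tor p(2,3)] val[OF p(4)] p(1) by simp
  qed
  then show "f \<in> vanishing_ideal Z" by (simp add: vanishing_ideal_def)
qed

abbreviation "S \<equiv> monoid_span gens"

lemma range_chart_hom: "range chart_hom = supported S"
proof
  note sup = supported_simps[OF monoid_span_submonoid[of gens]]
  have coord: "chart_coord t \<in> supported S" for t
  proof (cases t)
    case (Inl l)
    then show ?thesis by (auto simp: chart_coord_def gens intro!: supported_single monoid_span_base)
  next
    case (Inr kl)
    show ?thesis
    proof (cases "of_int (det2 (\<gamma> (fst kl)) (\<gamma> (snd kl))) = (0 :: 'k)")
      case True then show ?thesis by (simp add: Inr chart_coord_def sup)
    next
      case False
      then have "\<gamma> (fst kl) + \<gamma> (snd kl) - \<gamma> i - \<gamma> j \<in> gens"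
        unfolding gens by (intro UnI2 CollectI exI conjI) (rule refl)
      then show ?thesis by (auto simp: Inr chart_coord_def intro!: supported_single monoid_span_base)
    qed
  qed
  have pow: "F ^ n \<in> supported S" if "F \<in> supported S" for F :: "'k laurent" and n
    by (induction n) (auto intro!: sup that)
  have prod: "prod f A \<in> supported S" if "\<And>t. f t \<in> supported S" for f :: "'n + 'n \<times> 'n \<Rightarrow> 'k laurent" and A
    by (induction A rule: infinite_finite_induct) (auto intro!: sup that)
  have "chart_hom f \<in> supported S" for f
  proof (induction f rule: pm_induct)
    case zero then show ?case by (simp add: chart_hom_def sup)
  next
    case (single m c)
    have "subst_poly chart_coord m \<in> supported S" unfolding subst_poly_def by (rule prod) (rule pow[OF coord])
    moreover have "lconst c \<in> supported S" by (rule supported_single) (rule monoid_span.zero)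
    ultimately show ?case using sup by (simp add: chart_hom_simps)
  qed (simp add: chart_hom_simps sup)
  then show "range chart_hom \<subseteq> supported S" by blast
  have gen: "\<exists>f. chart_hom f = lmono g" if "g \<in> gens" for g
    using that unfolding gens
  proof
    assume "g \<in> range \<gamma>"
    then obtain l where "g = \<gamma> l" by blast
    then have "chart_hom (Poly_Mapping.single (Poly_Mapping.single (Inl l) 1) 1) = lmono g"
      by (simp add: chart_hom_simps subst_poly_single chart_coord_def)
    then show ?thesis by blast
  next
    assume "g \<in> {\<gamma> k + \<gamma> l - \<gamma> i - \<gamma> j | k l. of_int (det2 (\<gamma> k) (\<gamma> l)) \<noteq> (0 :: 'k)}"
    then obtain k l where kl: "g = \<gamma> k + \<gamma> l - \<gamma> i - \<gamma> j" "of_int (det2 (\<gamma> k) (\<gamma> l)) \<noteq> (0 :: 'k)"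
      by (elim CollectE exE conjE) (rule that)
    let ?c = "of_int (det2 (\<gamma> i) (\<gamma> j)) / of_int (det2 (\<gamma> k) (\<gamma> l)) :: 'k"
    have "chart_hom (Poly_Mapping.single (Poly_Mapping.single (Inr (k, l)) 1) ?c) = lmono g"
      using kl ij by (simp add: chart_hom_simps subst_poly_single chart_coord_def mult_single)
    then show ?thesis by blast
  qed
  have mono: "\<exists>f. chart_hom f = lmono z" if "z \<in> S" for z
    using that
  proof induction
    case zero
    have "chart_hom 1 = lmono 0" by (simp add: chart_hom_simps)
    then show ?case by blast
  next
    case (add g z)
    obtain f1 where f1: "chart_hom f1 = lmono g" using gen[OF add.hyps(1)] by blast
    obtain f2 where f2: "chart_hom f2 = lmono z" using add.IH by blast
    have "chart_hom (f1 * f2) = lmono (g + z)" using f1 f2 by (simp add: chart_hom_simps mult_single)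
    then show ?case by blast
  qed
  have "\<exists>f. chart_hom f = F" if "Poly_Mapping.keys F \<subseteq> S" for F :: "'k laurent"
    using that
  proof (induction F rule: pm_induct_on)
    case zero
    show ?case by (intro exI[of _ 0]) (simp add: chart_hom_def)
  next
    case (single z c)
    then obtain f where "chart_hom f = lmono z" using mono by blast
    then have "chart_hom (Poly_Mapping.single 0 c * f) = Poly_Mapping.single z c"
      by (simp add: chart_hom_simps mult_single) (simp add: subst_poly_def mult_single)
    then show ?case by blast
  next
    case (add F G)
    then obtain f g where "chart_hom f = F" "chart_hom g = G" by blast
    then have "chart_hom (f + g) = F + G" by (simp add: chart_hom_simps)
    then show ?case by blast
  qed
  then show "supported S \<subseteq> range chart_hom" unfolding supported_def by (metis (mono_tags, lifting) mem_Collect_eq rangeI subsetI)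
qed

lemma zmult_S: "z \<in> S \<Longrightarrow> zmult n z \<in> S"
  by (induction n) (auto simp: monoid_span.zero monoid_span_plus)

lemma gamma_S: "\<gamma> k \<in> S"
  by (rule monoid_span_base) (simp add: gens)

text \<open>Every lattice point is a difference of two elements of \<open>S\<close>, because \<open>S\<close> contains a lattice basis.  It
follows that the function field of the chart is that of the torus.\<close>

lemma S_group: "\<exists>b\<in>S. z + b \<in> S"
proof -
  define \<delta> where "\<delta> = det2 (\<gamma> i0) (\<gamma> j0)"
  have dd: "\<delta> * \<delta> = 1" using basis unfolding \<delta>_def[symmetric] by (metis abs_mult_self_eq mult_1)
  define p where "p = \<delta> * det2 z (\<gamma> j0)"
  define q where "q = \<delta> * det2 (\<gamma> i0) z"
  have "p * fst (\<gamma> i0) + q * fst (\<gamma> j0) = \<delta> * (\<delta> * fst z)" "p * snd (\<gamma> i0) + q * snd (\<gamma> j0) = \<delta> * (\<delta> * snd z)"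
    unfolding p_def q_def unfolding \<delta>_def det2_def by (simp_all add: algebra_simps)
  then have z: "fst z = p * fst (\<gamma> i0) + q * fst (\<gamma> j0)" "snd z = p * snd (\<gamma> i0) + q * snd (\<gamma> j0)"
    using dd by (simp_all flip: mult.assoc)
  let ?b = "zmult (nat (- p)) (\<gamma> i0) + zmult (nat (- q)) (\<gamma> j0)"
  have n: "int (nat p) = p + int (nat (- p))" "int (nat q) = q + int (nat (- q))" by simp_all
  have "z + ?b = zmult (nat p) (\<gamma> i0) + zmult (nat q) (\<gamma> j0)"
    unfolding prod_eq_iff zmult_def fst_add snd_add fst_conv snd_conv n z by (simp add: algebra_simps)
  moreover have "?b \<in> S" "zmult (nat p) (\<gamma> i0) + zmult (nat q) (\<gamma> j0) \<in> S"
    by (intro monoid_span_plus zmult_S gamma_S)+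
  ultimately show ?thesis by metis
qed

lemma S_group_finite: "finite K \<Longrightarrow> \<exists>b\<in>S. \<forall>z\<in>K. z + b \<in> S"
proof (induction K rule: finite_induct)
  case empty then show ?case using monoid_span.zero by blast
next
  case (insert x K)
  then obtain b where b: "b \<in> S" "\<forall>z\<in>K. z + b \<in> S" by blast
  obtain b' where b': "b' \<in> S" "x + b' \<in> S" using S_group by blast
  have "x + (b + b') \<in> S" using monoid_span_plus[OF b'(2) b(1)] by (simp add: add_ac)
  moreover have "z + (b + b') \<in> S" if "z \<in> K" for z
    using monoid_span_plus[OF bspec[OF b(2) that] b'(1)] by (simp add: add_ac)
  ultimately show ?case using monoid_span_plus[OF b(1) b'(1)] by blast
qed

definition chart_fun :: "('k, 'n + 'n \<times> 'n) mpoly \<Rightarrow> 'k rat_fun" where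
  "chart_fun f = emb (chart_hom f)"

lemma chart_model: "function_field_model chart_fun"
proof
  show "chart_fun (x + y) = chart_fun x + chart_fun y" for x y by (simp add: chart_fun_def chart_hom_simps emb_simps)
  show "chart_fun (x * y) = chart_fun x * chart_fun y" for x y by (simp add: chart_fun_def chart_hom_simps emb_simps)
  show "chart_fun 1 = 1" by (simp add: chart_fun_def chart_hom_simps emb_simps)
  show "\<exists>a b. chart_fun b \<noteq> 0 \<and> chart_fun a = z * chart_fun b" for z
  proof -
    obtain a b where ab: "z = to_fract a / to_fract b" "b \<noteq> 0" by (rule obtain_fraction)
    have emb: "\<exists>F. emb F = to_fract p" for p :: "'k poly poly"
      using var_shift_in_range[of p "to_fract p" 0] by auto
    obtain F G where FG: "emb F = to_fract a" "emb G = to_fract b" using emb by metis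
    obtain w where w: "\<forall>z\<in>Poly_Mapping.keys F \<union> Poly_Mapping.keys G. z + w \<in> S"
      using S_group_finite[of "Poly_Mapping.keys F \<union> Poly_Mapping.keys G"] by auto
    have sh: "H * lmono w \<in> range chart_hom" if "Poly_Mapping.keys H \<subseteq> Poly_Mapping.keys F \<union> Poly_Mapping.keys G" for H
      unfolding range_chart_hom supported_def mem_Collect_eq
      by (rule keys_mult_subset) (use w that in auto)
    obtain f where f: "chart_hom f = F * lmono w" using sh[of F] by auto
    obtain g where g: "chart_hom g = G * lmono w" using sh[of G] by auto
    have w0: "emb (lmono w :: 'k laurent) \<noteq> 0" by (simp add: emb_single emb.h_one tpow_nonzero)
    have "chart_fun g \<noteq> 0" using ab(2) FG(2) w0 by (simp add: chart_fun_def g emb_simps)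
    moreover have "chart_fun f = z * chart_fun g"
      using ab by (simp add: chart_fun_def f g emb_simps FG)
    ultimately show ?thesis by blast
  qed
qed

text \<open>The linear forms \<open>E1\<close> and \<open>E2\<close> bound the exponents of integral elements (\<open>integral_exponents_ge\<close>); within
these bounds, saturation makes monomials integral (\<open>saturation_integral\<close>).\<close>

theorem chart_smooth_iff:
  fixes E1 E2 :: "int \<times> int \<Rightarrow> int"
  assumes E: "\<And>z w. E1 (z + w) = E1 z + E1 w" "\<And>z w. E2 (z + w) = E2 z + E2 w"
    and SE: "\<And>z. z \<in> gens \<Longrightarrow> 0 \<le> E1 z \<and> 0 \<le> E2 z"
    and M: "M = {z. 0 \<le> E1 z \<and> 0 \<le> E2 z}"
    and sat: "\<And>z. z \<in> M \<Longrightarrow> \<exists>n>0. zmult n z \<in> S"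
  shows "smooth_normalization Z \<longleftrightarrow>
    (\<forall>m. maximal_in (supported M) m \<longrightarrow> cotangent_basis_in (range (lconst :: 'k \<Rightarrow> _)) m)"
proof (rule smooth_normalization_iff[OF chart_model])
  show "vanishing_ideal Z = {f. chart_fun f = 0}"
    unfolding vanishing_ideal_chart chart_fun_def using emb_eq_0 by auto
  show "chart_fun (Poly_Mapping.single 0 c) = const_fun c" for c
    by (simp add: chart_fun_def chart_hom_simps emb_single subst_poly_def)
  have E0: "E1 0 = 0" "E2 0 = 0" using E(1)[of 0 0] E(2)[of 0 0] by simp_all
  show "add_submonoid M" unfolding add_submonoid_def M using E E0 by auto
  have S_ge: "0 \<le> E1 z \<and> 0 \<le> E2 z" if "z \<in> S" for z
    using that by induction (use E E0 SE in \<open>auto simp: add_nonneg_nonneg\<close>)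
  have rng: "range chart_fun = emb ` supported S"
    unfolding chart_fun_def range_chart_hom[symmetric] by (auto simp: image_image)
  show "{z. integral_over (range chart_fun) z} = emb ` supported M"
  proof (intro equalityI subsetI CollectI)
    fix z :: "'k rat_fun" assume "z \<in> emb ` supported M"
    then obtain F where F: "F \<in> supported M" "z = emb F" by blast
    show "integral_over (range chart_fun) z"
      unfolding rng F(2) by (rule saturation_integral[OF monoid_span_submonoid])
        (use F(1) sat in \<open>auto simp: supported_def\<close>)
  next
    fix z assume "z \<in> {z. integral_over (range chart_fun) z}"
    then obtain n c where c: "\<And>i. i < n \<Longrightarrow> c i \<in> emb ` supported S" and zn: "z ^ n = (\<Sum>i<n. c i * z ^ i)"
      unfolding integral_over_def rng by blast
    have "\<And>i. i < n \<Longrightarrow> c i \<in> range emb" using c by auto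
    then have "integral_over (range emb) z" using zn unfolding integral_over_def
      by (intro exI[of _ n] exI[of _ c]) simp
    then obtain F where F: "z = emb F" using laurent_integrally_closed by blast
    have "\<forall>i. \<exists>C. i < n \<longrightarrow> C \<in> supported S \<and> c i = emb C" using c by blast
    then obtain C where C: "\<And>i. i < n \<Longrightarrow> C i \<in> supported S \<and> c i = emb (C i)" by metis
    have "emb (F ^ n) = emb (\<Sum>i<n. C i * F ^ i)"
      using zn C by (simp add: emb_simps F)
    then have eq: "F ^ n = (\<Sum>i<n. C i * F ^ i)" by (simp only: emb_eq_iff)
    have "Poly_Mapping.keys F \<subseteq> {m. 0 \<le> E1 m}"
      by (rule integral_exponents_ge[OF E(1) _ eq]) (use C S_ge in \<open>auto simp: supported_def\<close>)
    moreover have "Poly_Mapping.keys F \<subseteq> {m. 0 \<le> E2 m}"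
      by (rule integral_exponents_ge[OF E(2) _ eq]) (use C S_ge in \<open>auto simp: supported_def\<close>)
    ultimately have "F \<in> supported M" unfolding supported_def M by auto
    then show "z \<in> emb ` supported M" using F by blast
  qed
qed

end

section \<open>Changing lattice coordinates\<close>

definition smul :: "int \<Rightarrow> int \<times> int \<Rightarrow> int \<times> int" where
  "smul k z = (k * fst z, k * snd z)"

lemma zmult_smul: "zmult n z = smul (int n) z"
  by (simp add: zmult_def smul_def)

definition lin2 :: "int \<Rightarrow> int \<Rightarrow> int \<Rightarrow> int \<Rightarrow> int \<times> int \<Rightarrow> int \<times> int" where
  "lin2 a b c d z = (a * fst z + b * snd z, c * fst z + d * snd z)"

lemma lin2_add: "lin2 a b c d (z + w) = lin2 a b c d z + lin2 a b c d w"
  and lin2_diff: "lin2 a b c d (z - w) = lin2 a b c d z - lin2 a b c d w"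
  and lin2_zmult: "lin2 a b c d (zmult n z) = zmult n (lin2 a b c d z)"
  and lin2_zero [simp]: "lin2 a b c d 0 = 0"
  and det2_lin2: "det2 (lin2 a b c d z) (lin2 a b c d w) = (a * d - b * c) * det2 z w"
  by (auto simp: lin2_def zmult_def det2_def algebra_simps prod_eq_iff)

lemma lin2_bij:
  assumes "\<bar>a * d - b * c\<bar> = 1"
  shows "bij (lin2 a b c d)"
proof -
  define \<delta> where "\<delta> = a * d - b * c"
  have dd: "\<delta> * \<delta> = 1" using assms unfolding \<delta>_def[symmetric] by (metis abs_mult_self_eq mult_1)
  define g where "g = lin2 (\<delta> * d) (- \<delta> * b) (- \<delta> * c) (\<delta> * a)"
  have "g (lin2 a b c d z) = smul (\<delta> * \<delta>) z" "lin2 a b c d (g z) = smul (\<delta> * \<delta>) z" for z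
    unfolding g_def lin2_def smul_def by (simp_all add: \<delta>_def algebra_simps)
  then have "g (lin2 a b c d z) = z" "lin2 a b c d (g z) = z" for z
    by (simp_all add: dd smul_def)
  then show ?thesis by (intro o_bij[of g]) auto
qed

lemma toric_weight_lin2: "toric_weight (\<lambda>k. lin2 a b c d (\<gamma> k)) m = lin2 a b c d (toric_weight \<gamma> m)"
  by (simp add: prod_eq_iff toric_weight_coords lin2_def sum.distrib sum_distrib_left algebra_simps)

lemma lookup_toric_hom:
  "Poly_Mapping.lookup (toric_hom \<gamma> f) z =
     (\<Sum>m\<in>Poly_Mapping.keys f. if toric_weight \<gamma> m = z then Poly_Mapping.lookup f m else 0)"
  unfolding toric_hom_def lookup_sum by (rule sum.cong) (auto simp: lookup_single when_def)

text \<open>A unimodular map renames the exponents of Laurent monomials, so that the same relations hold between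
the generators.\<close>

lemma toric_surface_lin2:
  fixes \<gamma> :: "'n::finite \<Rightarrow> int \<times> int"
  assumes "\<bar>a * d - b * c\<bar> = 1"
  shows "(toric_surface (\<lambda>k. lin2 a b c d (\<gamma> k)) :: ('k::field ^ 'n) set) = toric_surface \<gamma>"
proof -
  note bij = lin2_bij[OF assms]
  have "toric_hom (\<lambda>k. lin2 a b c d (\<gamma> k)) f = 0 \<longleftrightarrow> toric_hom \<gamma> f = 0" for f :: "('k, 'n) mpoly"
  proof -
    have lk: "Poly_Mapping.lookup (toric_hom (\<lambda>k. lin2 a b c d (\<gamma> k)) f) (lin2 a b c d z) = Poly_Mapping.lookup (toric_hom \<gamma> f) z" for z
      unfolding lookup_toric_hom toric_weight_lin2 using bij_is_inj[OF bij] by (simp add: inj_eq)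
    show ?thesis
    proof
      assume "toric_hom (\<lambda>k. lin2 a b c d (\<gamma> k)) f = 0"
      then show "toric_hom \<gamma> f = 0" by (intro poly_mapping_eqI) (simp add: lk[symmetric])
    next
      assume 0: "toric_hom \<gamma> f = 0"
      show "toric_hom (\<lambda>k. lin2 a b c d (\<gamma> k)) f = 0"
      proof (rule poly_mapping_eqI)
        fix z
        obtain z' where "z = lin2 a b c d z'" using bij_is_surj[OF bij] by (metis surjE)
        then show "Poly_Mapping.lookup (toric_hom (\<lambda>k. lin2 a b c d (\<gamma> k)) f) z = Poly_Mapping.lookup 0 z"
          using 0 by (simp add: lk)
      qed
    qed
  qed
  then show ?thesis unfolding toric_surface_def by simp
qed

lemma det2_simps:
  "det2 (a + b) c = det2 a c + det2 b c" "det2 a (b + c) = det2 a b + det2 a c"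
  "det2 (a - b) c = det2 a c - det2 b c" "det2 a (b - c) = det2 a b - det2 a c"
  "det2 (smul k a) b = k * det2 a b" "det2 a (smul k b) = k * det2 a b"
  "det2 a a = 0" "det2 0 a = 0" "det2 a 0 = 0" "det2 (- a) b = - det2 a b" "det2 a (- b) = - det2 a b"
  by (auto simp: det2_def smul_def algebra_simps)

lemma det2_swap: "det2 b a = - det2 a b" by (simp add: det2_def)

lemma cramer2: "smul (det2 l r) z = smul (det2 z r) l + smul (det2 l z) r"
  by (auto simp: det2_def smul_def algebra_simps prod_eq_iff)

lemma smul_simps [simp]: "smul 1 z = z" "smul 0 z = 0" "smul k 0 = 0" "smul (- 1) z = - z"
  by (auto simp: smul_def prod_eq_iff)

lemma smul_distrib: "smul k (z + w) = smul k z + smul k w" "smul (k + l) z = smul k z + smul l z"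
  "smul k (smul l z) = smul (k * l) z" "smul (k - l) z = smul k z - smul l z"
  by (auto simp: smul_def algebra_simps prod_eq_iff)

lemma smul_eq_0: "smul k z = 0 \<longleftrightarrow> k = 0 \<or> z = 0"
  by (auto simp: smul_def prod_eq_iff)

definition saturation :: "(int \<times> int) set \<Rightarrow> (int \<times> int) set" where
  "saturation S = {z. \<exists>n>0. zmult n z \<in> S}"

lemma saturation_smul_iff: "z \<in> saturation S \<longleftrightarrow> (\<exists>n>0. smul n z \<in> S)"
proof
  assume "\<exists>n>0. smul n z \<in> S"
  then obtain n where "n > 0" "smul n z \<in> S" by blast
  then show "z \<in> saturation S" unfolding saturation_def zmult_smul
    by (intro CollectI exI[of _ "nat n"]) simp
next
  assume "z \<in> saturation S"
  then obtain n where "n > 0" "zmult n z \<in> S" unfolding saturation_def by blast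
  then show "\<exists>n>0. smul n z \<in> S" unfolding zmult_smul by (intro exI[of _ "int n"]) simp
qed

lemma span_smul: "z \<in> monoid_span G \<Longrightarrow> 0 \<le> k \<Longrightarrow> smul k z \<in> monoid_span G"
proof -
  assume z: "z \<in> monoid_span G" "0 \<le> k"
  have "zmult n z \<in> monoid_span G" for n
    by (induction n) (auto simp: z monoid_span.zero monoid_span_plus)
  from this[of "nat k"] z(2) show ?thesis by (simp add: zmult_smul)
qed

lemma saturation_base: "z \<in> S \<Longrightarrow> z \<in> saturation S"
  unfolding saturation_smul_iff by (intro exI[of _ 1]) simp

lemma saturation_plus:
  assumes "a \<in> saturation (monoid_span G)" "b \<in> saturation (monoid_span G)"
  shows "a + b \<in> saturation (monoid_span G)"
proof -
  obtain n where n: "n > 0" "smul n a \<in> monoid_span G" using assms(1) unfolding saturation_smul_iff by blast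
  obtain m where m: "m > 0" "smul m b \<in> monoid_span G" using assms(2) unfolding saturation_smul_iff by blast
  have "smul m (smul n a) + smul n (smul m b) \<in> monoid_span G"
    by (rule monoid_span_plus; rule span_smul) (use n m in auto)
  then have "smul (m * n) (a + b) \<in> monoid_span G" by (simp add: smul_distrib mult.commute)
  then show ?thesis unfolding saturation_smul_iff using n m by (intro exI[of _ "m * n"]) simp
qed

lemma saturation_smul:
  assumes "a \<in> saturation (monoid_span G)" "0 \<le> k"
  shows "smul k a \<in> saturation (monoid_span G)"
proof -
  obtain n where n: "n > 0" "smul n a \<in> monoid_span G" using assms(1) unfolding saturation_smul_iff by blast
  have "smul k (smul n a) \<in> monoid_span G" using span_smul n assms(2) by blast
  then show ?thesis unfolding saturation_smul_iff using n by (intro exI[of _ n]) (simp add: smul_distrib mult.commute)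
qed

lemma saturation_root:
  assumes "smul k a \<in> saturation S" "0 < k"
  shows "a \<in> saturation S"
proof -
  obtain n where n: "n > 0" "smul n (smul k a) \<in> S" using assms(1) unfolding saturation_smul_iff by blast
  then show ?thesis unfolding saturation_smul_iff using assms(2)
    by (intro exI[of _ "n * k"]) (simp add: smul_distrib)
qed

section \<open>Smoothness of a chart in terms of its exponents\<close>

context toric_nash_chart
begin

abbreviation "T \<equiv> saturation S"

text \<open>In the coordinates given by the lattice basis \<open>l\<close>, \<open>r\<close> the saturation is a quadrant, a half plane or the plane;
the flags are those of \<open>quadrant\<close>.\<close>

lemma smooth_if_quadrant:
  assumes lr: "det2 l r = 1"
    and gens_in: "\<And>g. g \<in> gens \<Longrightarrow> (u1 \<or> 0 \<le> det2 g r) \<and> (u2 \<or> 0 \<le> det2 l g)"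
    and sat: "\<And>z. (u1 \<or> 0 \<le> det2 z r) \<and> (u2 \<or> 0 \<le> det2 l z) \<Longrightarrow> z \<in> T"
  shows "smooth_normalization Z"
proof -
  \<comment> \<open>coordinates with respect to the lattice basis \<open>l\<close>, \<open>r\<close>\<close>
  define A where "A = lin2 (snd r) (- fst r) (- snd l) (fst l)"
  have A_eq: "A z = (det2 z r, det2 l z)" for z by (simp add: A_def lin2_def det2_def)
  have Adet: "snd r * fst l - (- fst r) * (- snd l) = 1" using lr by (simp add: det2_def algebra_simps)
  have det_A: "det2 (A z) (A w) = det2 z w" for z w
    unfolding A_def det2_lin2 Adet by simp
  have A_simps: "A (z + w) = A z + A w" "A (z - w) = A z - A w" "A (zmult n z) = zmult n (A z)" "A 0 = 0" for z w n
    unfolding A_def by (simp_all add: lin2_add lin2_diff lin2_zmult)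
  have A_bij: "bij A" unfolding A_def by (rule lin2_bij) (simp only: Adet abs_one)
  interpret c: toric_nash_chart "\<lambda>k. A (\<gamma> k)" i0 j0 V i j "A ` gens"
  proof
    show "\<bar>det2 (A (\<gamma> i0)) (A (\<gamma> j0))\<bar> = 1" using basis by (simp add: det_A)
    show "V = toric_surface (\<lambda>k. A (\<gamma> k))"
      unfolding V A_def by (rule toric_surface_lin2[symmetric]) (simp only: Adet abs_one)
    show "of_int (det2 (A (\<gamma> i)) (A (\<gamma> j))) \<noteq> (0 :: 'k)" using ij by (simp add: det_A)
    have im: "A ` {f k l | k l. R k l} = {A (f k l) | k l. R k l}" for f and R :: "'n \<Rightarrow> 'n \<Rightarrow> bool" by blast
    show "A ` gens = range (\<lambda>k. A (\<gamma> k)) \<union>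
      {A (\<gamma> k) + A (\<gamma> l) - A (\<gamma> i) - A (\<gamma> j) | k l. of_int (det2 (A (\<gamma> k)) (A (\<gamma> l))) \<noteq> (0 :: 'k)}"
      unfolding gens image_Un image_image im A_simps det_A by (rule refl)
  qed
  have span: "A z \<in> monoid_span (A ` gens)" if "z \<in> S" for z
    using that by induction (auto simp: A_simps intro: monoid_span.intros)
  have "smooth_normalization Z \<longleftrightarrow>
    (\<forall>m. maximal_in (supported (quadrant u1 u2)) m \<longrightarrow> cotangent_basis_in (range (lconst :: 'k \<Rightarrow> _)) m)"
  proof (rule c.chart_smooth_iff[where ?E1.0 = "\<lambda>z. if u1 then 0 else fst z" and ?E2.0 = "\<lambda>z. if u2 then 0 else snd z"])
    show "quadrant u1 u2 = {z. 0 \<le> (if u1 then 0 else fst z) \<and> 0 \<le> (if u2 then 0 else snd z)}"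
      by (auto simp: quadrant_def)
    show "0 \<le> (if u1 then 0 else fst z) \<and> 0 \<le> (if u2 then 0 else snd z)" if "z \<in> A ` gens" for z
      using that gens_in by (auto simp: A_eq)
    show "\<exists>n>0. zmult n z \<in> monoid_span (A ` gens)" if z: "z \<in> quadrant u1 u2" for z
    proof -
      obtain y where y: "z = A y" using bij_is_surj[OF A_bij] by (metis surjE)
      have "y \<in> T" by (rule sat) (use z in \<open>auto simp: y A_eq quadrant_def\<close>)
      then obtain n where "n > 0" "zmult n y \<in> S" unfolding saturation_def by blast
      then show ?thesis using span[of "zmult n y"] by (auto simp: y A_simps)
    qed
  qed auto
  then show ?thesis using quadrant_cotangent_basis by blast
qed

lemma gens_T: "g \<in> gens \<Longrightarrow> g \<in> T"
  by (rule saturation_base[OF monoid_span_base])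

lemma smooth_if_basis:
  assumes "det2 l r = 1" "l \<in> T" "r \<in> T"
    and "\<And>g. g \<in> gens \<Longrightarrow> 0 \<le> det2 g r \<and> 0 \<le> det2 l g"
  shows "smooth_normalization Z"
proof (rule smooth_if_quadrant[OF assms(1), of False False])
  fix z assume z: "(False \<or> 0 \<le> det2 z r) \<and> (False \<or> 0 \<le> det2 l z)"
  have "z = smul (det2 z r) l + smul (det2 l z) r" using cramer2[of l r z] assms(1) by simp
  moreover have "smul (det2 z r) l + smul (det2 l z) r \<in> T"
    using z assms by (intro saturation_plus saturation_smul) auto
  ultimately show "z \<in> T" by simp
qed (use assms(4) in auto)

lemma primitive_extends:
  assumes "z \<noteq> (0 :: int \<times> int)"
  shows "\<exists>k p f. 0 < k \<and> z = smul k p \<and> det2 p f = 1"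
proof -
  define k where "k = gcd (fst z) (snd z)"
  have k: "0 < k" using assms by (simp add: k_def prod_eq_iff)
  obtain a b where ab: "fst z = k * a" "snd z = k * b" "coprime a b"
    unfolding k_def using gcd_coprime_exists[of "fst z" "snd z"] k by (auto simp: k_def mult.commute)
  obtain x y where "x * a + y * b = 1" using bezout_int[of a b] ab(3) by auto
  then have "det2 (a, b) (- y, x) = 1" by (simp add: det2_def algebra_simps)
  moreover have "z = smul k (a, b)" using ab by (simp add: smul_def prod_eq_iff)
  ultimately show ?thesis using k by blast
qed

text \<open>A saturated semigroup of full rank that contains a line is a half plane or the plane.\<close>

lemma smooth_if_line:
  assumes z: "z \<noteq> 0" "z \<in> T" "- z \<in> T"
  shows "smooth_normalization Z"
proof -
  have key: "smooth_normalization Z"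
    if pf: "det2 p f = 1" and p: "p \<in> T" "- p \<in> T" and g: "g \<in> gens" "0 < det2 p g" for p f g
  proof -
    have line: "smul k p \<in> T" for k
    proof (cases "0 \<le> k")
      case True then show ?thesis using saturation_smul p(1) by blast
    next
      case False
      then have "smul (- k) (- p) \<in> T" using saturation_smul p(2) by simp
      moreover have "smul (- k) (- p) = smul k p" by (simp add: smul_def prod_eq_iff)
      ultimately show ?thesis by simp
    qed
    \<comment> \<open>a point on the same side of the line as a generator \<open>h\<close> has a multiple in the span of \<open>h\<close> and the
      line; \<open>\<epsilon> = \<plusminus>1\<close> selects the side\<close>
    have half: "w \<in> T" if h: "h \<in> gens" "0 < det2 p h * \<epsilon>" "0 \<le> det2 p w * \<epsilon>" "\<epsilon> * \<epsilon> = 1" for w h \<epsilon>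
    proof -
      have "smul (det2 p h * \<epsilon>) w = smul \<epsilon> (smul (det2 w h) p) + smul (det2 p w * \<epsilon>) h"
        using cramer2[of p h w] by (metis smul_distrib(1,3) mult.commute)
      moreover have "smul \<epsilon> (smul (det2 w h) p) + smul (det2 p w * \<epsilon>) h \<in> T"
        unfolding smul_distrib(3) by (intro saturation_plus line saturation_smul gens_T h)
      ultimately show ?thesis using saturation_root h(2) by metis
    qed
    show ?thesis
    proof (cases "\<exists>h\<in>gens. det2 p h < 0")
      case True
      then obtain h where h: "h \<in> gens" "det2 p h < 0" by blast
      show ?thesis
      proof (rule smooth_if_quadrant[OF pf, of True True])
        fix w
        show "w \<in> T" using half[OF g(1), of 1 w] half[OF h(1), of "- 1" w] g(2) h(2)
          by (cases "0 \<le> det2 p w") auto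
      qed auto
    next
      case False
      show ?thesis
      proof (rule smooth_if_quadrant[OF pf, of True False])
        fix w assume "(True \<or> 0 \<le> det2 w f) \<and> (False \<or> 0 \<le> det2 p w)"
        then show "w \<in> T" using half[OF g(1), of 1 w] g(2) by auto
      qed (use False in \<open>auto simp: not_less\<close>)
    qed
  qed
  obtain k p f where kp: "0 < k" "z = smul k p" "det2 p f = 1" using primitive_extends[OF z(1)] by blast
  have p: "p \<in> T" using saturation_root[of k p] z(2) kp by simp
  have "smul k (- p) = - z" using kp(2) by (simp add: smul_def prod_eq_iff)
  then have np: "- p \<in> T" using saturation_root[of k "- p"] z(3) kp(1) by simp
  have "\<exists>g\<in>gens. det2 p g \<noteq> 0"
  proof (rule ccontr)
    assume "\<not> ?thesis"
    then have "det2 p (\<gamma> i0) = 0" "det2 p (\<gamma> j0) = 0" by (auto simp: gens)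
    then have "smul (det2 (\<gamma> i0) (\<gamma> j0)) p = 0"
      using cramer2[of "\<gamma> i0" "\<gamma> j0" p] by (simp add: det2_swap[of _ p])
    then have "p = 0" using basis by (auto simp: smul_eq_0)
    then show False using kp(3) by (simp add: det2_simps)
  qed
  then obtain g where g: "g \<in> gens" "det2 p g \<noteq> 0" by blast
  show ?thesis
  proof (cases "0 < det2 p g")
    case True then show ?thesis using key kp(3) p np g by blast
  next
    case False
    then show ?thesis using key[of "- p" "- f" g] kp(3) p np g by (simp add: det2_simps)
  qed
qed

text \<open>An edge vector that is primitive, as witnessed by \<open>s\<close> or \<open>s'\<close>, is irreducible.  If the two do not form a
lattice basis, there is a lattice point of the cone that is not a combination of them, and a smallest such
point is a third irreducible element.\<close>

lemma not_smooth_if_index: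
  assumes D: "2 \<le> det2 l r" and l: "l \<in> T" "det2 l s = 1" and r: "r \<in> T" "det2 s' r = 1"
    and gens_in: "\<And>g. g \<in> gens \<Longrightarrow> 0 \<le> det2 g r \<and> 0 \<le> det2 l g"
  shows "\<not> smooth_normalization Z"
proof -
  define M where "M = {z. 0 \<le> det2 z r \<and> 0 \<le> det2 l z}"
  define E where "E z = det2 z r + det2 l z" for z
  have iff: "smooth_normalization Z \<longleftrightarrow>
    (\<forall>m. maximal_in (supported M) m \<longrightarrow> cotangent_basis_in (range (lconst :: 'k \<Rightarrow> _)) m)"
  proof (rule chart_smooth_iff[where ?E1.0 = "\<lambda>z. det2 z r" and ?E2.0 = "det2 l"])
    fix z assume "z \<in> M"
    then have "smul (det2 z r) l + smul (det2 l z) r \<in> T"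
      by (intro saturation_plus saturation_smul l r) (auto simp: M_def)
    then have "smul (det2 l r) z \<in> T" using cramer2[of l r z] by simp
    then have "z \<in> T" by (rule saturation_root) (use D in simp)
    then show "\<exists>n>0. zmult n z \<in> S" by (simp add: saturation_def)
  qed (use gens_in in \<open>auto simp: M_def det2_simps\<close>)
  have Mmon: "add_submonoid M" by (auto simp: add_submonoid_def M_def det2_simps)
  have Eadd: "E (z + w) = E z + E w" for z w by (simp add: E_def det2_simps)
  have pos: "0 < E z" if "z \<in> M" "z \<noteq> 0" for z
  proof (rule ccontr)
    assume "\<not> 0 < E z"
    then have "det2 z r = 0" "det2 l z = 0" using that(1) by (auto simp: E_def M_def)
    then have "smul (det2 l r) z = 0" using cramer2[of l r z] by simp
    then show False using D that(2) by (auto simp: smul_eq_0)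
  qed
  have lM: "l \<in> M" and rM: "r \<in> M" using D by (auto simp: M_def det2_simps)
  have l0: "l \<noteq> 0" and r0: "r \<noteq> 0" and lr: "l \<noteq> r" using D by (auto simp: det2_simps)
  have irr_l: "irreducible_in M l"
    unfolding irreducible_in_def
  proof (intro conjI ballI impI lM l0)
    fix a b assume ab: "a \<in> M" "b \<in> M" "l = a + b"
    have "det2 l a + det2 l b = 0" by (metis ab(3) det2_simps(2,7))
    then have z: "det2 l a = 0" "det2 l b = 0" using ab by (auto simp: M_def)
    have a: "a = smul (det2 a s) l" and b: "b = smul (det2 b s) l"
      using cramer2[of l s a] cramer2[of l s b] l(2) z by simp_all
    have "det2 a r = det2 a s * det2 l r" "det2 b r = det2 b s * det2 l r"
      by (subst a, simp add: det2_simps) (subst b, simp add: det2_simps)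
    then have "0 \<le> det2 a s" "0 \<le> det2 b s" using ab D by (auto simp: M_def zero_le_mult_iff)
    moreover have "det2 a s + det2 b s = 1" using l(2) unfolding ab(3) det2_simps .
    ultimately have "det2 a s = 0 \<or> det2 b s = 0" by auto
    then show "a = 0 \<or> b = 0" using a b by (metis smul_simps(2))
  qed
  have irr_r: "irreducible_in M r"
    unfolding irreducible_in_def
  proof (intro conjI ballI impI rM r0)
    fix a b assume ab: "a \<in> M" "b \<in> M" "r = a + b"
    have "det2 a r + det2 b r = 0" by (metis ab(3) det2_simps(1,7))
    then have z: "det2 a r = 0" "det2 b r = 0" using ab by (auto simp: M_def)
    have a: "a = smul (det2 s' a) r" and b: "b = smul (det2 s' b) r"
      using cramer2[of s' r a] cramer2[of s' r b] r(2) z by simp_all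
    have "det2 l a = det2 s' a * det2 l r" "det2 l b = det2 s' b * det2 l r"
      by (subst a, simp add: det2_simps) (subst b, simp add: det2_simps)
    then have "0 \<le> det2 s' a" "0 \<le> det2 s' b" using ab D by (auto simp: M_def zero_le_mult_iff)
    moreover have "det2 s' a + det2 s' b = 1" using r(2) unfolding ab(3) det2_simps .
    ultimately have "det2 s' a = 0 \<or> det2 s' b = 0" by auto
    then show "a = 0 \<or> b = 0" using a b by (metis smul_simps(2))
  qed
  define NN where "NN = {smul x l + smul y r | x y. 0 \<le> x \<and> 0 \<le> y}"
  have NN_add: "a + b \<in> NN" if ab: "a \<in> NN" "b \<in> NN" for a b
  proof -
    obtain x y where a: "a = smul x l + smul y r" "0 \<le> x" "0 \<le> y" using ab(1) unfolding NN_def by blast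
    obtain x' y' where b: "b = smul x' l + smul y' r" "0 \<le> x'" "0 \<le> y'" using ab(2) unfolding NN_def by blast
    have "a + b = smul (x + x') l + smul (y + y') r" unfolding a b smul_distrib by simp
    then show ?thesis unfolding NN_def using a b by (intro CollectI exI[of _ "x + x'"] exI[of _ "y + y'"]) simp
  qed
  \<comment> \<open>a point of the cone in the first lattice line next to the edge \<open>l\<close>; combinations of the edge vectors
    have a multiple of \<open>det2 l r \<ge> 2\<close> as their value of \<open>det2 l\<close>\<close>
  define z0 where "z0 = s + smul \<bar>det2 s r\<bar> l"
  have "det2 l z0 = 1" by (simp add: z0_def det2_simps l)
  moreover have "det2 z0 r = det2 s r + \<bar>det2 s r\<bar> * det2 l r" by (simp add: z0_def det2_simps)
  moreover have "\<bar>det2 s r\<bar> * 1 \<le> \<bar>det2 s r\<bar> * det2 l r" using D by (intro mult_left_mono) auto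
  ultimately have z0: "z0 \<in> M" "det2 l z0 = 1" by (auto simp: M_def)
  have "z0 \<notin> NN"
  proof
    assume "z0 \<in> NN"
    then obtain x y where "z0 = smul x l + smul y r" unfolding NN_def by blast
    then have "y * det2 l r = 1" using z0(2) by (simp add: det2_simps)
    then have "det2 l r dvd 1" by (metis dvd_triv_right)
    then show False using D by simp
  qed
  then have ex: "z0 \<in> M \<and> z0 \<notin> NN" using z0 by blast
  define z where "z = arg_min (\<lambda>z. nat (E z)) (\<lambda>z. z \<in> M \<and> z \<notin> NN)"
  have z: "z \<in> M" "z \<notin> NN" and zmin: "\<And>w. w \<in> M \<Longrightarrow> w \<notin> NN \<Longrightarrow> nat (E z) \<le> nat (E w)"
    using arg_min_nat_lemma[of "\<lambda>z. z \<in> M \<and> z \<notin> NN", OF ex, of "\<lambda>z. nat (E z)"] unfolding z_def by blast+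
  have NN0: "0 \<in> NN" "l \<in> NN" "r \<in> NN"
    unfolding NN_def
    by (rule CollectI, rule exI[of _ 0], rule exI[of _ 0], simp)
      (rule CollectI, rule exI[of _ 1], rule exI[of _ 0], simp,
       rule CollectI, rule exI[of _ 0], rule exI[of _ 1], simp)
  have irr_z: "irreducible_in M z"
    unfolding irreducible_in_def
  proof (intro conjI ballI impI z(1))
    show "z \<noteq> 0" using z(2) NN0 by blast
    fix a b assume ab: "a \<in> M" "b \<in> M" "z = a + b"
    show "a = 0 \<or> b = 0"
    proof (rule ccontr)
      assume "\<not> (a = 0 \<or> b = 0)"
      then have "0 < E a" "0 < E b" using pos ab by auto
      then have "nat (E a) < nat (E z)" "nat (E b) < nat (E z)" using Eadd ab(3) by auto
      then have "a \<in> NN" "b \<in> NN" using zmin ab by (meson not_le)+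
      then show False using NN_add z(2) ab(3) by blast
    qed
  qed
  have zlr: "z \<noteq> l" "z \<noteq> r" using z(2) NN0 by auto
  let ?y = "\<lambda>i :: nat. if i = 0 then l else if i = 1 then r else z"
  have "\<exists>m :: 'k laurent set. maximal_in (supported M) m \<and> \<not> cotangent_basis_in (range lconst) m"
  proof (rule three_irreducibles_singular[OF Mmon Eadd pos, of ?y])
    show "inj_on ?y {..<3}"
      using lr zlr by (auto simp: inj_on_def split: if_splits)
  qed (use irr_l irr_r irr_z in auto)
  then show ?thesis unfolding iff by blast
qed

lemma chart_nonempty: "Z \<noteq> {}"
  using chart_pt_in_chart[of "(1, 1)"] by auto

end

section \<open>The boundary points of the cone\<close>

text \<open>Since \<open>c \<ge> 2\<close>, the differences of the sequence do not decrease.\<close>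

lemma convex_recurrence_mono:
  fixes f :: "nat \<Rightarrow> int"
  assumes rec: "\<And>n. Suc n < N \<Longrightarrow> \<exists>c\<ge>2. f (Suc (Suc n)) = c * f (Suc n) - f n"
    and "0 \<le> f 0" "f 0 \<le> f 1"
  shows "n < N \<Longrightarrow> 0 \<le> f n \<and> f n \<le> f (Suc n)"
proof (induction n)
  case (Suc n)
  then have IH: "0 \<le> f n" "f n \<le> f (Suc n)" by auto
  obtain c where c: "c \<ge> 2" "f (Suc (Suc n)) = c * f (Suc n) - f n" using rec Suc.prems by blast
  have "2 * f (Suc n) \<le> c * f (Suc n)" using c IH by (intro mult_right_mono) auto
  then show ?case using c IH by auto
qed (use assms in auto)

lemma convex_recurrence_ge:
  fixes f :: "nat \<Rightarrow> int"
  assumes rec: "\<And>n. Suc n < N \<Longrightarrow> \<exists>c\<ge>2. f (Suc (Suc n)) = c * f (Suc n) - f n"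
    and "0 \<le> f 0" "f 0 \<le> f 1" "1 \<le> n" "n \<le> N"
  shows "f 1 \<le> f n"
  using assms(4,5)
proof (induction n rule: nat_induct_at_least)
  case (Suc n)
  have "f n \<le> f (Suc n)" using convex_recurrence_mono[of N f n, OF rec assms(2,3)] Suc.prems by auto
  then show ?case using Suc by auto
qed simp

text \<open>The points \<open>h\<close> are the lattice points on the compact part of the boundary of the convex hull of the nonzero
lattice points in the cone with edge vectors \<open>h 0\<close> and \<open>h r\<close>.\<close>

locale hilbert_chain =
  fixes h :: "nat \<Rightarrow> int \<times> int" and b :: "nat \<Rightarrow> int" and r :: nat
  assumes r: "2 \<le> r" and basis: "det2 (h 0) (h 1) = 1"
    and b: "1 \<le> i \<Longrightarrow> i < r \<Longrightarrow> 2 \<le> b i"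
    and step: "1 \<le> i \<Longrightarrow> i < r \<Longrightarrow> h (i + 1) = smul (b i) (h i) - h (i - 1)"
begin

definition "lattice_cone = {z. 0 \<le> det2 (h 0) z \<and> 0 \<le> det2 z (h r)}"

lemma adjacent: "i < r \<Longrightarrow> det2 (h i) (h (Suc i)) = 1"
proof (induction i)
  case (Suc i)
  have s: "h (Suc (Suc i)) = smul (b (Suc i)) (h (Suc i)) - h i" using step[of "Suc i"] Suc.prems by simp
  show ?case unfolding s using Suc by (simp add: det2_simps det2_swap[of "h i"])
qed (use basis in simp)

lemma step_forward:
  "i + Suc n < r \<Longrightarrow> h (i + Suc (Suc n)) = smul (b (i + Suc n)) (h (i + Suc n)) - h (i + n)"
  using step[of "i + Suc n"] by simp

lemma step_backward:
  "Suc n < i \<Longrightarrow> i \<le> r \<Longrightarrow> h (i - Suc (Suc n)) = smul (b (i - Suc n)) (h (i - Suc n)) - h (i - n)"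
  using step[of "i - Suc n"] by (simp add: Suc_diff_Suc diff_diff_eq[symmetric])

lemma det_pos:
  assumes "i < j" "j \<le> r"
  shows "1 \<le> det2 (h i) (h j)"
proof -
  let ?f = "\<lambda>n. det2 (h i) (h (i + n))"
  have "?f 1 \<le> ?f (j - i)"
  proof (rule convex_recurrence_ge[of "r - i"])
    fix n assume "Suc n < r - i"
    then show "\<exists>c\<ge>2. ?f (Suc (Suc n)) = c * ?f (Suc n) - ?f n"
      using step_forward[of i n] b[of "i + Suc n"] by (intro exI[of _ "b (i + Suc n)"]) (simp add: det2_simps)
  qed (use assms adjacent[of i] in \<open>auto simp: det2_simps\<close>)
  then show ?thesis using assms adjacent[of i] by simp
qed

text \<open>The linear form \<open>det2 (h (i - 1) - h (i + 1))\<close>.  For the chart with \<open>u = h i + h (i + 1)\<close> and for the one with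
\<open>u = h (i - 1) + h i\<close> its kernel is a side of the cone.  Among the points \<open>h j\<close> it is least at \<open>h i\<close>, where it
equals two; this makes it decisive both for the irreducibility of \<open>h i\<close> and for the sides of the charts.\<close>

definition "E i z = det2 (h (i - 1)) z + det2 z (h (i + 1))"

lemma E_simps: "E i (z + w) = E i z + E i w" "E i (z - w) = E i z - E i w" "E i (smul k z) = k * E i z"
  by (simp_all add: E_def det2_simps algebra_simps)

lemma
  assumes i: "1 \<le> i" "i < r"
  shows E_self: "E i (h i) = 2" and E_Suc: "E i (h (Suc i)) = b i" and E_pred: "E i (h (i - 1)) = b i"
proof -
  have d: "det2 (h (i - 1)) (h i) = 1" "det2 (h i) (h (i + 1)) = 1"
    using adjacent[of "i - 1"] adjacent[of i] i by auto
  then show "E i (h i) = 2" by (simp add: E_def)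
  have "det2 (h (i - 1)) (h (i + 1)) = b i" using d(1) by (simp only: step[OF i] det2_simps)
  then show "E i (h (Suc i)) = b i" "E i (h (i - 1)) = b i" by (simp_all add: E_def det2_simps)
qed

text \<open>Linear forms restricted to the points \<open>h\<close> satisfy the same recurrence, in both directions.\<close>

lemma E_other:
  assumes i: "1 \<le> i" "i < r" and j: "j \<le> r" "j \<noteq> i"
  shows "b i \<le> E i (h j)"
proof (cases "i < j")
  case True
  let ?f = "\<lambda>n. E i (h (i + n))"
  have "?f 1 \<le> ?f (j - i)"
  proof (rule convex_recurrence_ge[of "r - i"])
    fix n assume "Suc n < r - i"
    then show "\<exists>c\<ge>2. ?f (Suc (Suc n)) = c * ?f (Suc n) - ?f n"
      using step_forward[of i n] b[of "i + Suc n"] by (intro exI[of _ "b (i + Suc n)"]) (simp add: E_simps)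
  qed (use True j b[OF i] in \<open>auto simp: E_self[OF i] E_Suc[OF i]\<close>)
  then show ?thesis using True by (simp add: E_Suc[OF i])
next
  case False
  let ?f = "\<lambda>n. E i (h (i - n))"
  have "?f 1 \<le> ?f (i - j)"
  proof (rule convex_recurrence_ge[of i])
    fix n assume n: "Suc n < i"
    then show "\<exists>c\<ge>2. ?f (Suc (Suc n)) = c * ?f (Suc n) - ?f n"
      using step_backward[of n i] b[of "i - Suc n"] i by (intro exI[of _ "b (i - Suc n)"]) (simp add: E_simps)
  qed (use False j b[OF i] in \<open>auto simp: E_self[OF i] E_pred[OF i, simplified]\<close>)
  then show ?thesis using False j by (simp add: E_pred[OF i, simplified])
qed

lemma cone_add: "p \<in> lattice_cone \<Longrightarrow> q \<in> lattice_cone \<Longrightarrow> p + q \<in> lattice_cone"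
  by (simp add: lattice_cone_def det2_simps)

lemma h_in_cone: "j \<le> r \<Longrightarrow> h j \<in> lattice_cone"
  using det_pos[of 0 j] det_pos[of j r] unfolding lattice_cone_def
  by (cases "j = 0"; cases "j = r") (auto simp: det2_simps)

text \<open>The vectors \<open>h 0, \<dots>, h r\<close> subdivide the cone into cones spanned by neighbours, which are lattice bases.\<close>

lemma cone_decomposition:
  assumes z: "z \<in> lattice_cone"
  obtains j x y where "j < r" "0 \<le> x" "0 \<le> y" "z = smul x (h j) + smul y (h (Suc j))"
    "x = det2 z (h (Suc j))" "y = det2 (h j) z"
proof -
  have "\<exists>j<n. 0 \<le> det2 (h j) z \<and> 0 \<le> det2 z (h (Suc j))" if "1 \<le> n" "0 \<le> det2 z (h n)" for n
    using that
  proof (induction n rule: nat_induct_at_least)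
    case base
    then show ?case using z by (auto simp: lattice_cone_def)
  next
    case (Suc n)
    show ?case
    proof (cases "0 \<le> det2 z (h n)")
      case True then show ?thesis using Suc by (meson less_Suc_eq)
    next
      case False
      then have "0 \<le> det2 (h n) z" by (simp add: det2_swap[of "h n" z])
      then show ?thesis using Suc.prems by auto
    qed
  qed
  from this[of r] obtain j where j: "j < r" "0 \<le> det2 (h j) z" "0 \<le> det2 z (h (Suc j))"
    using z r by (auto simp: lattice_cone_def)
  then have "z = smul (det2 z (h (Suc j))) (h j) + smul (det2 (h j) z) (h (Suc j))"
    using cramer2[of "h j" "h (Suc j)" z] adjacent by simp
  then show thesis using j by (intro that) auto
qed

lemma E_bounds:
  assumes i: "1 \<le> i" "i < r" and z: "z \<in> lattice_cone"
  shows "z \<noteq> 0 \<Longrightarrow> 2 \<le> E i z" "det2 (h i) z \<noteq> 0 \<Longrightarrow> b i \<le> E i z"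
proof -
  obtain j x y where d: "j < r" "0 \<le> x" "0 \<le> y" "z = smul x (h j) + smul y (h (Suc j))"
    using cone_decomposition[OF z] by metis
  have Ez: "E i z = x * E i (h j) + y * E i (h (Suc j))" by (simp add: d(4) E_simps)
  have ge2: "2 \<le> E i (h k)" if "k \<le> r" for k
    using E_other[OF i that] E_self[OF i] b[OF i] by (cases "k = i") auto
  have scale: "t \<le> s * e" if "1 \<le> s" "t \<le> e" "0 \<le> e" for s t e :: int
    using mult_right_mono[of 1 s e] that by auto
  have nonneg: "0 \<le> x * E i (h j)" "0 \<le> y * E i (h (Suc j))"
    using d ge2[of j] ge2[of "Suc j"] by auto
  have left: "t \<le> E i z" if "1 \<le> x" "t \<le> E i (h j)" for t
    using scale[OF that] ge2[of j] d nonneg unfolding Ez by auto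
  have right: "t \<le> E i z" if "1 \<le> y" "t \<le> E i (h (Suc j))" for t
    using scale[OF that] ge2[of "Suc j"] d nonneg unfolding Ez by auto
  show "2 \<le> E i z" if "z \<noteq> 0"
  proof -
    have "1 \<le> x \<or> 1 \<le> y" using that d by (cases "x = 0"; cases "y = 0") auto
    then show ?thesis using left[of 2] right[of 2] ge2 d by auto
  qed
  show "b i \<le> E i z" if nz: "det2 (h i) z \<noteq> 0"
  proof -
    have "(1 \<le> x \<and> j \<noteq> i) \<or> (1 \<le> y \<and> Suc j \<noteq> i)"
    proof (rule ccontr)
      assume "\<not> ?thesis"
      then have "x = 0 \<or> j = i" "y = 0 \<or> Suc j = i" using d by auto
      then have "det2 (h i) z = 0" using d(4) by (auto simp: det2_simps)
      then show False using nz by simp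
    qed
    then show ?thesis using left[of "b i"] right[of "b i"] E_other[OF i] d by auto
  qed
qed

text \<open>One of two independent vectors does not lie on the ray of \<open>h i\<close>.\<close>

lemma E_pair:
  assumes i: "1 \<le> i" "i < r" and pq: "p \<in> lattice_cone" "q \<in> lattice_cone" "det2 p q \<noteq> 0"
  shows "b i + 2 \<le> E i (p + q)"
proof -
  have "p \<noteq> 0" "q \<noteq> 0" using pq(3) by (auto simp: det2_simps)
  then have ge2: "2 \<le> E i p" "2 \<le> E i q" using E_bounds(1)[OF i] pq by auto
  have "det2 (h i) p \<noteq> 0 \<or> det2 (h i) q \<noteq> 0"
  proof (rule ccontr)
    assume 0: "\<not> ?thesis"
    have "h i \<noteq> 0" using adjacent[of i] i by (auto simp: det2_simps)
    moreover have "smul (det2 p q) (h i) = 0"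
      using cramer2[of p q "h i"] 0 by (simp add: det2_swap[of _ "h i"])
    ultimately show False using pq(3) by (simp add: smul_eq_0)
  qed
  then have "b i \<le> E i p \<or> b i \<le> E i q" using E_bounds(2)[OF i] pq by blast
  then show ?thesis using ge2 by (auto simp: E_simps)
qed

lemma edge_pair:
  assumes pq: "p \<in> lattice_cone" "q \<in> lattice_cone" "det2 p q \<noteq> 0"
  shows "1 \<le> det2 (h 0) (p + q)" "1 \<le> det2 (p + q) (h r)"
proof -
  have "h 0 \<noteq> 0" "h r \<noteq> 0" using det_pos[of 0 r] r by (auto simp: det2_simps)
  have "\<not> (det2 (h 0) p = 0 \<and> det2 (h 0) q = 0)"
    using cramer2[of p q "h 0"] \<open>h 0 \<noteq> 0\<close> pq(3) by (auto simp: smul_eq_0 det2_swap[of _ "h 0"])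
  then show "1 \<le> det2 (h 0) (p + q)" using pq by (auto simp: lattice_cone_def det2_simps)
  have "\<not> (det2 p (h r) = 0 \<and> det2 q (h r) = 0)"
    using cramer2[of p q "h r"] \<open>h r \<noteq> 0\<close> pq(3) by (auto simp: smul_eq_0 det2_swap[of "h r"])
  then show "1 \<le> det2 (p + q) (h r)" using pq by (auto simp: lattice_cone_def det2_simps)
qed

text \<open>An edge vector can only be split along its edge, where its coordinate is one.  In between, nonzero
elements of the cone have \<open>E j \<ge> 2\<close>, while \<open>E j (h j) = 2\<close>.\<close>

lemma chain_irreducible:
  assumes "j \<le> r"
  shows "irreducible_in lattice_cone (h j)"
  unfolding irreducible_in_def
proof (intro conjI ballI impI h_in_cone assms)
  show "h j \<noteq> 0" using adjacent[of j] adjacent[of "j - 1"] assms r by (cases "j < r") (auto simp: det2_simps)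
  fix p q assume pq: "p \<in> lattice_cone" "q \<in> lattice_cone" "h j = p + q"
  consider "j = 0" | "j = r" | "1 \<le> j" "j < r" using assms by linarith
  then show "p = 0 \<or> q = 0"
  proof cases
    case 1
    have pos: "1 \<le> det2 (h 0) (h r)" using det_pos[of 0 r] r by simp
    have "det2 (h 0) p + det2 (h 0) q = 0" using pq(3) 1 by (metis det2_simps(2,7))
    then have z: "det2 (h 0) p = 0" "det2 (h 0) q = 0" using pq by (auto simp: lattice_cone_def)
    have c: "p = smul (det2 p (h 1)) (h 0)" "q = smul (det2 q (h 1)) (h 0)"
      using cramer2[of "h 0" "h 1" p] cramer2[of "h 0" "h 1" q] z basis by simp_all
    then have "det2 p (h r) = det2 p (h 1) * det2 (h 0) (h r)" "det2 q (h r) = det2 q (h 1) * det2 (h 0) (h r)"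
      by (metis det2_simps(5))+
    then have "0 \<le> det2 p (h 1)" "0 \<le> det2 q (h 1)" using pq pos by (auto simp: lattice_cone_def zero_le_mult_iff)
    moreover have "det2 p (h 1) + det2 q (h 1) = 1" using basis pq(3) 1 by (metis det2_simps(1))
    ultimately have "det2 p (h 1) = 0 \<or> det2 q (h 1) = 0" by auto
    then show ?thesis using c by (metis smul_simps(2))
  next
    case 2
    have pos: "1 \<le> det2 (h 0) (h r)" using det_pos[of 0 r] r by simp
    let ?g = "h (r - 1)"
    have g: "det2 ?g (h r) = 1" using adjacent[of "r - 1"] r by simp
    have "det2 p (h r) + det2 q (h r) = 0" using pq(3) 2 by (metis det2_simps(1,7))
    then have z: "det2 p (h r) = 0" "det2 q (h r) = 0" using pq by (auto simp: lattice_cone_def)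
    have c: "p = smul (det2 ?g p) (h r)" "q = smul (det2 ?g q) (h r)"
      using cramer2[of ?g "h r" p] cramer2[of ?g "h r" q] z g by simp_all
    then have "det2 (h 0) p = det2 ?g p * det2 (h 0) (h r)" "det2 (h 0) q = det2 ?g q * det2 (h 0) (h r)"
      by (metis det2_simps(6))+
    then have "0 \<le> det2 ?g p" "0 \<le> det2 ?g q" using pq pos by (auto simp: lattice_cone_def zero_le_mult_iff)
    moreover have "det2 ?g p + det2 ?g q = 1" using g pq(3) 2 by (metis det2_simps(2))
    ultimately have "det2 ?g p = 0 \<or> det2 ?g q = 0" by auto
    then show ?thesis using c by (metis smul_simps(2))
  next
    case 3
    show ?thesis
    proof (rule ccontr)
      assume "\<not> ?thesis"
      then have "2 \<le> E j p" "2 \<le> E j q" using E_bounds(1)[OF 3] pq by auto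
      then show False using E_self[OF 3] unfolding pq(3) E_simps by simp
    qed
  qed
qed

end

lemma irreducible_generator:
  assumes "irreducible_in M z" and "z \<in> monoid_span G" and "M = monoid_span G"
  shows "z \<in> G"
  using assms(2,1)
proof (induction rule: monoid_span.induct)
  case zero then show ?case by (simp add: irreducible_in_def)
next
  case (add g z)
  have "g \<in> M" "z \<in> M" using add.hyps assms(3) monoid_span_base by auto
  then have "g = 0 \<or> z = 0" using add.prems unfolding irreducible_in_def by blast
  then show ?case using add by auto
qed

lemma range_toric_weight: "range (toric_weight \<gamma>) = monoid_span (range \<gamma>)" for \<gamma> :: "'n::finite \<Rightarrow> int \<times> int"
proof (intro equalityI subsetI)
  fix z assume "z \<in> range (toric_weight \<gamma>)"
  then obtain m where z: "z = (\<Sum>i\<in>UNIV. zmult (Poly_Mapping.lookup m i) (\<gamma> i))"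
    by (auto simp: toric_weight_zmult)
  have "(\<Sum>i\<in>A. zmult (Poly_Mapping.lookup m i) (\<gamma> i)) \<in> monoid_span (range \<gamma>)" if "finite A" for A
    using that
    by induction (auto simp: zmult_smul intro!: monoid_span_plus monoid_span.zero span_smul intro: monoid_span_base)
  then show "z \<in> monoid_span (range \<gamma>)" using z by simp
next
  fix z assume "z \<in> monoid_span (range \<gamma>)"
  then show "z \<in> range (toric_weight \<gamma>)"
  proof induction
    case zero
    then show ?case by (intro range_eqI[of _ _ 0]) simp
  next
    case (add g z)
    then obtain k m where km: "g = \<gamma> k" "z = toric_weight \<gamma> m" by blast
    have "toric_weight \<gamma> (Poly_Mapping.single k 1) = \<gamma> k"
      by (simp add: toric_weight_coords lookup_single when_def prod_eq_iff if_distrib if_distribR sum.delta cong: if_cong)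
    then show ?case unfolding km
      by (intro range_eqI[of _ _ "Poly_Mapping.single k 1 + m"]) (simp only: toric_weight_add)
  qed
qed

section \<open>The edges of the charts\<close>

text \<open>The condition for the chart with \<open>u = h j + h (j + 1)\<close>; the first two cases belong to the two edges.\<close>

definition admissible :: "(nat \<Rightarrow> int) \<Rightarrow> nat \<Rightarrow> nat \<Rightarrow> bool" where
  "admissible b r j \<longleftrightarrow>
     (if j = 0 then b 1 = 2
      else if j + 1 = r then b j = 2
      else (b j, b (j + 1)) \<in> {(2, 2), (2, 3), (2, 4), (3, 2), (4, 2)})"

text \<open>For a lattice basis \<open>e\<close>, \<open>f\<close> this gives the coefficients of the primitive vector on the ray of \<open>c e - 2 f\<close>,
as \<open>(x, y)\<close> with the vector \<open>x e - y f\<close>.\<close>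

definition edge_coeff :: "int \<Rightarrow> int \<times> int" where
  "edge_coeff c = (if even c then (c div 2, 1) else (c, 2))"

lemma edge_coeff_multiple:
  "\<exists>k>0. c = k * fst (edge_coeff c) \<and> 2 = k * snd (edge_coeff c)"
proof (cases "even c")
  case True then show ?thesis by (intro exI[of _ 2]) (simp add: edge_coeff_def)
next
  case False then show ?thesis by (intro exI[of _ 1]) (simp add: edge_coeff_def)
qed

lemma edge_coeff_coprime: "\<exists>m n. fst (edge_coeff c) * n + snd (edge_coeff c) * m = 1"
proof (cases "even c")
  case True then show ?thesis by (intro exI[of _ 1] exI[of _ 0]) (simp add: edge_coeff_def)
next
  case False
  then have "c * 1 + 2 * (- (c div 2)) = 1" by presburger
  then show ?thesis using False by (intro exI[of _ "- (c div 2)"] exI[of _ 1]) (simp add: edge_coeff_def)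
qed

text \<open>Here \<open>D\<close> is the determinant of the primitive edge vectors of a chart.  In terms of the halves of \<open>c\<close> and \<open>d\<close> it
is \<open>s t - 1\<close>, or a product of an odd and an arbitrary factor minus two, or a product of odd factors minus
four.\<close>

lemma edge_coeff_pair:
  assumes "2 \<le> c" "2 \<le> d"
  defines "D \<equiv> fst (edge_coeff c) * fst (edge_coeff d) - snd (edge_coeff c) * snd (edge_coeff d)"
  shows "(c, d) \<in> {(2, 3), (2, 4), (3, 2), (4, 2)} \<Longrightarrow> D = 1"
    and "(c, d) \<notin> {(2, 2), (2, 3), (2, 4), (3, 2), (4, 2)} \<Longrightarrow> 2 \<le> D"
proof -
  show "(c, d) \<in> {(2, 3), (2, 4), (3, 2), (4, 2)} \<Longrightarrow> D = 1"
    unfolding D_def edge_coeff_def by auto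
  assume n: "(c, d) \<notin> {(2, 2), (2, 3), (2, 4), (3, 2), (4, 2)}"
  have prod: "x * y \<le> s * t" if "x \<le> s" "y \<le> t" "0 \<le> x" "0 \<le> y" for x y s t :: int
    using mult_mono[of x s y t] that by auto
  consider s t where "c = 2 * s" "d = 2 * t" | s t where "c = 2 * s" "d = 2 * t + 1"
    | s t where "c = 2 * s + 1" "d = 2 * t" | s t where "c = 2 * s + 1" "d = 2 * t + 1"
    by (cases "even c"; cases "even d"; elim evenE oddE) auto
  then show "2 \<le> D"
  proof cases
    case 1
    then have D: "D = s * t - 1" by (simp add: D_def edge_coeff_def)
    have "1 \<le> s" "1 \<le> t" "\<not> (s = 1 \<and> t = 1)" "\<not> (s = 1 \<and> t = 2)" "\<not> (s = 2 \<and> t = 1)"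
      using n assms(1,2) 1 by auto
    then have "(1 \<le> s \<and> 3 \<le> t) \<or> (3 \<le> s \<and> 1 \<le> t) \<or> (2 \<le> s \<and> 2 \<le> t)" by arith
    then show ?thesis using prod[of 1 s 3 t] prod[of 3 s 1 t] prod[of 2 s 2 t] D by auto
  next
    case 2
    then have D: "D = s * (2 * t + 1) - 2" by (simp add: D_def edge_coeff_def)
    have "(1 \<le> s \<and> 5 \<le> 2 * t + 1) \<or> (2 \<le> s \<and> 3 \<le> 2 * t + 1)" using n assms(1,2) 2 by auto
    then show ?thesis using prod[of 1 s 5 "2 * t + 1"] prod[of 2 s 3 "2 * t + 1"] D by auto
  next
    case 3
    then have D: "D = (2 * s + 1) * t - 2" by (simp add: D_def edge_coeff_def)
    have "(1 \<le> t \<and> 5 \<le> 2 * s + 1) \<or> (2 \<le> t \<and> 3 \<le> 2 * s + 1)" using n assms(1,2) 3 by auto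
    then show ?thesis using prod[of 5 "2 * s + 1" 1 t] prod[of 3 "2 * s + 1" 2 t] D by auto
  next
    case 4
    then have D: "D = (2 * s + 1) * (2 * t + 1) - 4" by (simp add: D_def edge_coeff_def)
    have "3 \<le> 2 * s + 1" "3 \<le> 2 * t + 1" using assms(1,2) 4 by auto
    then show ?thesis using prod[of 3 "2 * s + 1" 3 "2 * t + 1"] D by auto
  qed
qed

locale hilbert_chart = toric_nash_chart \<gamma> i0 j0 V i j gens + hilbert_chain h b r
  for \<gamma> :: "'n::finite \<Rightarrow> int \<times> int" and i0 j0 :: 'n and V :: "('k::alg_closed_field ^ 'n) set"
    and i j :: 'n and gens :: "(int \<times> int) set" and h b r +
  assumes gamma_cone: "\<gamma> k \<in> lattice_cone"
    and chain_gamma: "m \<le> r \<Longrightarrow> h m \<in> range \<gamma>"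
begin

definition "u = \<gamma> i + \<gamma> j"
definition "w m = h m + h (Suc m)"

lemma h_gens: "m \<le> r \<Longrightarrow> h m \<in> gens"
  by (simp add: gens chain_gamma)

lemma h_S: "m \<le> r \<Longrightarrow> h m \<in> S"
  by (rule monoid_span_base[OF h_gens])

lemma w_gens: assumes "m < r" shows "w m - u \<in> gens"
proof -
  obtain k l where kl: "h m = \<gamma> k" "h (Suc m) = \<gamma> l" using chain_gamma[of m] chain_gamma[of "Suc m"] assms by auto
  have "of_int (det2 (\<gamma> k) (\<gamma> l)) \<noteq> (0 :: 'k)" using adjacent[OF assms] kl by simp
  then have "\<gamma> k + \<gamma> l - \<gamma> i - \<gamma> j \<in> gens" unfolding gens by (intro UnI2 CollectI exI conjI) auto
  then show ?thesis unfolding w_def u_def kl by (simp add: algebra_simps)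
qed

lemma w_S: "m < r \<Longrightarrow> w m - u \<in> S"
  by (rule monoid_span_base[OF w_gens])

lemma det_ij: "det2 (\<gamma> i) (\<gamma> j) \<noteq> 0"
  using ij by auto

lemma gens_cases:
  assumes "g \<in> gens"
  obtains "g \<in> lattice_cone" | p q where "p \<in> lattice_cone" "q \<in> lattice_cone" "det2 p q \<noteq> 0" "g = p + q - u"
proof -
  have "g \<in> range \<gamma> \<or> (\<exists>k l. g = \<gamma> k + \<gamma> l - \<gamma> i - \<gamma> j \<and> of_int (det2 (\<gamma> k) (\<gamma> l)) \<noteq> (0 :: 'k))"
    using assms by (simp add: gens)
  then consider k where "g = \<gamma> k" | k l where "g = \<gamma> k + \<gamma> l - \<gamma> i - \<gamma> j" "of_int (det2 (\<gamma> k) (\<gamma> l)) \<noteq> (0 :: 'k)"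
    by (elim disjE rangeE exE conjE) auto
  then show thesis
  proof cases
    case 1 then show ?thesis using that(1) gamma_cone by simp
  next
    case 2
    then have "det2 (\<gamma> k) (\<gamma> l) \<noteq> 0" by auto
    then show ?thesis using that(2)[of "\<gamma> k" "\<gamma> l"] gamma_cone 2(1) by (simp add: u_def algebra_simps)
  qed
qed

text \<open>The vectors \<open>w (m - 1) - u\<close> and \<open>w m - u\<close> of \<open>S\<close> point to opposite sides of the ray of \<open>h m\<close>, and adding
multiples of \<open>h m\<close> to the latter gives the negative of the former; \<open>E_pair\<close> says that the required number of
multiples is nonnegative.\<close>

lemma multiple_smooth:
  assumes m: "1 \<le> m" "m < r" and u: "u = smul a (h m)"
  shows "smooth_normalization Z"
proof -
  define x where "x = w (m - 1) - u"
  have "b m + 2 \<le> E m u" unfolding u_def by (rule E_pair[OF m gamma_cone gamma_cone det_ij])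
  then have a: "0 \<le> 2 * a - b m - 2" by (simp add: u E_simps E_self[OF m])
  have s: "h (Suc m) = smul (b m) (h m) - h (m - 1)" using step[OF m] by simp
  have "- x = (w m - u) + smul (2 * a - b m - 2) (h m)"
    using m by (simp add: x_def w_def u s prod_eq_iff smul_def algebra_simps)
  moreover have "\<dots> \<in> S" using m a by (intro monoid_span_plus w_S span_smul h_S) auto
  ultimately have x1: "- x \<in> T" by (simp add: saturation_base)
  have x2: "x \<in> T" using w_S[of "m - 1"] m by (simp add: x_def saturation_base)
  have "det2 x (h m) = 1" using adjacent[of "m - 1"] m by (simp add: x_def w_def u det2_simps)
  then have "x \<noteq> 0" by (auto simp: det2_simps)
  then show ?thesis using x1 x2 smooth_if_line by blast
qed

text \<open>If \<open>u\<close> lies strictly between \<open>h m\<close> and \<open>h (m + 1)\<close>, then \<open>u - w m\<close> is a combination of them and hence in \<open>S\<close>,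
while its negative is a generator.  If \<open>u\<close> is on a ray of the subdivision, \<open>multiple_smooth\<close> applies.\<close>

lemma chart_cases:
  obtains "smooth_normalization Z" | m where "m < r" "u = w m"
proof -
  have uL: "u \<in> lattice_cone" unfolding u_def by (intro cone_add gamma_cone)
  have edge: "1 \<le> det2 (h 0) u" "1 \<le> det2 u (h r)"
    unfolding u_def by (rule edge_pair[OF gamma_cone gamma_cone det_ij])+
  obtain m x y where d: "m < r" "0 \<le> x" "0 \<le> y" "u = smul x (h m) + smul y (h (Suc m))"
    using cone_decomposition[OF uL] by metis
  consider "x = 0" | "y = 0" | "1 \<le> x" "1 \<le> y" using d(2,3) by linarith
  then show thesis
  proof cases
    case 1
    then have "u = smul y (h (Suc m))" using d by simp
    moreover from this have "Suc m \<noteq> r" using edge(2) by (auto simp: det2_simps)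
    ultimately show ?thesis using multiple_smooth[of "Suc m" y] d that(1) by simp
  next
    case 2
    then have "u = smul x (h m)" using d by simp
    moreover from this have "m \<noteq> 0" using edge(1) by (intro notI) (simp add: det2_simps)
    ultimately show ?thesis using multiple_smooth[of m x] d that(1) by simp
  next
    case 3
    show ?thesis
    proof (cases "u = w m")
      case True then show ?thesis using that(2) d by blast
    next
      case False
      have "u - w m = smul (x - 1) (h m) + smul (y - 1) (h (Suc m))"
        by (simp add: d(4) w_def smul_distrib)
      moreover have "\<dots> \<in> S" using 3 d by (intro monoid_span_plus span_smul h_S) auto
      ultimately have "u - w m \<in> T" by (simp add: saturation_base)
      moreover have "- (u - w m) \<in> T" using w_S[OF d(1)] by (simp add: saturation_base)
      ultimately show ?thesis using smooth_if_line[of "u - w m"] False that(1) by simp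
    qed
  qed
qed

context
  fixes m
  assumes m: "m < r" and u: "u = w m"
begin

text \<open>The vector \<open>h (m - 1) - h (m + 1) = w (m - 1) - w m\<close> lies in \<open>S\<close> and spans a side of the cone, because \<open>E m\<close> takes
its least value on sums of two independent generators at \<open>u\<close>.  When \<open>m = 0\<close>, the edge \<open>h 0\<close> of the original cone
remains.\<close>

lemma left_edge:
  defines "xy \<equiv> (if m = 0 then (1, 0) else edge_coeff (b m))"
  defines "l \<equiv> smul (fst xy) (h m) - smul (snd xy) (h (Suc m))"
  shows "l \<in> T" "\<exists>s. det2 l s = 1" "\<And>g. g \<in> gens \<Longrightarrow> 0 \<le> det2 l g"
proof -
  have adj: "det2 (h m) (h (Suc m)) = 1" by (rule adjacent[OF m])
  obtain p q where "fst xy * q + snd xy * p = 1"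
    using edge_coeff_coprime[of "b m"] by (cases "m = 0") (auto simp: xy_def)
  then have "det2 l (smul p (h m) + smul q (h (Suc m))) = 1"
    using adj by (simp add: l_def det2_simps det2_swap[of "h (Suc m)" "h m"] algebra_simps)
  then show "\<exists>s. det2 l s = 1" by blast
  have "l \<in> T \<and> (\<forall>g\<in>gens. 0 \<le> det2 l g)"
  proof (cases "m = 0")
    case True
    then have l: "l = h 0" by (simp add: l_def xy_def)
    have "0 \<le> det2 (h 0) g" if "g \<in> gens" for g
      using that
    proof (cases rule: gens_cases)
      case 1 then show ?thesis by (simp add: lattice_cone_def)
    next
      case (2 p q)
      have "det2 (h 0) u = 1" using adj True by (simp add: u w_def det2_simps)
      then show ?thesis using edge_pair(1)[OF 2(1-3)] by (simp add: 2(4) det2_simps)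
    qed
    then show ?thesis using h_S[of 0] by (simp add: l saturation_base)
  next
    case False
    then have m1: "1 \<le> m" by simp
    have "h (Suc m) = smul (b m) (h m) - h (m - 1)" using step[OF m1 m] by simp
    then have lv: "h (m - 1) - h (Suc m) = smul (b m) (h m) - smul 2 (h (Suc m))"
      by (simp add: smul_def prod_eq_iff algebra_simps)
    obtain k where k: "0 < k" "b m = k * fst xy" "2 = k * snd xy"
      using edge_coeff_multiple[of "b m"] False by (auto simp: xy_def)
    have kl: "smul k l = h (m - 1) - h (Suc m)"
      unfolding lv by (simp only: l_def smul_distrib k(2) k(3)) (simp add: smul_def prod_eq_iff algebra_simps)
    have "h (m - 1) - h (Suc m) = w (m - 1) - u" using m1 by (simp add: u w_def)
    then have "smul k l \<in> T" unfolding kl using w_S[of "m - 1"] m by (simp add: saturation_base)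
    then have "l \<in> T" using saturation_root k(1) by blast
    moreover have "0 \<le> det2 l g" if g: "g \<in> gens" for g
    proof -
      have "k * det2 l g = det2 (h (m - 1) - h (Suc m)) g" by (simp only: kl[symmetric] det2_simps)
      also have "\<dots> = E m g" by (simp add: E_def det2_simps det2_swap[of g])
      finally have kE: "k * det2 l g = E m g" .
      have "0 \<le> E m g" using g
      proof (cases rule: gens_cases)
        case 1 then show ?thesis using E_bounds(1)[OF m1 m 1] by (cases "g = 0") (auto simp: E_def det2_simps)
      next
        case (2 p q)
        have "E m u = b m + 2" by (simp add: u w_def E_simps E_self[OF m1 m] E_Suc[OF m1 m])
        then show ?thesis using E_pair[OF m1 m 2(1-3)] by (simp add: 2(4) E_simps)
      qed
      then show ?thesis using kE k(1) by (metis zero_le_mult_iff not_le)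
    qed
    ultimately show ?thesis by blast
  qed
  then show "l \<in> T" "\<And>g. g \<in> gens \<Longrightarrow> 0 \<le> det2 l g" by blast+
qed

text \<open>The mirror image of \<open>left_edge\<close>.\<close>

lemma right_edge:
  defines "xy \<equiv> (if m + 1 = r then (1, 0) else edge_coeff (b (m + 1)))"
  defines "l \<equiv> smul (fst xy) (h (Suc m)) - smul (snd xy) (h m)"
  shows "l \<in> T" "\<exists>s. det2 s l = 1" "\<And>g. g \<in> gens \<Longrightarrow> 0 \<le> det2 g l"
proof -
  have adj: "det2 (h m) (h (Suc m)) = 1" by (rule adjacent[OF m])
  obtain p q where "fst xy * q + snd xy * p = 1"
    using edge_coeff_coprime[of "b (m + 1)"] by (cases "m + 1 = r") (auto simp: xy_def)
  then have "det2 (smul q (h m) + smul p (h (Suc m))) l = 1"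
    using adj by (simp add: l_def det2_simps det2_swap[of "h (Suc m)" "h m"] algebra_simps)
  then show "\<exists>s. det2 s l = 1" by blast
  have "l \<in> T \<and> (\<forall>g\<in>gens. 0 \<le> det2 g l)"
  proof (cases "m + 1 = r")
    case True
    then have l: "l = h r" by (simp add: l_def xy_def)
    have "0 \<le> det2 g (h r)" if "g \<in> gens" for g
      using that
    proof (cases rule: gens_cases)
      case 1 then show ?thesis by (simp add: lattice_cone_def)
    next
      case (2 p q)
      have "det2 u (h r) = 1" using adj True by (auto simp: u w_def det2_simps)
      then show ?thesis using edge_pair(2)[OF 2(1-3)] by (simp add: 2(4) det2_simps)
    qed
    then show ?thesis using h_S[of r] by (simp add: l saturation_base)
  next
    case False
    then have m1: "1 \<le> Suc m" "Suc m < r" using m by simp_all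
    have "h (Suc (Suc m)) = smul (b (Suc m)) (h (Suc m)) - h m" using step[OF m1] by simp
    then have lv: "h (Suc (Suc m)) - h m = smul (b (Suc m)) (h (Suc m)) - smul 2 (h m)"
      by (simp add: smul_def prod_eq_iff algebra_simps)
    obtain k where k: "0 < k" "b (Suc m) = k * fst xy" "2 = k * snd xy"
      using edge_coeff_multiple[of "b (Suc m)"] False by (auto simp: xy_def)
    have kl: "smul k l = h (Suc (Suc m)) - h m"
      unfolding lv by (simp only: l_def smul_distrib k(2) k(3)) (simp add: smul_def prod_eq_iff algebra_simps)
    have "h (Suc (Suc m)) - h m = w (Suc m) - u" by (simp add: u w_def)
    then have "smul k l \<in> T" unfolding kl using w_S[of "Suc m"] m1 by (simp add: saturation_base)
    then have "l \<in> T" using saturation_root k(1) by blast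
    moreover have "0 \<le> det2 g l" if g: "g \<in> gens" for g
    proof -
      have "k * det2 g l = det2 g (h (Suc (Suc m)) - h m)" by (simp only: kl[symmetric] det2_simps)
      also have "\<dots> = E (Suc m) g" by (simp add: E_def det2_simps det2_swap[of g "h m"])
      finally have kE: "k * det2 g l = E (Suc m) g" .
      have "0 \<le> E (Suc m) g" using g
      proof (cases rule: gens_cases)
        case 1 then show ?thesis using E_bounds(1)[OF m1 1] by (cases "g = 0") (auto simp: E_def det2_simps)
      next
        case (2 p q)
        have "E (Suc m) u = b (Suc m) + 2"
          using E_pred[OF m1] by (simp add: u w_def E_simps E_self[OF m1])
        then show ?thesis using E_pair[OF m1 2(1-3)] by (simp add: 2(4) E_simps)
      qed
      then show ?thesis using kE k(1) by (metis zero_le_mult_iff not_le)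
    qed
    ultimately show ?thesis by blast
  qed
  then show "l \<in> T" "\<And>g. g \<in> gens \<Longrightarrow> 0 \<le> det2 g l" by blast+
qed

text \<open>The determinant of the two primitive edge vectors decides; when it is zero they are opposite and span a line.\<close>

lemma smooth_iff_admissible: "smooth_normalization Z \<longleftrightarrow> admissible b r m"
proof -
  have adj: "det2 (h m) (h (Suc m)) = 1" by (rule adjacent[OF m])
  define xy where "xy = (if m = 0 then (1, 0) else edge_coeff (b m))"
  define st where "st = (if m + 1 = r then (1, 0) else edge_coeff (b (m + 1)))"
  define l where "l = smul (fst xy) (h m) - smul (snd xy) (h (Suc m))"
  define l' where "l' = smul (fst st) (h (Suc m)) - smul (snd st) (h m)"
  note L = left_edge[folded xy_def, folded l_def]
  note R = right_edge[folded st_def, folded l'_def]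
  define D where "D = fst xy * fst st - snd xy * snd st"
  have D: "det2 l l' = D"
    using adj by (simp add: l_def l'_def D_def det2_simps det2_swap[of "h (Suc m)" "h m"] algebra_simps)
  have one: "smooth_normalization Z" if "D = 1"
    using smooth_if_basis[of l l'] L R D that by auto
  have two: "\<not> smooth_normalization Z" if "2 \<le> D"
  proof -
    obtain s s' where "det2 l s = 1" "det2 s' l' = 1" using L(2) R(2) by blast
    then show ?thesis using not_smooth_if_index[of l l' s s'] L R D that by auto
  qed
  have half: "fst (edge_coeff c) = 1 \<longleftrightarrow> c = 2" "c \<noteq> 2 \<Longrightarrow> 2 \<le> fst (edge_coeff c)" if "2 \<le> c" for c
    using that by (auto simp: edge_coeff_def elim!: evenE)
  consider "m = 0" | "m \<noteq> 0" "m + 1 = r" | "m \<noteq> 0" "m + 1 < r" using m by linarith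
  then show ?thesis
  proof cases
    case 1
    then have "D = fst (edge_coeff (b 1))" using r by (simp add: D_def xy_def st_def)
    moreover have "2 \<le> b 1" using b[of 1] r by simp
    ultimately show ?thesis using one two half[of "b 1"] 1 by (auto simp: admissible_def)
  next
    case 2
    then have "D = fst (edge_coeff (b m))" by (simp add: D_def xy_def st_def)
    moreover have "2 \<le> b m" using b[of m] m 2 by simp
    ultimately show ?thesis using one two half[of "b m"] 2 by (auto simp: admissible_def)
  next
    case 3
    then have D': "D = fst (edge_coeff (b m)) * fst (edge_coeff (b (m + 1))) - snd (edge_coeff (b m)) * snd (edge_coeff (b (m + 1)))"
      by (simp add: D_def xy_def st_def)
    have b2: "2 \<le> b m" "2 \<le> b (m + 1)" using b[of m] b[of "m + 1"] 3 m by simp_all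
    note pair = edge_coeff_pair[OF b2, folded D']
    have ok: "admissible b r m \<longleftrightarrow> (b m, b (m + 1)) \<in> {(2, 2), (2, 3), (2, 4), (3, 2), (4, 2)}"
      using 3 by (simp add: admissible_def)
    have line: "smooth_normalization Z" if "b m = 2" "b (m + 1) = 2"
    proof (rule smooth_if_line[OF _ L(1)])
      have "- l = l'" using that 3 by (simp add: l_def l'_def xy_def st_def edge_coeff_def)
      then show "- l \<in> T" using R(1) by simp
      show "l \<noteq> 0" using L(2) by (auto simp: det2_simps)
    qed
    show ?thesis
    proof (cases "admissible b r m")
      case True
      then have "(b m = 2 \<and> b (m + 1) = 2) \<or> (b m, b (m + 1)) \<in> {(2, 3), (2, 4), (3, 2), (4, 2)}"
        unfolding ok by blast
      then show ?thesis using line one pair(1) True by blast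
    next
      case False
      then show ?thesis using two pair(2) ok by blast
    qed
  qed
qed

end

end

text \<open>The points \<open>h m\<close> are irreducible and so occur among the generators.  Their neighbouring pairs provide the
charts that decide; every other nonempty chart has the same sum \<open>u\<close> as one of these, or contains a line.\<close>

theorem (in hilbert_chain) nash_smooth_iff_admissible:
  fixes \<gamma> :: "'n::finite \<Rightarrow> int \<times> int" and V :: "('k::alg_closed_field ^ 'n) set"
  assumes gen: "range (toric_weight \<gamma>) = lattice_cone" and V: "V = toric_surface \<gamma>"
  shows "smooth_normalized_nash_blowup V \<longleftrightarrow> (\<forall>m<r. admissible b r m)"
proof -
  have span: "lattice_cone = monoid_span (range \<gamma>)" using gen range_toric_weight by metis
  have gamma_cone: "\<gamma> k \<in> lattice_cone" for k unfolding span by (rule monoid_span_base) simp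
  have chain_gamma: "h m \<in> range \<gamma>" if "m \<le> r" for m
    by (rule irreducible_generator[OF chain_irreducible[OF that] _ span]) (use h_in_cone[OF that] span in simp)
  then have "\<exists>k. \<gamma> k = h m" if "m \<le> r" for m using that by (metis imageE)
  then obtain idx where idx: "\<gamma> (idx m) = h m" if "m \<le> r" for m by metis
  have nash: "toric_nash \<gamma> (idx 0) (idx 1) V"
    by unfold_locales (use idx[of 0] idx[of 1] basis r V in simp_all)
  have chart: "hilbert_chart \<gamma> (idx 0) (idx 1) V i j (range \<gamma> \<union> {\<gamma> k + \<gamma> l - \<gamma> i - \<gamma> j | k l. of_int (det2 (\<gamma> k) (\<gamma> l)) \<noteq> (0 :: 'k)}) h b r"
    if "of_int (det2 (\<gamma> i) (\<gamma> j)) \<noteq> (0 :: 'k)" for i j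
    unfolding hilbert_chart_def hilbert_chart_axioms_def toric_nash_chart_def toric_nash_chart_axioms_def
    using nash hilbert_chain_axioms that gamma_cone chain_gamma by blast
  show ?thesis
  proof
    assume smooth: "smooth_normalized_nash_blowup V"
    show "\<forall>m<r. admissible b r m"
    proof (intro allI impI)
      fix m assume m: "m < r"
      have e: "\<gamma> (idx m) = h m" "\<gamma> (idx (Suc m)) = h (Suc m)" using idx m by simp_all
      interpret hilbert_chart \<gamma> "idx 0" "idx 1" V "idx m" "idx (Suc m)"
        "range \<gamma> \<union> {\<gamma> k + \<gamma> l - \<gamma> (idx m) - \<gamma> (idx (Suc m)) | k l. of_int (det2 (\<gamma> k) (\<gamma> l)) \<noteq> (0 :: 'k)}" h b r
        by (rule chart) (use adjacent[OF m] e in simp)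
      have "u = w m" by (simp add: u_def w_def e)
      then show "admissible b r m"
        using smooth_iff_admissible[OF m] smooth chart_nonempty unfolding smooth_normalized_nash_blowup_def by blast
    qed
  next
    assume ok: "\<forall>m<r. admissible b r m"
    show "smooth_normalized_nash_blowup V"
      unfolding smooth_normalized_nash_blowup_def
    proof (intro allI impI)
      fix i j assume "affine_chart i j (nash_blowup V) \<noteq> {}"
      then have "of_int (det2 (\<gamma> i) (\<gamma> j)) \<noteq> (0 :: 'k)" using toric_nash.chart_empty[OF nash] by metis
      then interpret hilbert_chart \<gamma> "idx 0" "idx 1" V i j
        "range \<gamma> \<union> {\<gamma> k + \<gamma> l - \<gamma> i - \<gamma> j | k l. of_int (det2 (\<gamma> k) (\<gamma> l)) \<noteq> (0 :: 'k)}" h b r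
        by (rule chart)
      show "smooth_normalization Z"
        using ok smooth_iff_admissible by (cases rule: chart_cases) blast+
    qed
  qed
qed

section \<open>Continued fractions and lattice cones\<close>

fun hull_point :: "(nat \<Rightarrow> int) \<Rightarrow> nat \<Rightarrow> int \<times> int" where
  "hull_point b 0 = (1, 0)"
| "hull_point b (Suc 0) = (1, 1)"
| "hull_point b (Suc (Suc n)) = smul (b (Suc n)) (hull_point b (Suc n)) - hull_point b n"

text \<open>The recursion of \<open>hull_point\<close> with the entries in a list, started from two consecutive points.\<close>

fun hull_steps :: "int \<times> int \<Rightarrow> int \<times> int \<Rightarrow> int list \<Rightarrow> int \<times> int" where
  "hull_steps u v [] = v"
| "hull_steps u v (a # as) = hull_steps v (smul a v - u) as"

lemma hull_steps_hull_point:
  "\<forall>i<length as. as ! i = b (Suc (n + i)) \<Longrightarrow>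
     hull_steps (hull_point b n) (hull_point b (Suc n)) as = hull_point b (Suc (n + length as))"
proof (induction as arbitrary: n)
  case (Cons a as)
  have a: "a = b (Suc n)" using Cons.prems[rule_format, of 0] by simp
  have "as ! i = b (Suc (Suc n + i))" if "i < length as" for i
    using Cons.prems[rule_format, of "Suc i"] that by simp
  then have "hull_steps (hull_point b (Suc n)) (hull_point b (Suc (Suc n))) as = hull_point b (Suc (Suc n + length as))"
    by (intro Cons.IH) simp
  then show ?case by (simp add: a)
qed simp

text \<open>Prepending \<open>a\<close> to a continued fraction with value \<open>N / N'\<close> replaces \<open>(N, N')\<close> by \<open>(a N - N', N)\<close>, and it
changes the coefficients of \<open>v\<close> and \<open>- u\<close> in the same way.\<close>

lemma neg_cfrac_hull_steps:
  assumes "as \<noteq> []" "\<forall>a\<in>set as. 1 < a"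
  shows "\<exists>N N'. coprime N N' \<and> 1 \<le> N' \<and> N' < N \<and> neg_cfrac as = of_int N / of_int N' \<and>
    (\<forall>u v. hull_steps u v as = smul N v - smul N' u)"
  using assms
proof (induction as)
  case (Cons a as)
  show ?case
  proof (cases as)
    case Nil
    then show ?thesis using Cons.prems by (intro exI[of _ a] exI[of _ 1]) simp
  next
    case (Cons c cs)
    then obtain N N' where N: "coprime N N'" "1 \<le> N'" "N' < N" "neg_cfrac as = of_int N / of_int N'"
      "\<And>u v. hull_steps u v as = smul N v - smul N' u"
      using Cons.IH Cons.prems by auto
    have a: "2 \<le> a" using Cons.prems by simp
    have "2 * N \<le> a * N" using a N by (intro mult_right_mono) auto
    then have "N < a * N - N'" using N(3) by linarith
    moreover have "neg_cfrac (a # as) = of_int (a * N - N') / of_int N"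
    proof -
      have "neg_cfrac (a # as) = of_int a - 1 / neg_cfrac as" by (simp add: \<open>as = c # cs\<close>)
      then show ?thesis using N(2,3) unfolding N(4) by (simp add: field_simps)
    qed
    moreover have "coprime (a * N - N') N"
    proof (rule coprimeI)
      fix d assume d: "d dvd a * N - N'" "d dvd N"
      then have "d dvd a * N - (a * N - N')" by (metis dvd_diff dvd_mult)
      then have "d dvd N'" by (simp only: diff_diff_eq2 add_diff_cancel_left')
      then show "is_unit d" using coprime_common_divisor[OF N(1)] d(2) by simp
    qed
    moreover have "hull_steps u v (a # as) = smul (a * N - N') v - smul N u" for u v
      by (simp add: N(5) prod_eq_iff smul_def algebra_simps)
    ultimately show ?thesis using N(2,3) by (intro exI[of _ "a * N - N'"] exI[of _ N] conjI allI) auto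
  qed
qed simp

text \<open>The two reduced fractions \<open>(N - N') / N\<close> and \<open>P / Q\<close> agree.\<close>

lemma hull_point_last:
  assumes as: "as \<noteq> []" "hd as = 1" "\<forall>a\<in>set (tl as). 1 < a"
    and PQ: "coprime P Q" "0 \<le> P" "P < Q" "neg_cfrac as = of_int P / of_int Q"
  shows "2 \<le> length as" "hull_point ((!) as) (length as) = (P, Q)"
proof -
  obtain bs where bs: "as = 1 # bs" using as by (cases as) auto
  have ne: "bs \<noteq> []"
  proof
    assume "bs = []"
    then have "of_int P = (of_int Q :: rat)" using PQ by (simp add: bs field_simps)
    then show False using PQ by simp
  qed
  then show "2 \<le> length as" by (cases bs) (auto simp: bs)
  obtain N N' where N: "coprime N N'" "1 \<le> N'" "N' < N" "neg_cfrac bs = of_int N / of_int N'"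
      "\<And>u v. hull_steps u v bs = smul N v - smul N' u"
    using neg_cfrac_hull_steps[OF ne] as by (auto simp: bs)
  have "neg_cfrac as = of_int (N - N') / of_int N"
  proof -
    have "neg_cfrac as = 1 - 1 / neg_cfrac bs" using ne by (cases bs) (auto simp: bs)
    then show ?thesis using N(2,3) unfolding N(4) by (simp add: field_simps)
  qed
  then have "of_int (N - N') / of_int N = (of_int P / of_int Q :: rat)" by (simp only: PQ(4))
  then have "of_int (N - N') * of_int Q = (of_int P * of_int N :: rat)"
    by (subst (asm) frac_eq_eq) (use PQ(2,3) N(2,3) in simp_all)
  then have "(N - N') * Q = P * N" by (simp only: of_int_eq_iff of_int_mult[symmetric])
  moreover have "coprime (N - N') N"
  proof (rule coprimeI)
    fix d assume d: "d dvd N - N'" "d dvd N"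
    then have "d dvd N - (N - N')" by (metis dvd_diff)
    then have "d dvd N'" by simp
    then show "is_unit d" using coprime_common_divisor[OF N(1)] d(2) by simp
  qed
  ultimately have "N - N' = P \<and> N = Q"
    using coprime_crossproduct_int[of "N - N'" N P Q] PQ(1-3) N by (simp add: mult.commute)
  moreover have "hull_point ((!) as) (length as) = hull_steps (1, 0) (1, 1) bs"
    using hull_steps_hull_point[of bs "(!) as" 0] by (simp add: bs)
  ultimately show "hull_point ((!) as) (length as) = (P, Q)" by (auto simp: N(5) smul_def)
qed

lemma hull_points_hilbert_chain:
  assumes "2 \<le> r" "\<And>i. 1 \<le> i \<Longrightarrow> i < r \<Longrightarrow> 2 \<le> b i"
  shows "hilbert_chain (hull_point b) b r"
proof
  fix i assume "1 \<le> i" "i < r"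
  then show "hull_point b (i + 1) = smul (b i) (hull_point b i) - hull_point b (i - 1)" by (cases i) auto
qed (use assms in \<open>auto simp: det2_def\<close>)

lemma cone_hull_two:
  assumes "0 < Q"
  shows "convex_cone hull {real_vec (1, 0), real_vec (P, Q)} =
    {(x, y). 0 \<le> y \<and> 0 \<le> x * of_int Q - y * of_int P}"
    (is "?L = ?R")
proof
  show "?L \<subseteq> ?R"
  proof (rule hull_minimal)
    show "{real_vec (1, 0), real_vec (P, Q)} \<subseteq> ?R" using assms by (auto simp: real_vec_def)
    have add: "a + b \<in> ?R" if "a \<in> ?R" "b \<in> ?R" for a b
      using that by (auto simp: case_prod_beta algebra_simps)
    have scale: "c *\<^sub>R a \<in> ?R" if "a \<in> ?R" "0 \<le> c" for a c
    proof -
      have "0 \<le> c * (fst a * of_int Q - snd a * of_int P)" "0 \<le> c * snd a"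
        using that by (auto intro!: mult_nonneg_nonneg simp: case_prod_beta)
      then show ?thesis by (simp add: case_prod_beta algebra_simps)
    qed
    have "0 \<in> ?R" by (simp add: case_prod_beta)
    then show "convex_cone ?R" unfolding convex_cone_iff by (intro conjI ballI allI impI add scale)
  qed
  show "?R \<subseteq> ?L"
  proof
    fix a assume a: "a \<in> ?R"
    define t where "t = snd a / of_int Q"
    define s where "s = (fst a * of_int Q - snd a * of_int P) / of_int Q"
    have st: "0 \<le> s" "0 \<le> t" using a assms by (auto simp: s_def t_def case_prod_beta)
    have "s *\<^sub>R real_vec (1, 0) + t *\<^sub>R real_vec (P, Q) \<in> ?L"
      by (intro convex_cone_hull_add convex_cone_hull_mul hull_inc st) auto
    moreover have "a = s *\<^sub>R real_vec (1, 0) + t *\<^sub>R real_vec (P, Q)"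
      using assms by (simp add: real_vec_def s_def t_def prod_eq_iff field_simps)
    ultimately show "a \<in> ?L" by simp
  qed
qed

text \<open>The real linear map of the normal form and its integral version \<open>lin2\<close> act compatibly on lattice points.\<close>

lemma normal_form_lattice:
  assumes "cone_normal_form C P Q" and gen: "semigroup_generators C \<gamma>"
  obtains a b c d where "\<bar>a * d - b * c\<bar> = 1"
    "range (toric_weight (\<lambda>k. lin2 a b c d (\<gamma> k))) = {z. 0 \<le> det2 (1, 0) z \<and> 0 \<le> det2 z (P, Q)}"
proof -
  have Q: "0 < Q" using assms(1) by (auto simp: cone_normal_form_def)
  obtain a b c d where det: "\<bar>a * d - b * c\<bar> = 1"
    and F: "(\<lambda>(x, y). (of_int a * x + of_int b * y, of_int c * x + of_int d * y)) ` C =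
      convex_cone hull {real_vec (1, 0), real_vec (P, Q)}"
    using assms(1) unfolding cone_normal_form_def unimodularly_equivalent_def by blast
  define f :: "real \<times> real \<Rightarrow> real \<times> real"
    where "f = (\<lambda>(x, y). (of_int a * x + of_int b * y, of_int c * x + of_int d * y))"
  define \<delta> where "\<delta> = real_of_int (a * d - b * c)"
  have "a * d - b * c \<noteq> 0" using det by auto
  then have "\<delta> \<noteq> 0" unfolding \<delta>_def of_int_eq_0_iff .
  have "inj f"
  proof (rule injI)
    fix v w assume "f v = f w"
    then have e: "of_int a * (fst v - fst w) + of_int b * (snd v - snd w) = 0"
      "of_int c * (fst v - fst w) + of_int d * (snd v - snd w) = 0"
      by (auto simp: f_def case_prod_beta algebra_simps)
    have "\<delta> * (fst v - fst w) = of_int d * (of_int a * (fst v - fst w) + of_int b * (snd v - snd w))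
        - of_int b * (of_int c * (fst v - fst w) + of_int d * (snd v - snd w))"
      "\<delta> * (snd v - snd w) = of_int a * (of_int c * (fst v - fst w) + of_int d * (snd v - snd w))
        - of_int c * (of_int a * (fst v - fst w) + of_int b * (snd v - snd w))"
      by (simp_all add: \<delta>_def algebra_simps)
    then have "\<delta> * (fst v - fst w) = 0" "\<delta> * (snd v - snd w) = 0" by (simp_all only: e)
    then show "v = w" using \<open>\<delta> \<noteq> 0\<close> by (simp add: prod_eq_iff)
  qed
  have f_lin: "f (real_vec z) = real_vec (lin2 a b c d z)" for z
    by (simp add: f_def real_vec_def lin2_def)
  have mem: "lin2 a b c d z \<in> {z. 0 \<le> det2 (1, 0) z \<and> 0 \<le> det2 z (P, Q)} \<longleftrightarrow> z \<in> lattice_points C" for z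
  proof -
    have "z \<in> lattice_points C \<longleftrightarrow> f (real_vec z) \<in> f ` C"
      using inj_image_mem_iff[OF \<open>inj f\<close>] by (simp add: lattice_points_def)
    also have "\<dots> \<longleftrightarrow> real_vec (lin2 a b c d z) \<in> {(x, y). 0 \<le> y \<and> 0 \<le> x * of_int Q - y * of_int P}"
      unfolding f_lin F[folded f_def] cone_hull_two[OF Q] by (rule refl)
    also have "\<dots> \<longleftrightarrow> lin2 a b c d z \<in> {z. 0 \<le> det2 (1, 0) z \<and> 0 \<le> det2 z (P, Q)}"
      unfolding real_vec_def det2_def
      by (simp add: of_int_mult[symmetric] of_int_diff[symmetric] del: of_int_mult of_int_diff)
    finally show ?thesis by blast
  qed
  have surj: "surj (lin2 a b c d)" using lin2_bij[OF det] bij_is_surj by blast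
  have "range (toric_weight (\<lambda>k. lin2 a b c d (\<gamma> k))) = lin2 a b c d ` lattice_points C"
    using gen unfolding semigroup_generators_def toric_weight_lin2 by (metis image_image)
  also have "\<dots> = {z. 0 \<le> det2 (1, 0) z \<and> 0 \<le> det2 z (P, Q)}"
  proof (intro equalityI subsetI)
    fix w assume w: "w \<in> {z. 0 \<le> det2 (1, 0) z \<and> 0 \<le> det2 z (P, Q)}"
    obtain z where "w = lin2 a b c d z" using surj by (metis surjE)
    then show "w \<in> lin2 a b c d ` lattice_points C" using w mem by blast
  qed (use mem in blast)
  finally show thesis using that det by blast
qed

text \<open>For \<open>r \<ge> 5\<close> the conditions on the pairs next to the two ends follow from those on the inner pairs: an entry
of an admissible pair is \<open>2\<close>, \<open>3\<close> or \<open>4\<close>, and the end entry is \<open>2\<close>.\<close>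

lemma admissible_list:
  assumes "2 \<le> length as" "as ! 0 = (1 :: int)"
  shows "(\<forall>m<length as. admissible ((!) as) (length as) m) \<longleftrightarrow>
     as = [1, 2] \<or>
     as = [1, 2, 2] \<or>
     as \<in> {[1, 2, 2, 2], [1, 2, 3, 2], [1, 2, 4, 2]} \<or>
     (length as \<ge> 5 \<and> as ! 0 = 1 \<and> as ! 1 = 2 \<and> last as = 2 \<and>
      (\<forall>i \<in> {3..length as - 2}.
         (as ! (i - 1), as ! i) \<in> {(2, 2), (2, 3), (2, 4), (3, 2), (4, 2)}))"
proof -
  consider x where "as = [1, x]" | x y where "as = [1, x, y]" | x y z where "as = [1, x, y, z]" | "5 \<le> length as"
  proof -
    obtain x bs where bs: "as = 1 # x # bs" using assms by (cases as; cases "tl as") auto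
    show thesis
    proof (cases bs)
      case Nil then show ?thesis using that(1) bs by blast
    next
      case (Cons y cs)
      show ?thesis
      proof (cases cs)
        case Nil then show ?thesis using that(2) bs Cons by blast
      next
        case c: (Cons z ds)
        show ?thesis
        proof (cases ds)
          case Nil then show ?thesis using that(3) bs Cons c by blast
        next
          case (Cons w es) then show ?thesis using that(4) bs c \<open>bs = y # cs\<close> by simp
        qed
      qed
    qed
  qed
  then show ?thesis
  proof cases
    case 1 then show ?thesis by (auto simp: admissible_def numeral_eq_Suc All_less_Suc)
  next
    case 2 then show ?thesis by (auto simp: admissible_def numeral_eq_Suc All_less_Suc)
  next
    case 3 then show ?thesis by (auto simp: admissible_def eval_nat_numeral All_less_Suc)
  next
    case 4
    let ?r = "length as" and ?L = "{(2, 2), (2, 3), (2, 4), (3, 2), (4, 2)} :: (int \<times> int) set"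
    have last: "last as = as ! (?r - 1)" using 4 by (subst last_conv_nth) auto
    have short: "\<not> (as = [1, 2] \<or> as = [1, 2, 2] \<or> as \<in> {[1, 2, 2, 2], [1, 2, 3, 2], [1, 2, 4, 2]})"
      using 4 by auto
    have "(\<forall>m<?r. admissible ((!) as) ?r m) \<longleftrightarrow> as ! 1 = 2 \<and> as ! (?r - 1) = 2 \<and>
      (\<forall>i \<in> {3..?r - 2}. (as ! (i - 1), as ! i) \<in> ?L)" (is "?ok \<longleftrightarrow> ?rhs")
    proof
      assume ok: ?ok
      have "as ! 1 = 2" using ok[rule_format, of 0] 4 by (force simp: admissible_def)
      moreover have "as ! (?r - 1) = 2" using ok[rule_format, of "?r - 1"] 4 by (simp add: admissible_def split: if_splits)
      moreover have "(as ! (i - 1), as ! i) \<in> ?L" if "i \<in> {3..?r - 2}" for i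
      proof -
        have "i - 1 < ?r" "i - 1 \<noteq> 0" "i - 1 + 1 \<noteq> ?r" "i - 1 + 1 = i" using that 4 by auto
        then show ?thesis using ok[rule_format, of "i - 1"] unfolding admissible_def by (simp only: if_False)
      qed
      ultimately show ?rhs by blast
    next
      assume R: ?rhs
      have pair: "(as ! (m - 1), as ! m) \<in> ?L" if "3 \<le> m" "m \<le> ?r - 2" for m
        using R that by (meson atLeastAtMost_iff)
      show ?ok
      proof (intro allI impI)
        fix m assume m: "m < ?r"
        consider "m = 0" | "m = 1" | "2 \<le> m" "m + 3 \<le> ?r" | "m = ?r - 2" | "m = ?r - 1" using m by linarith
        then show "admissible ((!) as) ?r m"
        proof cases
          case 1 then show ?thesis using R by (simp add: admissible_def)
        next
          case 2
          have "as ! 2 \<in> {2, 3, 4}" using pair[of 3] 4 by auto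
          then show ?thesis using R 2 4 by (auto simp: admissible_def numeral_2_eq_2)
        next
          case 3 then show ?thesis using pair[of "m + 1"] by (simp add: admissible_def)
        next
          case m2: 4
          have "as ! (?r - 2) \<in> {2, 3, 4}" using pair[of "?r - 2"] 4 by auto
          moreover have "m + 1 = ?r - 1" "m \<noteq> 0" "m + 1 \<noteq> ?r" using m2 4 by auto
          ultimately show ?thesis using R m2 by (auto simp: admissible_def)
        next
          case 5
          then have "m + 1 = ?r" "m \<noteq> 0" using 4 by auto
          then show ?thesis using R 5 by (simp add: admissible_def)
        qed
      qed
    qed
    then show ?thesis using short 4 assms(2) unfolding last by argo
  qed
qed

theorem theorem1:
  fixes C :: "(real \<times> real) set"
    and \<gamma> :: "'n::finite \<Rightarrow> int \<times> int"
    and V :: "('k::alg_closed_field ^ 'n) set"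
    and as :: "int list"
  assumes "rational_cone2 C"
    and "semigroup_generators C \<gamma>"
    and "V = toric_surface \<gamma>"
    and "singular_locus V \<noteq> {}"
    and "associated_cfrac C as"
  shows "smooth_normalized_nash_blowup V \<longleftrightarrow>
     as = [1, 2] \<or>
     as = [1, 2, 2] \<or>
     as \<in> {[1, 2, 2, 2], [1, 2, 3, 2], [1, 2, 4, 2]} \<or>
     (length as \<ge> 5 \<and> as ! 0 = 1 \<and> as ! 1 = 2 \<and> last as = 2 \<and>
      (\<forall>i \<in> {3..length as - 2}.
         (as ! (i - 1), as ! i) \<in> {(2, 2), (2, 3), (2, 4), (3, 2), (4, 2)}))"
proof -
  obtain P Q where normal: "cone_normal_form C P Q" and as: "as \<noteq> []" "hd as = 1" "\<forall>a\<in>set (tl as). 1 < a"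
    and cf: "neg_cfrac as = of_int P / of_int Q"
    using assms(5) unfolding associated_cfrac_def by blast
  have PQ: "coprime P Q" "0 \<le> P" "P < Q" using normal by (auto simp: cone_normal_form_def)
  note hull_point = hull_point_last[OF as PQ cf]
  obtain a b c d where det: "\<bar>a * d - b * c\<bar> = 1"
    and gen: "range (toric_weight (\<lambda>k. lin2 a b c d (\<gamma> k))) = {z. 0 \<le> det2 (1, 0) z \<and> 0 \<le> det2 z (P, Q)}"
    by (rule normal_form_lattice[OF normal assms(2)])
  have as2: "2 \<le> as ! i" if "1 \<le> i" "i < length as" for i
  proof -
    have "as ! i = tl as ! (i - 1)" "i - 1 < length (tl as)" using that by (auto simp: nth_tl)
    then have "as ! i \<in> set (tl as)" by simp
    then show ?thesis using as(3) by force
  qed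
  interpret hilbert_chain "hull_point ((!) as)" "(!) as" "length as"
    by (rule hull_points_hilbert_chain[OF hull_point(1) as2])
  have "V = toric_surface (\<lambda>k. lin2 a b c d (\<gamma> k))" using assms(3) by (simp only: toric_surface_lin2[OF det])
  then have "smooth_normalized_nash_blowup V \<longleftrightarrow> (\<forall>m<length as. admissible ((!) as) (length as) m)"
    by (intro nash_smooth_iff_admissible) (use gen in \<open>simp_all add: lattice_cone_def hull_point(2)\<close>)
  also have "as ! 0 = 1" using as by (simp add: hd_conv_nth)
  note admissible_list[OF hull_point(1) this]
  finally show ?thesis .
qed

end
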